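(* Let $T>0$, $I=[0,T]$, and let $\mathcal{H}$ be a separable (real) Hilbert space with inner product $\langle\cdot,\cdot\rangle$ and norm $\|\cdot\|$. For every $t\in I$ let $A(t):D(A(t))\subset\mathcal{H}\rightrightarrows\mathcal{H}$ be a maximal monotone operator, and suppose: (i) there exists a function $\rho:I\to[0,+\infty[$ which is right continuous on $[0,T[$ and nondecreasing, with $\rho(0)=0$ and $\rho(T)<+\infty$, such that $$\mathrm{dis}(A(t),A(s))\le d\rho(]s,t])=\rho(t)-\rho(s)\quad\text{for } 0\le s\le t\le T;$$ (ii) there exists a nonnegative real constant $c$ such that $\|A^0(t,x)\|\le c(1+\|x\|)$ for all $t\in I$ and $x\in D(A(t))$. Let $f:I\times\mathcal{H}\to\mathcal{H}$ be such that for every fixed $x\in\mathcal{H}$ the map $f(\cdot,x)$ is $(\mathcal{B}(I),\mathcal{B}(\mathcal{H}))$-measurable, and suppose: (iii) there exists a nonnegative real constant $m$ such that $\|f(t,x)\|\le m(1+\|x\|)$ for all $(t,x)\in I\times\mathcal{H}$; (iv) there exists $\alpha\in L^1(I,\mathbb{R};\lambda)$ such that $\|f(t,x)-f(t,y)\|\le\alpha(t)\|x-y\|$ for all $(t,x,y)\in I\times\mathcal{H}\times\mathcal{H}$. Let $\nu:=\lambda+d\rho$. Then for any $u_0\in D(A(0))$ there exists a unique BVRC solution $u:I\to\mathcal{H}$ to the problem $$ (P_f)\quad \begin{cases} -\dfrac{du}{d\nu}(t)\in A(t)u(t)+f(t,u(t))\,\dfrac{d\lambda}{d\nu}(t)\quad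 \nu\text{-a.e. } t\in I;\\[2mm] u(t)\in D(A(t))\quad\forall t\in I;\\ u(0)=u_0. \end{cases} $$
   Context: Notation and definitions. - $\lambda$ is the Lebesgue measure on $I=[0,T]$; $d\rho$ is the Stieltjes measure on $I$ associated with $\rho$ (so $d\rho(]s,t])=\rho(t)-\rho(s)$ for $0\le s\le t\le T$). $\frac{d\lambda}{d\nu}$ is the density of $\lambda$ with respect to $\nu=\lambda+d\rho$. $\mathcal{B}(I)$ and $\mathcal{B}(\mathcal{H})$ are the Borel $\sigma$-algebras of $I$ and $\mathcal{H}$. - For a set-valued map $A:\mathcal{H}\rightrightarrows\mathcal{H}$, $D(A)=\{x: A(x)\ne\emptyset\}$ is its domain and $Gr(A)=\{(x,y): y\in A(x)\}$ its graph. $A$ is monotone if $\langle y_1-y_2,x_1-x_2\rangle\ge 0$ for all $(x_1,y_1),(x_2,y_2)\in Gr(A)$; it is maximal monotone if it is monotone and its graph is not strictly contained in the graph of another monotone operator. If $A$ is maximal monotone, then for $x\in D(A)$ the set $A(x)$ is nonempty, closed and convex, and $A^0(x)$ denotes the projection of the origin on $A(x)$ (the element of minimal norm). $A^0(t,x)$ denotes this element for the operator $A(t)$, and $A(t)u(t)$ denotes the value of the operator $A(t)$ at $u(t)$. - Vladimirov's pseudo-distance between maximal monotone operators $A$ and $B$ of $\mathcal{H}$ is $$\mathrm{dis}(A,B)=\sup\Big\{\frac{\langle y-y',x'-x\rangle}{1+\|y\|+\|y'\|}:\ (x,y)\in Gr(A),\ (x',y')\in Gr(B)\Big\}\in[0,+\infty].$$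 - A mapping $u:I\to\mathcal{H}$ has bounded variation if $\sup\sum_{k=1}^n\|u(t_k)-u(t_{k-1})\|<+\infty$, the supremum being over all finite sequences $t_0<t_1<\dots<t_n$ in $I$. It is BVRC if it is right continuous with bounded variation. For a BVRC mapping $u$, $du$ denotes its differential ($\mathcal{H}$-valued) measure, which satisfies $u(t)=u(s)+\int_{]s,t]}du$ for all $s\le t$ in $I$. - $\frac{du}{d\nu}$ denotes the density of the vector measure $du$ with respect to $\nu$. That $v\in L^1(I,\mathcal{H};\nu)$ is a density of $du$ with respect to $\nu$ means $u(t)=u(0)+\int_{]0,t]}v\,d\nu$ for all $t\in I$. A BVRC solution of $(P_f)$ is a BVRC mapping $u:I\to\mathcal{H}$ whose differential measure $du$ has a density $\frac{du}{d\nu}$ with respect to $\nu$ and which satisfies the three conditions of $(P_f)$. *)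

theory Defs
  imports "HOL-Analysis.Analysis"
begin

subsection \<open>Set-valued operators\<close>

definition op_domain :: "('a \<Rightarrow> 'b set) \<Rightarrow> 'a set" where
  "op_domain A = {x. A x \<noteq> {}}"

definition op_graph :: "('a \<Rightarrow> 'b set) \<Rightarrow> ('a \<times> 'b) set" where
  "op_graph A = {(x, y). y \<in> A x}"

definition monotone_op :: "('a::real_inner \<Rightarrow> 'a set) \<Rightarrow> bool" where
  "monotone_op A \<longleftrightarrow>
     (\<forall>(x1, y1) \<in> op_graph A. \<forall>(x2, y2) \<in> op_graph A. (y1 - y2) \<bullet> (x1 - x2) \<ge> 0)"

definition maximal_monotone :: "('a::real_inner \<Rightarrow> 'a set) \<Rightarrow> bool" where
  "maximal_monotone A \<longleftrightarrow>
     monotone_op A \<and> \<not> (\<exists>B. monotone_op B \<and> op_graph A \<subset> op_graph B)"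

text \<open>
  The element \<open>A\<^sup>0(x)\<close> of minimal norm of \<open>A x\<close>. It is meaningful only where it exists
  and is unique, in particular for \<open>A\<close> maximal monotone on a Hilbert space and
  \<open>x \<in> op_domain A\<close>. (\<open>closest_point\<close> of the library is restricted to Heine-Borel spaces.)
\<close>
definition min_section :: "('a::real_inner \<Rightarrow> 'a set) \<Rightarrow> 'a \<Rightarrow> 'a" where
  "min_section A x = arg_min_on norm (A x)"

text \<open>
  Vladimirov's pseudo-distance. The supremum is taken in \<open>ereal\<close>; by \<open>vladimirov_dis_nonneg\<close>
  it belongs to \<open>[0, \<infinity>]\<close> for maximal monotone operators.
\<close>
definition vladimirov_dis :: "('a::real_inner \<Rightarrow> 'a set) \<Rightarrow> ('a \<Rightarrow> 'a set) \<Rightarrow> ereal" where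
  "vladimirov_dis A B =
     (SUP ((x, y), (x', y')) \<in> op_graph A \<times> op_graph B.
        ereal (((y - y') \<bullet> (x' - x)) / (1 + norm y + norm y')))"

lemma maximal_monotone_mem:
  assumes "maximal_monotone A"
    and "\<And>x' y'. y' \<in> A x' \<Longrightarrow> (y - y') \<bullet> (x - x') \<ge> 0"
  shows "y \<in> A x"
proof (rule ccontr)
  assume n: "y \<notin> A x"
  let ?B = "A(x := insert y (A x))"
  have sym: "(y' - y) \<bullet> (x' - x) \<ge> 0" if "y' \<in> A x'" for x' y'
    using assms(2)[OF that] by (simp add: inner_diff algebra_simps)
  have m: "(y1 - y2) \<bullet> (x1 - x2) \<ge> 0" if "y1 \<in> A x1" "y2 \<in> A x2" for x1 x2 y1 y2
    using assms(1) that by (auto simp: maximal_monotone_def monotone_op_def op_graph_def)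
  have "monotone_op ?B"
    unfolding monotone_op_def op_graph_def
    using m sym assms(2) by (auto split: if_splits)
  moreover have "op_graph A \<subset> op_graph ?B"
    using n by (auto simp: op_graph_def)
  ultimately show False
    using assms(1) by (auto simp: maximal_monotone_def)
qed

lemma vladimirov_dis_nonneg:
  assumes A: "maximal_monotone A" and B: "maximal_monotone B"
  shows "vladimirov_dis A B \<ge> 0"
proof (rule ccontr)
  assume "\<not> vladimirov_dis A B \<ge> 0"
  then have neg: "vladimirov_dis A B < 0" by simp
  have *: "(y' - y) \<bullet> (x' - x) > 0" if "y \<in> A x" "y' \<in> B x'" for x y x' y'
  proof -
    have "ereal (((y - y') \<bullet> (x' - x)) / (1 + norm y + norm y')) \<le> vladimirov_dis A B"
      unfolding vladimirov_dis_def
      by (rule SUP_upper2[of "((x, y), (x', y'))"]) (use that in \<open>auto simp: op_graph_def\<close>)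
    also note neg
    finally have "((y - y') \<bullet> (x' - x)) / (1 + norm y + norm y') < 0"
      by (simp add: zero_ereal_def)
    moreover have "1 + norm y + norm y' > 0"
      by (intro add_pos_nonneg) auto
    ultimately have "(y - y') \<bullet> (x' - x) < 0"
      by (meson divide_nonneg_pos not_le)
    then show ?thesis
      by (metis inner_minus_left minus_diff_eq neg_0_less_iff_less)
  qed
  obtain x' y' where b: "y' \<in> B x'"
    using maximal_monotone_mem[OF B, of 0 0] by blast
  have "y' \<in> A x'"
  proof (rule maximal_monotone_mem[OF A])
    fix x y assume "y \<in> A x"
    from *[OF this b] show "(y' - y) \<bullet> (x' - x) \<ge> 0" by simp
  qed
  with *[OF this b] show False by simp
qed


subsection \<open>Measures on \<open>[0,T]\<close>\<close>

definition lebesgue_measure_I :: "real \<Rightarrow> real measure" where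
  "lebesgue_measure_I T = restrict_space lborel {0..T}"

text \<open>
  \<open>\<rho>\<close> is extended to the real line by its values at the end points of \<open>[0,T]\<close>; hence
  \<open>{0}\<close> has mass zero, in accordance with the normalisation \<open>\<rho> 0 = 0\<close>.
\<close>
definition stieltjes_measure_I :: "real \<Rightarrow> (real \<Rightarrow> real) \<Rightarrow> real measure" where
  "stieltjes_measure_I T \<rho> =
     restrict_space (interval_measure (\<lambda>t. \<rho> (max 0 (min T t)))) {0..T}"

definition sum_of_measures :: "'a measure \<Rightarrow> 'a measure \<Rightarrow> 'a measure" where
  "sum_of_measures M N = measure_of (space M) (sets M) (\<lambda>X. emeasure M X + emeasure N X)"

definition nu_measure :: "real \<Rightarrow> (real \<Rightarrow> real) \<Rightarrow> real measure" where
  "nu_measure T \<rho> = sum_of_measures (lebesgue_measure_I T) (stieltjes_measure_I T \<rho>)"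

definition lebesgue_density :: "real \<Rightarrow> (real \<Rightarrow> real) \<Rightarrow> real \<Rightarrow> real" where
  "lebesgue_density T \<rho> t = enn2real (RN_deriv (nu_measure T \<rho>) (lebesgue_measure_I T) t)"

lemma sets_sum_of_measures [simp]: "sets (sum_of_measures M N) = sets M"
  by (simp add: sum_of_measures_def)

lemma emeasure_sum_of_measures:
  assumes "sets N = sets M" "X \<in> sets M"
  shows "emeasure (sum_of_measures M N) X = emeasure M X + emeasure N X"
  unfolding sum_of_measures_def
proof (rule emeasure_measure_of_sigma)
  show "sigma_algebra (space M) (sets M)" ..
  show "positive (sets M) (\<lambda>X. emeasure M X + emeasure N X)"
    by (simp add: positive_def)
  show "countably_additive (sets M) (\<lambda>X. emeasure M X + emeasure N X)"
    using assms(1) by (auto simp: countably_additive_def suminf_add[symmetric] suminf_emeasure)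
qed (rule assms)

lemma sets_nu_measure: "sets (nu_measure T \<rho>) = sets (restrict_space borel {0..T})"
  by (simp add: nu_measure_def lebesgue_measure_I_def sets_restrict_space)

lemma emeasure_stieltjes_measure_I_Ioc:
  assumes mono: "mono_on {0..T} \<rho>"
    and rc: "\<And>t. t \<in> {0..<T} \<Longrightarrow> continuous (at_right t) \<rho>"
    and st: "0 \<le> s" "s \<le> t" "t \<le> T"
  shows "emeasure (stieltjes_measure_I T \<rho>) {s<..t} = ennreal (\<rho> t - \<rho> s)"
proof -
  let ?F = "\<lambda>t. \<rho> (max 0 (min T t))"
  have T: "0 \<le> T" using st by simp
  have F_mono: "?F x \<le> ?F y" if "x \<le> y" for x y
    using T that by (intro mono_onD[OF mono]) auto
  have F_rc: "continuous (at_right a) ?F" for a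
  proof -
    consider "a < 0" | "0 \<le> a" "a < T" | "T \<le> a" by linarith
    then show ?thesis
    proof cases
      case 1
      have "eventually (\<lambda>x. x < 0) (at_right a)"
        using 1 by (rule eventually_at_right_real[THEN eventually_mono]) simp
      then have "eventually (\<lambda>x. \<rho> 0 = ?F x) (at_right a)"
        by eventually_elim (use T in auto)
      from Lim_transform_eventually[OF tendsto_const this] show ?thesis
        using 1 T by (simp add: continuous_within)
    next
      case 2
      have "eventually (\<lambda>x. a < x \<and> x < T) (at_right a)"
        using eventually_at_right_real[OF 2(2)] by eventually_elim auto
      then have "eventually (\<lambda>x. \<rho> x = ?F x) (at_right a)"
        by eventually_elim (use 2 in auto)
      from Lim_transform_eventually[OF _ this] have "(?F \<longlongrightarrow> \<rho> a) (at_right a)"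
        using rc[of a] 2 by (simp add: continuous_within)
      then show ?thesis
        using 2 by (simp add: continuous_within)
    next
      case 3
      have "eventually (\<lambda>x. \<rho> T = ?F x) (at_right a)"
        using 3 T by (auto simp: eventually_at_filter)
      from Lim_transform_eventually[OF tendsto_const this] show ?thesis
        using 3 T by (simp add: continuous_within)
    qed
  qed
  have "emeasure (stieltjes_measure_I T \<rho>) {s<..t} = emeasure (interval_measure ?F) {s<..t}"
    unfolding stieltjes_measure_I_def
    by (rule emeasure_restrict_space) (use st in auto)
  also have "\<dots> = ennreal (?F t - ?F s)"
    using st by (intro emeasure_interval_measure_Ioc F_mono F_rc) auto
  finally show ?thesis
    using st by simp
qed


subsection \<open>BVRC mappings, densities and solutions\<close>

definition bounded_variation_on :: "real set \<Rightarrow> (real \<Rightarrow> 'a::real_normed_vector) \<Rightarrow> bool" where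
  "bounded_variation_on I u \<longleftrightarrow>
     bdd_above {\<Sum>k=1..n. norm (u (\<tau> k) - u (\<tau> (k - 1))) | (n::nat) (\<tau>::nat \<Rightarrow> real).
                  strict_mono_on {0..n} \<tau> \<and> \<tau> ` {0..n} \<subseteq> I}"

definition BVRC :: "real \<Rightarrow> (real \<Rightarrow> 'a::real_normed_vector) \<Rightarrow> bool" where
  "BVRC T u \<longleftrightarrow>
     bounded_variation_on {0..T} u \<and> (\<forall>t \<in> {0..<T}. continuous (at_right t) u)"

text \<open>\<open>v\<close> is a density, with respect to \<open>\<nu>\<close>, of the differential measure of \<open>u\<close>.\<close>
definition is_diff_density ::
    "real \<Rightarrow> real measure \<Rightarrow> (real \<Rightarrow> 'a::{banach, second_countable_topology}) \<Rightarrow> (real \<Rightarrow> 'a) \<Rightarrow> bool"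
  where
  "is_diff_density T \<nu> u v \<longleftrightarrow>
     integrable \<nu> v \<and> (\<forall>t \<in> {0..T}. u t = u 0 + set_lebesgue_integral \<nu> {0<..t} v)"

definition BVRC_solution ::
    "real \<Rightarrow> (real \<Rightarrow> real) \<Rightarrow>
     (real \<Rightarrow> 'a::{real_inner, banach, second_countable_topology} \<Rightarrow> 'a set) \<Rightarrow>
     (real \<Rightarrow> 'a \<Rightarrow> 'a) \<Rightarrow> 'a \<Rightarrow> (real \<Rightarrow> 'a) \<Rightarrow> bool"
  where
  "BVRC_solution T \<rho> A f u0 u \<longleftrightarrow>
     BVRC T u \<and>
     (\<exists>v. is_diff_density T (nu_measure T \<rho>) u v \<and>
        (AE t in nu_measure T \<rho>.
           - v t \<in> (\<lambda>y. y + lebesgue_density T \<rho> t *\<^sub>R f t (u t)) ` A t (u t))) \<and>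
     (\<forall>t \<in> {0..T}. u t \<in> op_domain (A t)) \<and>
     u 0 = u0"

end

theory Submission
  imports Defs
begin

text \<open>
  Put \<open>\<theta> t = t + \<rho> t\<close>, so that \<open>\<nu>\<close> gives \<open>]s,t]\<close> the mass \<open>\<theta> t - \<theta> s\<close>, and let the \<open>n\<close>-th grid
  consist of the points where \<open>\<theta>\<close> first reaches a multiple of \<open>\<theta> T / 2\<^sup>n\<close>. The grids are nested and
  between two consecutive points \<open>\<theta>\<close> oscillates by at most \<open>\<theta> T / 2\<^sup>n\<close>: a larger jump sits at a right end point.
  The implicit Euler schemes on these grids, which exist by Minty's theorem, are uniformly Lipschitz
  with respect to \<open>\<theta>\<close>, and comparing a scheme with a finer one shows that they converge uniformly.
  If \<open>u\<close> is the limit, the difference quotients of \<open>U t = u t + \<integral>\<^sub>0\<^sup>t f(r, u r) dr\<close> with respect to \<open>\<theta>\<close> along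
  the grids form an \<open>L\<^sup>2\<close>-bounded martingale. Hence they converge \<open>\<nu>\<close>-almost everywhere along a subsequence to
  a density of \<open>dU\<close>, and the monotonicity inequalities of the schemes, summed over one grid
  interval, pass to the limit and give the inclusion.
  Uniqueness follows from \<open>\<parallel>D t\<parallel>\<^sup>2 \<le> 2 \<integral> \<langle>D, dD\<rangle>\<close> for the difference \<open>D\<close> of two solutions, and Gronwall's lemma.
\<close>

section \<open>Maximal monotone operators\<close>

text \<open>The obstacle is that \<open>\<rho>\<close> may jump: a step need not be short in
  \<open>\<theta>\<close>, however fine the grid, so errors measured by the size of a step do not
  tend to zero. The implicit scheme takes the operator at the right end point, and this saves the
  estimates. The defect of a fine step inside a coarse block is the product of its
  \<open>\<theta>\<close>-length and the \<open>\<theta>\<close>-distance between its right end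
  point and the time of comparison. Fine steps that end before the block does have total length at
  most \<open>eps n\<close>. For those that end with it, the distance is zero when schemes are
  compared at the end of the block, and it tends to zero when the inclusion is tested at a point
  \<open>t\<close> of shrinking blocks. Both summands of \<open>\<theta>\<close> matter:
  \<open>\<rho>\<close> dominates the pseudo-distance, which keeps the selections bounded uniformly
  in the step, and \<open>t\<close> dominates the integral of \<open>f\<close>. No convergence of
  the selections \<open>Z\<close> is established. Each pair of the graph of \<open>A t\<close> is
  tested on a fixed block, first in the limit of finer schemes and then, after division by the mass
  of the block, in the limit of smaller blocks.\<close>

lemma monotone_opD:
  assumes "monotone_op A" "y \<in> A x" "y' \<in> A x'"
  shows "0 \<le> (y - y') \<bullet> (x - x')"
  using assms by (auto simp: monotone_op_def op_graph_def)

lemma maximal_monotone_imp_monotone: "maximal_monotone A \<Longrightarrow> monotone_op A"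
  by (simp add: maximal_monotone_def)

text \<open>The form \<open>q1 + q2 - x1 \<bullet> y2 - x2 \<bullet> y1\<close> is affine in each of
  two hull points separately, and on two generators it is the monotonicity expression. Minimality of
  the hull is applied to one argument at a time; equal arguments then give
  \<open>2 * (q - x \<bullet> y)\<close>.\<close>

lemma monotone_hull_inner_le:
  fixes S :: "('a::real_inner \<times> 'a) set"
  assumes mono: "\<And>x y x' y'. (x, y) \<in> S \<Longrightarrow> (x', y') \<in> S \<Longrightarrow> 0 \<le> (y - y') \<bullet> (x - x')"
    and mem: "(x, y, q) \<in> convex hull ((\<lambda>(x, y). (x, y, x \<bullet> y)) ` S)"
  shows "x \<bullet> y \<le> q"
proof -
  let ?G = "(\<lambda>(x, y). (x, y, x \<bullet> y)) ` S"
  have half: "q1 + a \<bullet> b - x1 \<bullet> b - a \<bullet> y1 \<ge> 0"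
    if "(a, b) \<in> S" and m: "(x1, y1, q1) \<in> convex hull ?G" for a b x1 y1 q1
  proof -
    let ?F = "\<lambda>p :: 'a \<times> 'a \<times> real. snd (snd p) + a \<bullet> b - fst p \<bullet> b - a \<bullet> fst (snd p)"
    let ?H = "{p. 0 \<le> ?F p}"
    have "convex ?H"
    proof (rule convexI)
      fix p p' and u v :: real
      assume h: "p \<in> ?H" "p' \<in> ?H" and uv: "0 \<le> u" "0 \<le> v" "u + v = 1"
      have "0 \<le> u * ?F p + v * ?F p'"
        using h uv by (intro add_nonneg_nonneg mult_nonneg_nonneg) auto
      also have "\<dots> = ?F (u *\<^sub>R p + v *\<^sub>R p') + (u + v - 1) * (a \<bullet> b)"
        by (simp add: inner_add_left inner_add_right algebra_simps)
      finally show "u *\<^sub>R p + v *\<^sub>R p' \<in> ?H" using uv by simp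
    qed
    moreover have "?G \<subseteq> ?H"
      using mono \<open>(a, b) \<in> S\<close> by (fastforce simp: inner_diff algebra_simps inner_commute)
    ultimately have "convex hull ?G \<subseteq> ?H" by (rule hull_minimal[rotated])
    with m show ?thesis by auto
  qed
  let ?F = "\<lambda>p :: 'a \<times> 'a \<times> real. q + snd (snd p) - x \<bullet> fst (snd p) - fst p \<bullet> y"
  let ?H = "{p. 0 \<le> ?F p}"
  have "convex ?H"
  proof (rule convexI)
    fix p p' and u v :: real
    assume h: "p \<in> ?H" "p' \<in> ?H" and uv: "0 \<le> u" "0 \<le> v" "u + v = 1"
    have "0 \<le> u * ?F p + v * ?F p'"
      using h uv by (intro add_nonneg_nonneg mult_nonneg_nonneg) auto
    also have "\<dots> = ?F (u *\<^sub>R p + v *\<^sub>R p') + (u + v - 1) * q"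
      by (simp add: inner_add_left inner_add_right algebra_simps)
    finally show "u *\<^sub>R p + v *\<^sub>R p' \<in> ?H" using uv by simp
  qed
  moreover have "?G \<subseteq> ?H"
    using half[OF _ mem] by (fastforce simp: algebra_simps)
  ultimately have "convex hull ?G \<subseteq> ?H" by (rule hull_minimal[rotated])
  with mem show ?thesis by auto
qed

text \<open>Parallelogram identities and increasing squared norms deliver exactly this kind of
  bound: on squares, and in terms of the smaller index.\<close>

lemma Cauchy_if_norm_diff_squared_le:
  fixes X :: "nat \<Rightarrow> 'a::real_normed_vector"
  assumes "\<And>m n. m \<le> n \<Longrightarrow> (norm (X m - X n))\<^sup>2 \<le> b m" and "b \<longlonglongrightarrow> (0::real)"
  shows "Cauchy X"
proof (rule metric_CauchyI)
  fix e :: real assume "e > 0"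
  then have "eventually (\<lambda>n. b n < (e/2)\<^sup>2) sequentially"
    using assms(2) by (intro order_tendstoD) auto
  then obtain N where "b N < (e/2)\<^sup>2" by (auto simp: eventually_sequentially)
  then have *: "norm (X N - X n) < e/2" if "n \<ge> N" for n
    using assms(1)[OF that] \<open>e > 0\<close> by (meson le_less_trans less_eq_real_def half_gt_zero power_less_imp_less_base)
  have "dist (X m) (X n) < e" if "m \<ge> N" "n \<ge> N" for m n
    using *[OF that(1)] *[OF that(2)] norm_triangle_ineq4[of "X N - X n" "X N - X m"]
    by (simp add: dist_norm)
  then show "\<exists>M. \<forall>m\<ge>M. \<forall>n\<ge>M. dist (X m) (X n) < e" by blast
qed

text \<open>
  \<open>- \<parallel>c\<parallel>\<^sup>2 - q\<close> is a strongly concave function on the convex hull \<open>K\<close> of the points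
  \<open>((x - y)/2, x \<bullet> y)\<close>, and it is nonpositive there by monotonicity. Strong concavity makes
  maximising sequences converge, and optimality of the limit is the required inequality.
  Neither weak compactness nor finite-dimensional reduction is needed.
\<close>
lemma monotone_set_extension:
  fixes S :: "('a::{real_inner, banach} \<times> 'a) set"
  assumes mono: "\<And>x y x' y'. (x, y) \<in> S \<Longrightarrow> (x', y') \<in> S \<Longrightarrow> 0 \<le> (y - y') \<bullet> (x - x')"
    and ne: "S \<noteq> {}"
  obtains x where "\<And>x' y'. (x', y') \<in> S \<Longrightarrow> (x + y') \<bullet> (x - x') \<le> 0"
proof -
  let ?G = "(\<lambda>(x, y). (x, y, x \<bullet> y)) ` S"
  define K where "K = convex hull ?G"
  define c :: "'a \<times> 'a \<times> real \<Rightarrow> 'a" where "c p = (1/2) *\<^sub>R (fst p - fst (snd p))" for p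
  define g :: "'a \<times> 'a \<times> real \<Rightarrow> real" where "g p = - (norm (c p))\<^sup>2 - snd (snd p)" for p
  have K: "convex K" unfolding K_def by simp
  have GK: "?G \<subseteq> K" unfolding K_def by (rule hull_subset)
  have g_le: "g p \<le> 0" if p: "p \<in> K" for p
  proof -
    obtain x y q where [simp]: "p = (x, y, q)" by (cases p)
    have "x \<bullet> y \<le> q"
      using monotone_hull_inner_le[of S x y q] mono p K_def by auto
    \<comment> \<open>Polarisation, as \<open>c p\<close> is half of \<open>x - y\<close>. With
      \<open>x \<bullet> y \<le> q\<close> it puts \<open>g p\<close> below minus a square.\<close>
    moreover have "(norm (c p))\<^sup>2 + x \<bullet> y = (norm ((1/2) *\<^sub>R (x + y)))\<^sup>2"
      unfolding c_def by (simp only: power2_norm_eq_inner)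
        (simp add: inner_add inner_diff inner_commute field_simps)
    ultimately have "- (norm (c p))\<^sup>2 \<le> q"
      using zero_le_power2[of "norm ((1/2) *\<^sub>R (x + y))"] by linarith
    then show ?thesis by (simp add: g_def)
  qed
  define s where "s = (SUP p\<in>K. g p)"
  have Kne: "K \<noteq> {}" using ne GK by auto
  have bdd: "bdd_above (g ` K)" by (rule bdd_aboveI2[where M=0]) (rule g_le)
  have g_s: "g p \<le> s" if "p \<in> K" for p
    unfolding s_def using that bdd by (rule cSUP_upper)
  have s0: "s \<le> 0" unfolding s_def using Kne g_le by (rule cSUP_least)
  have "\<exists>p\<in>K. s - 1 / real (Suc n) < g p" for n
    using less_cSUP_iff[OF Kne bdd, of "s - 1 / real (Suc n)"] unfolding s_def by auto
  then obtain p where p: "p n \<in> K" and ps: "s - 1 / real (Suc n) < g (p n)" for n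
    by metis
  have c_lin: "c (u *\<^sub>R a + v *\<^sub>R b) = u *\<^sub>R c a + v *\<^sub>R c b" for a b u v
    by (simp add: c_def algebra_simps)
  have lim0: "(\<lambda>n. 1 / real (Suc n)) \<longlonglongrightarrow> 0" using LIMSEQ_Suc[OF lim_inverse_n'] by simp
  have "Cauchy (\<lambda>n. c (p n))"
  proof (rule Cauchy_if_norm_diff_squared_le)
    fix m n :: nat assume "m \<le> n"
    let ?h = "(1/2) *\<^sub>R p m + (1/2) *\<^sub>R p n"
    have "?h \<in> K" using K p[of m] p[of n] by (rule convexD) auto
    then have "g ?h \<le> s" by (rule g_s)
    \<comment> \<open>At a midpoint the quadratic term gains a quarter of the squared distance, so
      two almost maximal points have almost the same image under \<open>c\<close>.\<close>
    moreover have "g ?h = (g (p m) + g (p n)) / 2 + (norm (c (p m) - c (p n)))\<^sup>2 / 4"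
      unfolding g_def c_lin by (simp only: power2_norm_eq_inner)
        (simp add: inner_add inner_diff inner_commute field_simps)
    moreover have "1 / real (Suc n) \<le> 1 / real (Suc m)" using \<open>m \<le> n\<close> by (simp add: field_simps)
    ultimately have "(norm (c (p m) - c (p n)))\<^sup>2 \<le> 4 * (1 / real (Suc m))"
      using ps[of m] ps[of n] by argo
    then show "(norm (c (p m) - c (p n)))\<^sup>2 \<le> 4 * (1 / real (Suc m))" .
  next
    show "(\<lambda>m. 4 * (1 / real (Suc m))) \<longlonglongrightarrow> 0"
      using tendsto_mult_right_zero[OF lim0] by simp
  qed
  then obtain x where x: "(\<lambda>n. c (p n)) \<longlonglongrightarrow> x"
    using Cauchy_convergent convergent_def by blast
  have gs: "(\<lambda>n. g (p n)) \<longlonglongrightarrow> s"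
  proof (rule tendsto_sandwich)
    show "(\<lambda>n. s - 1 / real (Suc n)) \<longlonglongrightarrow> s"
      using tendsto_diff[OF tendsto_const lim0] by simp
    show "\<forall>\<^sub>F n in sequentially. s - 1 / real (Suc n) \<le> g (p n)"
      using ps by (simp add: less_imp_le)
    show "\<forall>\<^sub>F n in sequentially. g (p n) \<le> s" using g_s[OF p] by simp
  qed simp
  have "(x + y') \<bullet> (x - x') \<le> 0" if S: "(x', y') \<in> S" for x' y'
  proof -
    define k where "k = (x', y', x' \<bullet> y')"
    have k: "k \<in> K" using S GK by (force simp: k_def)
    \<comment> \<open>The limit of the third components is \<open>- s - (norm x)\<^sup>2\<close>,
      and \<open>- D\<close> is the derivative of \<open>g\<close> from the limiting data towards
      \<open>k\<close>. The points \<open>p n\<close> themselves need not converge, so the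
      first-order condition is derived along \<open>p n\<close> at a fixed \<open>t\<close>.\<close>
    define D where "D = snd (snd k) - (- s - (norm x)\<^sup>2) + 2 * (x \<bullet> (c k - x))"
    have q: "(\<lambda>n. snd (snd (p n))) \<longlonglongrightarrow> - s - (norm x)\<^sup>2"
    proof -
      have "(\<lambda>n. - g (p n) - (norm (c (p n)))\<^sup>2) \<longlonglongrightarrow> - s - (norm x)\<^sup>2"
        by (intro tendsto_intros gs x)
      then show ?thesis by (simp add: g_def)
    qed
    have *: "- D * t \<le> (norm (c k - x))\<^sup>2 * t\<^sup>2" if t: "0 < t" "t < 1" for t
    proof -
      have "(\<lambda>n. - (norm ((1 - t) *\<^sub>R c (p n) + t *\<^sub>R c k))\<^sup>2 - ((1 - t) * snd (snd (p n)) + t * snd (snd k)))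
           \<longlonglongrightarrow> - (norm ((1 - t) *\<^sub>R x + t *\<^sub>R c k))\<^sup>2 - ((1 - t) * (- s - (norm x)\<^sup>2) + t * snd (snd k))"
        by (intro tendsto_intros q x)
      moreover have "- (norm ((1 - t) *\<^sub>R c (p n) + t *\<^sub>R c k))\<^sup>2 - ((1 - t) * snd (snd (p n)) + t * snd (snd k)) \<le> s" for n
      proof -
        have "(1 - t) *\<^sub>R p n + t *\<^sub>R k \<in> K" using K p k by (rule convexD) (use t in auto)
        from g_s[OF this] show ?thesis by (simp add: g_def c_lin)
      qed
      ultimately have "- (norm ((1 - t) *\<^sub>R x + t *\<^sub>R c k))\<^sup>2 - ((1 - t) * (- s - (norm x)\<^sup>2) + t * snd (snd k)) \<le> s"
        by (intro LIMSEQ_le_const2) auto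
      moreover have "(norm ((1 - t) *\<^sub>R x + t *\<^sub>R c k))\<^sup>2 = (norm x)\<^sup>2 + 2 * t * (x \<bullet> (c k - x)) + t\<^sup>2 * (norm (c k - x))\<^sup>2"
        by (simp only: power2_norm_eq_inner)
          (simp add: inner_add inner_diff inner_commute algebra_simps power2_eq_square)
      ultimately show ?thesis unfolding D_def by (simp add: algebra_simps)
    qed
    have "0 \<le> D"
    proof (rule ccontr)
      assume "\<not> 0 \<le> D"
      then have D: "- D > 0" by simp
      define N where "N = (norm (c k - x))\<^sup>2 + 1"
      define t where "t = min (1/2) (- D / (2 * N))"
      have N: "N \<ge> 1" by (simp add: N_def)
      have "0 < - D / (2 * N)" using D N by (intro divide_pos_pos) auto
      then have t: "0 < t" "t < 1" by (auto simp: t_def)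
      have "- D * t \<le> N * t\<^sup>2" using *[OF t] by (simp add: N_def algebra_simps)
        (smt (verit) zero_le_power2)
      then have "- D * t \<le> (N * t) * t" by (simp add: power2_eq_square)
      then have "- D \<le> N * t" by (rule mult_right_le_imp_le) (rule t)
      also have "\<dots> \<le> N * (- D / (2 * N))" using N by (intro mult_left_mono) (auto simp: t_def)
      also have "\<dots> = - D / 2" using N by simp
      finally show False using D by simp
    qed
    \<comment> \<open>Since \<open>2 *\<^sub>R c k = x' - y'\<close>, the left side is
      \<open>(x + y') \<bullet> (x - x')\<close> in expanded form; the sign comes from
      \<open>s0\<close>.\<close>
    then have "(norm x)\<^sup>2 - 2 * (x \<bullet> c k) - snd (snd k) \<le> s"
      unfolding D_def by (simp add: inner_diff power2_norm_eq_inner)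
    then have "(norm x)\<^sup>2 - x \<bullet> (x' - y') - x' \<bullet> y' \<le> 0"
      using s0 by (simp add: c_def k_def)
    then show ?thesis
      by (simp add: power2_norm_eq_inner inner_diff inner_add inner_commute algebra_simps)
  qed
  then show thesis by (rule that)
qed

text \<open>The extension lemma is applied to the graph of \<open>h A - p\<close>. The point
  \<open>x\<close> that it provides makes \<open>(p - x) / h\<close> compatible with the whole graph
  of \<open>A\<close>, and maximality admits this pair.\<close>

theorem minty_resolvent_exists:
  fixes A :: "'a::{real_inner, banach} \<Rightarrow> 'a set"
  assumes A: "maximal_monotone A" and l: "h > 0"
  obtains x y where "y \<in> A x" "x + h *\<^sub>R y = p"
proof -
  note mono = monotone_opD[OF maximal_monotone_imp_monotone[OF A]]
  let ?S = "{(x, h *\<^sub>R y - p) | x y. y \<in> A x}"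
  have "?S \<noteq> {}"
    using maximal_monotone_mem[OF A, of 0 0] by auto
  moreover have "0 \<le> (y - y') \<bullet> (x - x')" if "(x, y) \<in> ?S" "(x', y') \<in> ?S" for x y x' y'
  proof -
    from that obtain a b where ab: "y = h *\<^sub>R a - p" "a \<in> A x" "y' = h *\<^sub>R b - p" "b \<in> A x'" by auto
    have "y - y' = h *\<^sub>R (a - b)" by (simp add: ab algebra_simps)
    then show ?thesis using mono[OF ab(2,4)] l by simp
  qed
  ultimately obtain x where x: "\<And>x' y'. (x', y') \<in> ?S \<Longrightarrow> (x + y') \<bullet> (x - x') \<le> 0"
    by (metis (no_types, lifting) monotone_set_extension)
  have "(1/h) *\<^sub>R (p - x) \<in> A x"
  proof (rule maximal_monotone_mem[OF A])
    fix x' y' assume "y' \<in> A x'"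
    then have "(x + (h *\<^sub>R y' - p)) \<bullet> (x - x') \<le> 0" using x by blast
    moreover have "x + (h *\<^sub>R y' - p) = - h *\<^sub>R ((1/h) *\<^sub>R (p - x) - y')"
      using l by (simp add: algebra_simps)
    ultimately have "- h * (((1/h) *\<^sub>R (p - x) - y') \<bullet> (x - x')) \<le> 0"
      by (metis inner_scaleR_left)
    then show "0 \<le> ((1/h) *\<^sub>R (p - x) - y') \<bullet> (x - x')"
      using l by (simp add: zero_le_mult_iff)
  qed
  moreover have "x + h *\<^sub>R ((1/h) *\<^sub>R (p - x)) = p" using l by simp
  ultimately show thesis by (rule that)
qed

section \<open>Pseudo-distance and resolvents\<close>

lemma vladimirov_disD:
  assumes "vladimirov_dis A B \<le> ereal d" "y \<in> A x" "y' \<in> B x'"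
  shows "(y - y') \<bullet> (x' - x) \<le> d * (1 + norm y + norm y')"
proof -
  have "ereal (((y - y') \<bullet> (x' - x)) / (1 + norm y + norm y')) \<le> vladimirov_dis A B"
    unfolding vladimirov_dis_def
    by (rule SUP_upper2[of "((x, y), (x', y'))"]) (use assms(2,3) in \<open>auto simp: op_graph_def\<close>)
  also note assms(1)
  finally have "((y - y') \<bullet> (x' - x)) / (1 + norm y + norm y') \<le> d" by simp
  moreover have "1 + norm y + norm y' > 0"
    by (intro add_pos_nonneg) auto
  ultimately show ?thesis by (simp add: pos_divide_le_eq)
qed

text \<open>The old pair \<open>(x, y)\<close> is tested against the new one, with displacement
  \<open>x - x' = h *\<^sub>R y' + F\<close>. Both \<open>d\<close> and \<open>norm F\<close> are
  dominated by multiples of \<open>h\<close>; hence \<open>h\<close> cancels, and a quadratic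
  inequality for \<open>norm y'\<close> remains that does not depend on the step.\<close>

lemma resolvent_displacement_bound:
  assumes dis: "vladimirov_dis B A \<le> ereal d" and d: "0 \<le> d" "d \<le> h" and l: "h > 0"
    and y: "y \<in> A x" and y': "y' \<in> B x'" and eq: "x' + h *\<^sub>R y' = x - F"
    and F: "norm F \<le> h * k" and k: "0 \<le> k"
  shows "norm y' \<le> 2 * (k + norm y + 2)"
proof -
  let ?K = "k + norm y + 2" and ?n = "norm y'"
  have "x - x' = h *\<^sub>R y' + F" using eq by (simp add: algebra_simps)
  then have "(y' - y) \<bullet> (h *\<^sub>R y' + F) \<le> d * (1 + ?n + norm y)"
    using vladimirov_disD[OF dis y' y] by simp
  moreover have "(y' - y) \<bullet> (h *\<^sub>R y' + F) = h * ?n\<^sup>2 - h * (y \<bullet> y') + (y' - y) \<bullet> F"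
    by (simp add: inner_add inner_diff power2_norm_eq_inner algebra_simps inner_commute)
  moreover have "y \<bullet> y' \<le> norm y * ?n" by (rule norm_cauchy_schwarz)
  then have "h * (y \<bullet> y') \<le> h * (norm y * ?n)" using l by simp
  moreover have "- ((y' - y) \<bullet> F) \<le> (?n + norm y) * (h * k)"
  proof -
    have "- ((y' - y) \<bullet> F) \<le> norm (y' - y) * norm F"
      using norm_cauchy_schwarz[of "y - y'" F] by (simp add: inner_diff norm_minus_commute)
    also have "\<dots> \<le> (?n + norm y) * (h * k)"
      using F by (intro mult_mono norm_triangle_ineq4) auto
    finally show ?thesis .
  qed
  moreover have "d * (1 + ?n + norm y) \<le> h * (1 + ?n + norm y)"
    using d by (intro mult_right_mono) auto
  ultimately have "h * ?n\<^sup>2 \<le> h * (norm y * ?n) + (?n + norm y) * (h * k) + h * (1 + ?n + norm y)"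
    by linarith
  also have "\<dots> = h * (norm y * ?n + (?n + norm y) * k + (1 + ?n + norm y))"
    by (simp add: algebra_simps)
  finally have le: "?n\<^sup>2 \<le> norm y * ?n + (?n + norm y) * k + (1 + ?n + norm y)"
    using l by simp
  have "norm y * k + 1 + norm y \<le> ?K\<^sup>2"
    using k by (simp add: power2_eq_square algebra_simps)
  moreover have "?n * (k + norm y + 1) \<le> ?n * ?K" by (intro mult_left_mono) auto
  moreover have "norm y * ?n + (?n + norm y) * k + (1 + ?n + norm y)
      = ?n * (k + norm y + 1) + (norm y * k + 1 + norm y)" by (simp add: algebra_simps)
  ultimately have le2: "?n\<^sup>2 \<le> ?n * ?K + ?K\<^sup>2" using le by linarith
  show ?thesis
  proof (rule ccontr)
    assume "\<not> ?thesis"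
    then have g: "2 * ?K < ?n" by simp
    have K: "0 < ?K" using k by (simp add: add_nonneg_pos)
    have "?n * ?K + ?K\<^sup>2 < ?n * ?n"
    proof -
      have "?n * (2 * ?K) \<le> ?n * ?n" using g by (intro mult_left_mono) auto
      moreover have "?K * ?K < ?n * ?K" using g K by (intro mult_strict_right_mono) auto
      moreover have "?n * (2 * ?K) = ?n * ?K + ?n * ?K" by simp
      ultimately show ?thesis unfolding power2_eq_square by linarith
    qed
    then show False using le2 by (simp add: power2_eq_square)
  qed
qed

section \<open>Minimal sections and limits of domains\<close>

lemma maximal_monotone_values_closed_convex:
  assumes A: "maximal_monotone A"
  shows "closed (A x)" "convex (A x)"
proof -
  \<comment> \<open>By maximality, membership in \<open>A x\<close> amounts to the monotonicity
    inequalities against the graph, each a closed convex condition on \<open>y\<close>.\<close>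
  have eq: "A x = (\<Inter>(x', y') \<in> op_graph A. {y. y' \<bullet> (x - x') \<le> y \<bullet> (x - x')})"
  proof (intro equalityI subsetI)
    fix y assume "y \<in> A x"
    then show "y \<in> (\<Inter>(x', y') \<in> op_graph A. {y. y' \<bullet> (x - x') \<le> y \<bullet> (x - x')})"
      using monotone_opD[OF maximal_monotone_imp_monotone[OF A], of y x]
      by (fastforce simp: op_graph_def inner_diff_left)
  next
    fix y assume *: "y \<in> (\<Inter>(x', y') \<in> op_graph A. {y. y' \<bullet> (x - x') \<le> y \<bullet> (x - x')})"
    show "y \<in> A x"
      by (rule maximal_monotone_mem[OF A]) (use * in \<open>auto simp: op_graph_def inner_diff_left\<close>)
  qed
  have cl: "closed {y. y' \<bullet> (x - x') \<le> y \<bullet> (x - x')}" for x' y'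
    by (intro closed_Collect_le continuous_intros)
  have cv: "convex {y. y' \<bullet> (x - x') \<le> y \<bullet> (x - x')}" for x' y'
    using convex_halfspace_ge[of "y' \<bullet> (x - x')" "x - x'"] by (simp add: inner_commute)
  show "closed (A x)" unfolding eq by (intro closed_INT ballI) (auto intro: cl)
  show "convex (A x)" unfolding eq by (intro convex_INT) (auto intro: cv)
qed

lemma closed_convex_min_norm_exists:
  fixes S :: "'a::{real_inner, banach} set"
  assumes "closed S" "convex S" "S \<noteq> {}"
  obtains y where "y \<in> S" "\<And>x. x \<in> S \<Longrightarrow> norm y \<le> norm x"
proof -
  define s where "s = (INF x\<in>S. (norm x)\<^sup>2)"
  have bdd: "bdd_below ((\<lambda>x. (norm x)\<^sup>2) ` S)" by (rule bdd_belowI2[of _ 0]) simp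
  have s_le: "s \<le> (norm x)\<^sup>2" if "x \<in> S" for x
    unfolding s_def using bdd that by (rule cINF_lower)
  have "\<exists>x\<in>S. (norm x)\<^sup>2 < s + 1 / real (Suc n)" for n
    using cINF_less_iff[OF assms(3) bdd, of "s + 1 / real (Suc n)"] unfolding s_def by auto
  then obtain X where X: "X n \<in> S" and Xs: "(norm (X n))\<^sup>2 < s + 1 / real (Suc n)" for n
    by metis
  have lim0: "(\<lambda>n. 1 / real (Suc n)) \<longlonglongrightarrow> 0" using LIMSEQ_Suc[OF lim_inverse_n'] by simp
  have "Cauchy X"
  proof (rule Cauchy_if_norm_diff_squared_le)
    fix m n :: nat assume "m \<le> n"
    have "(1/2) *\<^sub>R X m + (1/2) *\<^sub>R X n \<in> S" using assms(2) X[of m] X[of n] by (rule convexD) auto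
    from s_le[OF this] have "s \<le> (norm (X m))\<^sup>2 / 2 + (norm (X n))\<^sup>2 / 2 - (norm (X m - X n))\<^sup>2 / 4"
      by (simp only: power2_norm_eq_inner) (simp add: inner_add inner_diff inner_commute field_simps)
    moreover have "1 / real (Suc n) \<le> 1 / real (Suc m)" using \<open>m \<le> n\<close> by (simp add: field_simps)
    ultimately show "(norm (X m - X n))\<^sup>2 \<le> 4 * (1 / real (Suc m))"
      using Xs[of m] Xs[of n] by linarith
  next
    show "(\<lambda>m. 4 * (1 / real (Suc m))) \<longlonglongrightarrow> 0"
      using tendsto_mult_right_zero[OF lim0] by simp
  qed
  then obtain y where y: "X \<longlonglongrightarrow> y" using Cauchy_convergent convergent_def by blast
  have yS: "y \<in> S" using closed_sequentially[OF assms(1) _ y] X by auto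
  have "(norm y)\<^sup>2 \<le> s"
  proof (rule LIMSEQ_le)
    show "(\<lambda>n. (norm (X n))\<^sup>2) \<longlonglongrightarrow> (norm y)\<^sup>2" by (intro tendsto_intros y)
    show "(\<lambda>n. s + 1 / real (Suc n)) \<longlonglongrightarrow> s" using tendsto_add[OF tendsto_const lim0] by simp
  qed (use Xs in \<open>auto intro: less_imp_le\<close>)
  then have "norm y \<le> norm x" if "x \<in> S" for x
    using s_le[OF that] by (meson norm_ge_zero order_trans power2_le_imp_le)
  with yS show thesis by (rule that)
qed

text \<open>\<open>min_section\<close> is a choice term, so it lies in \<open>A x\<close> only
  because a minimiser exists; this is the projection theorem for the closed convex set
  \<open>A x\<close>.\<close>

lemma min_section_mem:
  fixes A :: "'a::{real_inner, banach} \<Rightarrow> 'a set"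
  assumes "maximal_monotone A" "x \<in> op_domain A"
  shows "min_section A x \<in> A x"
proof -
  obtain y where "y \<in> A x" "\<And>z. z \<in> A x \<Longrightarrow> norm y \<le> norm z"
    using closed_convex_min_norm_exists[of "A x"] maximal_monotone_values_closed_convex[OF assms(1)]
      assms(2) by (auto simp: op_domain_def)
  then have "is_arg_min norm (\<lambda>y. y \<in> A x) y"
    by (simp add: is_arg_min_linorder)
  then have "is_arg_min norm (\<lambda>y. y \<in> A x) (min_section A x)"
    unfolding min_section_def arg_min_on_def arg_min_def by (rule someI)
  then show ?thesis by (simp add: is_arg_min_def)
qed

text \<open>The bounded Yosida approximations \<open>y\<^sub>h\<close> of \<open>x\<close> form a Cauchy family as \<open>h\<close> tends to 0.\<close>
lemma op_domain_of_bounded_yosida: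
  fixes A :: "'a::{real_inner, banach} \<Rightarrow> 'a set"
  assumes A: "maximal_monotone A"
    and bd: "\<And>h x' y'. h > 0 \<Longrightarrow> y' \<in> A x' \<Longrightarrow> x' + h *\<^sub>R y' = x \<Longrightarrow> norm y' \<le> K"
  shows "x \<in> op_domain A"
proof -
  define l :: "nat \<Rightarrow> real" where "l n = (1/2) ^ n" for n
  have l: "l n > 0" for n by (simp add: l_def)
  have l0: "l \<longlonglongrightarrow> 0" unfolding l_def by (rule LIMSEQ_realpow_zero) auto
  have "\<exists>x' y'. y' \<in> A x' \<and> x' + l n *\<^sub>R y' = x" for n
    by (metis minty_resolvent_exists[OF A l])
  then obtain X Y where Y: "Y n \<in> A (X n)" and XY: "X n + l n *\<^sub>R Y n = x" for n by metis
  have Yb: "norm (Y n) \<le> K" for n using bd[OF l Y XY] .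
  have X_eq: "X n = x - l n *\<^sub>R Y n" for n using XY[of n] by (simp add: algebra_simps)
  have key: "l m * (norm (Y m))\<^sup>2 + l n * (norm (Y n))\<^sup>2 \<le> (l m + l n) * (Y m \<bullet> Y n)" for m n
  proof -
    have "0 \<le> (Y m - Y n) \<bullet> (X m - X n)"
      by (rule monotone_opD[OF maximal_monotone_imp_monotone[OF A] Y Y])
    then show ?thesis
      by (simp add: X_eq inner_diff power2_norm_eq_inner algebra_simps inner_commute)
  qed
  \<comment> \<open>By \<open>key\<close>, norms grow as the step shrinks, and the squared distance
    is at most the growth of the squared norm. The bound \<open>K\<close> therefore forces strong
    convergence.\<close>
  have diff: "norm (Y m) \<le> norm (Y n) \<and> (norm (Y m - Y n))\<^sup>2 \<le> (norm (Y n))\<^sup>2 - (norm (Y m))\<^sup>2"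
    if "m \<le> n" for m n
  proof -
    have ln: "l n \<le> l m" using that unfolding l_def by (simp add: power_decreasing)
    define a b where "a = norm (Y m)" and "b = norm (Y n)"
    have ab0: "0 \<le> a" "0 \<le> b" by (auto simp: a_def b_def)
    have k: "l m * a\<^sup>2 + l n * b\<^sup>2 \<le> (l m + l n) * (Y m \<bullet> Y n)"
      using key unfolding a_def b_def .
    also have "\<dots> \<le> (l m + l n) * (a * b)"
      using l[of m] l[of n] norm_cauchy_schwarz[of "Y m" "Y n"] unfolding a_def b_def
      by (intro mult_left_mono) auto
    finally have "(a - b) * (l m * a - l n * b) \<le> 0"
      by (simp add: algebra_simps power2_eq_square)
    moreover have "0 < (a - b) * (l m * a - l n * b)" if "b < a"
    proof (rule mult_pos_pos)
      have "l n * b \<le> l m * b" using ln ab0 by (intro mult_right_mono) auto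
      also have "\<dots> < l m * a" using that l by simp
      finally show "0 < l m * a - l n * b" by simp
    qed (use that in simp)
    ultimately have ab: "a \<le> b" by fastforce
    have "(l m + l n) * (norm (Y m - Y n))\<^sup>2 = (l m + l n) * (a\<^sup>2 + b\<^sup>2) - 2 * ((l m + l n) * (Y m \<bullet> Y n))"
      unfolding a_def b_def power2_norm_eq_inner
      by (simp add: inner_diff inner_commute algebra_simps)
    also have "\<dots> \<le> (l m - l n) * (b\<^sup>2 - a\<^sup>2)"
      using k by (simp add: algebra_simps)
    also have "\<dots> \<le> (l m + l n) * (b\<^sup>2 - a\<^sup>2)"
      using l[of n] ab ab0 by (intro mult_right_mono) (auto intro: power_mono)
    finally have "(norm (Y m - Y n))\<^sup>2 \<le> b\<^sup>2 - a\<^sup>2"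
      using l[of m] l[of n] by (simp add: mult_le_cancel_left_pos)
    with ab show ?thesis by (simp add: a_def b_def)
  qed
  have inc: "incseq (\<lambda>n. (norm (Y n))\<^sup>2)" using diff by (intro incseq_SucI power_mono) auto
  have K0: "0 \<le> K" using Yb[of 0] norm_ge_zero order_trans by blast
  obtain L where L: "(\<lambda>n. (norm (Y n))\<^sup>2) \<longlonglongrightarrow> L" "\<forall>n. (norm (Y n))\<^sup>2 \<le> L"
    using incseq_convergent[OF inc, of "K\<^sup>2"] Yb K0 by (metis norm_ge_zero power_mono)
  have "Cauchy Y"
  proof (rule Cauchy_if_norm_diff_squared_le)
    fix m n :: nat assume "m \<le> n"
    then show "(norm (Y m - Y n))\<^sup>2 \<le> L - (norm (Y m))\<^sup>2" using diff L(2) by (meson diff_right_mono order_trans)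
  next
    show "(\<lambda>m. L - (norm (Y m))\<^sup>2) \<longlonglongrightarrow> 0" using tendsto_diff[OF tendsto_const[of L] L(1)] by simp
  qed
  then obtain y where y: "Y \<longlonglongrightarrow> y" using Cauchy_convergent convergent_def by blast
  have "(\<lambda>n. x - l n *\<^sub>R Y n) \<longlonglongrightarrow> x - 0 *\<^sub>R y" by (intro tendsto_intros l0 y)
  then have X: "X \<longlonglongrightarrow> x" by (simp add: X_eq[abs_def])
  have "y \<in> A x"
  proof (rule maximal_monotone_mem[OF A])
    fix x' y' assume "y' \<in> A x'"
    then have "0 \<le> (Y n - y') \<bullet> (X n - x')" for n
      by (rule monotone_opD[OF maximal_monotone_imp_monotone[OF A] Y])
    moreover have "(\<lambda>n. (Y n - y') \<bullet> (X n - x')) \<longlonglongrightarrow> (y - y') \<bullet> (x - x')"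
      by (intro tendsto_intros y X)
    ultimately show "0 \<le> (y - y') \<bullet> (x - x')" by (intro LIMSEQ_le_const) auto
  qed
  then show ?thesis by (auto simp: op_domain_def)
qed

text \<open>A resolvent pair of \<open>A\<close> at \<open>x\<close> is tested against
  \<open>Z k\<close>, which enters only through its bound \<open>K\<close>. In the limit
  \<open>h * (norm y')\<^sup>2 \<le> K * (h * norm y')\<close>, so the Yosida values of
  \<open>A\<close> at \<open>x\<close> obey the same bound as the selections.\<close>

lemma op_domain_limit:
  fixes A :: "'a::{real_inner, banach} \<Rightarrow> 'a set"
  assumes A: "maximal_monotone A"
    and dis: "\<And>k. vladimirov_dis (B k) A \<le> ereal (d k)" and d: "d \<longlonglongrightarrow> 0"
    and Z: "\<And>k. Z k \<in> B k (X k)" "\<And>k. norm (Z k) \<le> K" and X: "X \<longlonglongrightarrow> x"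
  shows "x \<in> op_domain A"
proof (rule op_domain_of_bounded_yosida[OF A])
  fix h :: real and x' y' assume l: "h > 0" and y': "y' \<in> A x'" and eq: "x' + h *\<^sub>R y' = x"
  have K: "0 \<le> K" using Z(2)[of 0] norm_ge_zero order_trans by blast
  have "- (K * norm (x' - X k)) - y' \<bullet> (x' - X k) \<le> \<bar>d k\<bar> * (1 + K + norm y')" for k
  proof -
    have "- (Z k \<bullet> (x' - X k)) \<le> norm (Z k) * norm (x' - X k)"
      using norm_cauchy_schwarz[of "- Z k" "x' - X k"] by simp
    also have "\<dots> \<le> K * norm (x' - X k)" using Z(2) by (intro mult_right_mono) auto
    finally have "- (K * norm (x' - X k)) - y' \<bullet> (x' - X k) \<le> (Z k - y') \<bullet> (x' - X k)"
      by (simp add: inner_diff)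
    also have "\<dots> \<le> d k * (1 + norm (Z k) + norm y')"
      by (rule vladimirov_disD[OF dis Z(1) y'])
    also have "\<dots> \<le> \<bar>d k\<bar> * (1 + K + norm y')"
      using Z(2)[of k] by (intro mult_mono) auto
    finally show ?thesis .
  qed
  moreover have "(\<lambda>k. - (K * norm (x' - X k)) - y' \<bullet> (x' - X k)) \<longlonglongrightarrow> - (K * norm (x' - x)) - y' \<bullet> (x' - x)"
    by (intro tendsto_intros X)
  moreover have "(\<lambda>k. \<bar>d k\<bar> * (1 + K + norm y')) \<longlonglongrightarrow> \<bar>0\<bar> * (1 + K + norm y')"
    by (intro tendsto_intros d)
  ultimately have "- (K * norm (x' - x)) - y' \<bullet> (x' - x) \<le> \<bar>0\<bar> * (1 + K + norm y')"
    by (intro LIMSEQ_le[where X="\<lambda>k. - (K * norm (x' - X k)) - y' \<bullet> (x' - X k)"]) auto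
  moreover have "x' - x = - (h *\<^sub>R y')" using eq by (simp add: algebra_simps)
  ultimately have "h * (norm y')\<^sup>2 \<le> K * (h * norm y')"
    using l by (simp add: power2_norm_eq_inner)
  then have "h * norm y' * norm y' \<le> h * norm y' * K" by (simp add: power2_eq_square algebra_simps)
  then show "norm y' \<le> K"
    using l K by (cases "y' = 0") auto
qed

section \<open>Dyadic grids adapted to a time change\<close>

text \<open>Used with \<open>t + \<rho> t\<close> and with the identity, so that the results on
  integration serve \<open>\<nu>\<close> and Lebesgue measure alike. \<open>theta_expanding\<close>
  says that \<open>\<theta> t - t\<close> is nondecreasing, which makes \<open>\<theta>\<close>
  strictly increasing; jumps from the left are allowed.\<close>

locale time_change =
  fixes T :: real and \<theta> :: "real \<Rightarrow> real"
  assumes T_pos: "0 < T"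
    and theta_0: "\<theta> 0 = 0"
    and theta_expanding: "0 \<le> s \<Longrightarrow> s \<le> t \<Longrightarrow> t \<le> T \<Longrightarrow> t - s \<le> \<theta> t - \<theta> s"
    and theta_right_continuous: "0 \<le> t \<Longrightarrow> t < T \<Longrightarrow> (\<theta> \<longlongrightarrow> \<theta> t) (at_right t)"
begin

lemma theta_mono: "0 \<le> s \<Longrightarrow> s \<le> t \<Longrightarrow> t \<le> T \<Longrightarrow> \<theta> s \<le> \<theta> t"
  using theta_expanding[of s t] by linarith

lemma theta_less: "0 \<le> s \<Longrightarrow> s < t \<Longrightarrow> t \<le> T \<Longrightarrow> \<theta> s < \<theta> t"
  using theta_expanding[of s t] by linarith

lemma theta_nonneg: "0 \<le> t \<Longrightarrow> t \<le> T \<Longrightarrow> 0 \<le> \<theta> t"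
  using theta_mono[of 0 t] theta_0 by simp

lemma theta_T_pos: "0 < \<theta> T"
  using theta_less[of 0 T] theta_0 T_pos by simp

text \<open>The generalised inverse of \<open>\<theta>\<close>; a level inside a jump is sent to the
  jump point.\<close>

definition tau :: "real \<Rightarrow> real" where
  "tau y = Inf {t \<in> {0..T}. y \<le> \<theta> t}"

lemma tau_mem:
  assumes "y \<le> \<theta> T"
  shows "tau y \<in> {0..T}" "y \<le> \<theta> (tau y)"
proof -
  let ?S = "{t \<in> {0..T}. y \<le> \<theta> t}"
  have ne: "T \<in> ?S" using assms T_pos by auto
  have bdd: "bdd_below ?S" by (rule bdd_belowI[of _ 0]) auto
  have le: "tau y \<le> s" if "s \<in> ?S" for s
    unfolding tau_def using that bdd by (rule cInf_lower)
  have ge: "0 \<le> tau y"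
    unfolding tau_def using ne by (intro cInf_greatest) auto
  show mem: "tau y \<in> {0..T}" using ge le[OF ne] by simp
  show "y \<le> \<theta> (tau y)"
  proof (rule ccontr)
    assume *: "\<not> y \<le> \<theta> (tau y)"
    then have "tau y \<noteq> T" using assms by auto
    then have lt: "tau y < T" using mem by auto
    have "eventually (\<lambda>t. \<theta> t < y) (at_right (tau y))"
      using theta_right_continuous[OF ge lt] * by (intro order_tendstoD(2)) auto
    then obtain b where b: "b > tau y" "\<And>t. tau y < t \<Longrightarrow> t < b \<Longrightarrow> \<theta> t < y"
      unfolding eventually_at_right_field by blast
    obtain s where s: "s \<in> ?S" "s < b"
      using cInf_less_iff[OF _ bdd, of b] ne b(1) unfolding tau_def by auto
    then show False
      using le[of s] b(2)[of s] * by (cases "s = tau y") auto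
  qed
qed

text \<open>Right continuity makes the infimum attained (\<open>tau_mem\<close>), which yields this
  Galois connection; the order properties of the grids rest on it.\<close>

lemma tau_le_iff:
  assumes "y \<le> \<theta> T" "t \<in> {0..T}"
  shows "tau y \<le> t \<longleftrightarrow> y \<le> \<theta> t"
proof
  assume "tau y \<le> t"
  then show "y \<le> \<theta> t"
    using tau_mem[OF assms(1)] theta_mono[of "tau y" t] assms(2) by auto
next
  assume "y \<le> \<theta> t"
  then show "tau y \<le> t"
    unfolding tau_def using assms(2) by (intro cInf_lower) (auto intro: bdd_belowI[of _ 0])
qed

definition eps :: "nat \<Rightarrow> real" where "eps n = \<theta> T / 2 ^ n"

text \<open>A jump of \<open>\<theta>\<close> across several levels makes consecutive points
  coincide. Degenerate steps therefore occur, and different indices may stand for the same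
  time.\<close>

definition grid :: "nat \<Rightarrow> nat \<Rightarrow> real" where "grid n k = tau (real k * eps n)"

lemma eps_pos: "0 < eps n"
  using theta_T_pos by (simp add: eps_def)

lemma eps_tendsto_0: "eps \<longlonglongrightarrow> 0"
proof -
  have "(\<lambda>n. \<theta> T * (1/2) ^ n) \<longlonglongrightarrow> \<theta> T * 0"
    by (intro tendsto_intros LIMSEQ_realpow_zero) auto
  then show ?thesis by (simp add: eps_def[abs_def] power_divide)
qed

lemma eps_level: "k \<le> 2 ^ n \<Longrightarrow> real k * eps n \<le> \<theta> T"
proof -
  assume "k \<le> 2 ^ n"
  then have "real k \<le> 2 ^ n" by (metis of_nat_le_iff of_nat_numeral of_nat_power)
  then have "real k * eps n \<le> 2 ^ n * eps n" using eps_pos[of n] by (intro mult_right_mono) auto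
  then show ?thesis by (simp add: eps_def)
qed

lemma grid_mem: "k \<le> 2 ^ n \<Longrightarrow> grid n k \<in> {0..T}"
  unfolding grid_def by (intro tau_mem(1) eps_level)

lemma grid_bounds: "k \<le> 2 ^ n \<Longrightarrow> 0 \<le> grid n k" "k \<le> 2 ^ n \<Longrightarrow> grid n k \<le> T"
  using grid_mem[of k n] by auto

lemma grid_le_iff: "k \<le> 2 ^ n \<Longrightarrow> 0 \<le> t \<Longrightarrow> t \<le> T \<Longrightarrow> grid n k \<le> t \<longleftrightarrow> real k * eps n \<le> \<theta> t"
  unfolding grid_def by (intro tau_le_iff eps_level) auto

lemma level_le_theta_grid: "k \<le> 2 ^ n \<Longrightarrow> real k * eps n \<le> \<theta> (grid n k)"
  unfolding grid_def by (intro tau_mem(2) eps_level)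

lemma grid_0 [simp]: "grid n 0 = 0"
  using grid_le_iff[of 0 n 0] grid_bounds[of 0 n] T_pos theta_0 by auto

lemma grid_last [simp]: "grid n (2 ^ n) = T"
proof (rule ccontr)
  assume "grid n (2 ^ n) \<noteq> T"
  then have "\<theta> (grid n (2 ^ n)) < \<theta> T"
    using grid_bounds[of "2 ^ n" n] by (intro theta_less) auto
  then show False using level_le_theta_grid[of "2 ^ n" n] by (simp add: eps_def)
qed

lemma grid_mono:
  assumes "j \<le> k" "k \<le> 2 ^ n"
  shows "grid n j \<le> grid n k"
proof -
  have "real j * eps n \<le> real k * eps n" using assms eps_pos[of n] by (intro mult_right_mono) auto
  also have "\<dots> \<le> \<theta> (grid n k)" by (rule level_le_theta_grid[OF assms(2)])
  finally show ?thesis using assms grid_bounds[of k n] by (subst grid_le_iff) auto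
qed

lemma grid_refine: "grid (n + p) (k * 2 ^ p) = grid n k"
  by (simp add: grid_def eps_def power_add)

text \<open>Level \<open>k\<close> is reached at \<open>grid n k\<close>, and level
  \<open>k + 1\<close> is not reached before \<open>grid n (Suc k)\<close>. At that point itself the
  bound may fail.\<close>

lemma theta_grid_gap:
  assumes "k < 2 ^ n" "grid n k \<le> r" "r < grid n (Suc k)"
  shows "\<theta> r - \<theta> (grid n k) \<le> eps n"
proof -
  have r: "0 \<le> r" "r \<le> T" using assms grid_bounds[of k n] grid_bounds[of "Suc k" n] by auto
  have "\<theta> r < real (Suc k) * eps n"
    using grid_le_iff[of "Suc k" n r] assms r by auto
  moreover have "real k * eps n \<le> \<theta> (grid n k)"
    using assms(1) by (intro level_le_theta_grid) auto
  ultimately show ?thesis by (simp add: algebra_simps)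
qed

text \<open>The index of the grid interval \<open>(grid n k, grid n (k+1)]\<close> containing \<open>t\<close>.\<close>
definition block :: "nat \<Rightarrow> real \<Rightarrow> nat" where
  "block n t = (LEAST k. t \<le> grid n (Suc k))"

lemma block_props:
  assumes "0 < t" "t \<le> T"
  shows "block n t < 2 ^ n" "grid n (block n t) < t" "t \<le> grid n (Suc (block n t))"
proof -
  have ex: "t \<le> grid n (Suc (2 ^ n - 1))" using assms(2) by simp
  show "t \<le> grid n (Suc (block n t))"
    unfolding block_def using ex by (rule LeastI)
  have "block n t \<le> 2 ^ n - 1" unfolding block_def using ex by (rule Least_le)
  moreover have "0 < (2::nat) ^ n" by simp
  ultimately show lt: "block n t < 2 ^ n" by linarith
  show "grid n (block n t) < t"
  proof (cases "block n t")
    case 0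
    then show ?thesis using assms by simp
  next
    case (Suc j)
    then have "\<not> t \<le> grid n (Suc j)"
      unfolding block_def using not_less_Least[of j "\<lambda>k. t \<le> grid n (Suc k)"] by simp
    then show ?thesis using Suc by simp
  qed
qed

lemma block_unique:
  assumes "k < 2 ^ n" "grid n k < t" "t \<le> grid n (Suc k)"
  shows "block n t = k"
proof -
  have t: "0 < t" "t \<le> T"
    using assms grid_bounds[of k n] grid_bounds[of "Suc k" n] by auto
  note b = block_props[OF t, of n]
  show ?thesis
  proof (rule linorder_cases)
    assume "block n t < k"
    then have "grid n (Suc (block n t)) \<le> grid n k" using assms by (intro grid_mono) auto
    then show ?thesis using b assms by simp
  next
    assume "k < block n t"
    then have "grid n (Suc k) \<le> grid n (block n t)" using b by (intro grid_mono) auto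
    then show ?thesis using b assms by simp
  qed
qed

text \<open>Right continuity supplies \<open>s > t\<close> with \<open>\<theta> s\<close> close to
  \<open>\<theta> t\<close>. Once \<open>eps n\<close> is below
  \<open>\<theta> s - \<theta> t\<close>, the next level is reached by time \<open>s\<close>, so the
  right end point lies between \<open>t\<close> and \<open>s\<close>. A jump at \<open>t\<close>
  does no harm.\<close>

lemma theta_block_tendsto:
  assumes t: "0 < t" "t \<le> T"
  shows "(\<lambda>n. \<theta> (grid n (Suc (block n t)))) \<longlonglongrightarrow> \<theta> t"
proof (cases "t = T")
  case True
  have "grid n (Suc (block n t)) = T" for n
    using block_props[OF t, of n] grid_bounds[of "Suc (block n t)" n] True by simp
  then show ?thesis using True by simp
next
  case False
  then have lt: "t < T" using t by simp
  have ge: "\<theta> t \<le> \<theta> (grid n (Suc (block n t)))" for n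
    using block_props[OF t, of n] grid_bounds[of "Suc (block n t)" n] t by (intro theta_mono) auto
  show ?thesis
  proof (rule order_tendstoI)
    fix a assume "a < \<theta> t"
    then show "eventually (\<lambda>n. a < \<theta> (grid n (Suc (block n t)))) sequentially"
      using ge by (intro always_eventually) (auto intro: less_le_trans)
  next
    fix a assume a: "\<theta> t < a"
    have "eventually (\<lambda>s. \<theta> s < a) (at_right t)"
      using theta_right_continuous[of t] lt t a by (intro order_tendstoD(2)) auto
    then obtain b where b: "b > t" "\<And>s. t < s \<Longrightarrow> s < b \<Longrightarrow> \<theta> s < a"
      unfolding eventually_at_right_field by blast
    define s where "s = min T ((t + b) / 2)"
    have s: "t < s" "s \<le> T" "\<theta> s < a" using b lt by (auto simp: s_def min_def intro!: b(2))
    have "\<theta> t < \<theta> s" using t s by (intro theta_less) auto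
    then have "eventually (\<lambda>n. eps n < \<theta> s - \<theta> t) sequentially"
      using eps_tendsto_0 by (intro order_tendstoD(2)) auto
    then show "eventually (\<lambda>n. \<theta> (grid n (Suc (block n t))) < a) sequentially"
    proof eventually_elim
      case (elim n)
      let ?k = "block n t"
      note b = block_props[OF t, of n]
      have "real ?k * eps n \<le> \<theta> t"
        using grid_le_iff[of ?k n t] b t by auto
      then have "real (Suc ?k) * eps n \<le> \<theta> s" using elim by (simp add: algebra_simps)
      then have "grid n (Suc ?k) \<le> s" using grid_le_iff[of "Suc ?k" n s] b s t by auto
      then have "\<theta> (grid n (Suc ?k)) \<le> \<theta> s"
        using grid_bounds[of "Suc ?k" n] b s by (intro theta_mono) auto
      then show ?case using s by simp
    qed
  qed
qed

text \<open>The index of the last grid point that does not exceed \<open>t\<close>.\<close>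
definition pre_index :: "nat \<Rightarrow> real \<Rightarrow> nat" where
  "pre_index n t = nat \<lfloor>\<theta> t / eps n\<rfloor>"

lemma pre_index_props:
  assumes "0 \<le> t" "t \<le> T"
  shows "pre_index n t \<le> 2 ^ n" "grid n (pre_index n t) \<le> t"
    "\<theta> t - \<theta> (grid n (pre_index n t)) \<le> eps n"
    "\<And>k. k \<le> 2 ^ n \<Longrightarrow> grid n k \<le> t \<Longrightarrow> k \<le> pre_index n t"
proof -
  have nn: "0 \<le> \<theta> t / eps n" using theta_nonneg[OF assms] eps_pos[of n] by simp
  have k: "real (pre_index n t) = of_int \<lfloor>\<theta> t / eps n\<rfloor>"
    unfolding pre_index_def using nn by simp
  have "\<theta> t \<le> 2 ^ n * eps n" using theta_mono[of t T] assms by (simp add: eps_def)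
  then have "\<theta> t / eps n \<le> 2 ^ n" using eps_pos[of n] by (simp add: pos_divide_le_eq)
  then have "real (pre_index n t) \<le> 2 ^ n"
    unfolding k by (rule order_trans[OF of_int_floor_le])
  then have "real (pre_index n t) \<le> real (2 ^ n)" by simp
  then show le: "pre_index n t \<le> 2 ^ n" using of_nat_le_iff by blast
  have "real (pre_index n t) \<le> \<theta> t / eps n" unfolding k by (rule of_int_floor_le)
  then have a: "real (pre_index n t) * eps n \<le> \<theta> t" using eps_pos[of n] by (simp add: pos_le_divide_eq)
  then show "grid n (pre_index n t) \<le> t" using grid_le_iff[OF le assms] by simp
  have "\<theta> t / eps n \<le> real (pre_index n t) + 1" unfolding k by linarith
  then have "\<theta> t \<le> (real (pre_index n t) + 1) * eps n" using eps_pos[of n] by (simp add: pos_divide_le_eq)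
  then show "\<theta> t - \<theta> (grid n (pre_index n t)) \<le> eps n"
    using level_le_theta_grid[OF le] by (simp add: algebra_simps)
  fix k assume "k \<le> 2 ^ n" "grid n k \<le> t"
  then have "real k * eps n \<le> \<theta> t" using grid_le_iff assms by auto
  then have "real k \<le> \<theta> t / eps n" using eps_pos[of n] by (simp add: pos_le_divide_eq)
  then have "int k \<le> \<lfloor>\<theta> t / eps n\<rfloor>" by (simp add: le_floor_iff)
  then show "k \<le> pre_index n t" unfolding pre_index_def by linarith
qed

text \<open>With coinciding grid points the index on the left may exceed \<open>k\<close>; only the
  points agree.\<close>

lemma pre_index_grid:
  assumes "k \<le> 2 ^ n"
  shows "grid n (pre_index n (grid n k)) = grid n k"
proof -
  note b = grid_bounds[OF assms]
  show ?thesis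
    using pre_index_props(2)[OF b, of n]
      grid_mono[OF pre_index_props(4)[OF b assms order_refl] pre_index_props(1)[OF b, of n]]
    by (rule antisym)
qed

end

section \<open>Differentiation along the grids\<close>

locale time_change_measure = time_change +
  fixes N :: "real measure"
  assumes sets_N: "sets N = sets (restrict_space borel {0..T})"
    and emeasure_N_Ioc: "0 \<le> s \<Longrightarrow> s \<le> t \<Longrightarrow> t \<le> T \<Longrightarrow> emeasure N {s<..t} = ennreal (\<theta> t - \<theta> s)"
    and emeasure_N_0: "emeasure N {0} = 0"
begin

lemma space_N: "space N = {0..T}"
  using sets_eq_imp_space_eq[OF sets_N] by (simp add: space_restrict_space)

lemma sets_N_Ioc [measurable, simp]: "0 \<le> s \<Longrightarrow> t \<le> T \<Longrightarrow> {s<..t} \<in> sets N"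
  unfolding sets_N by (auto simp: sets_restrict_space_iff)

sublocale finite_measure N
proof
  have "space N = {0} \<union> {0<..T}" using T_pos by (auto simp: space_N)
  moreover have "{0} \<in> sets N" unfolding sets_N using T_pos by (auto simp: sets_restrict_space_iff)
  ultimately have "emeasure N (space N) \<le> emeasure N {0} + emeasure N {0<..T}"
    using emeasure_subadditive[of "{0}" N "{0<..T}"] by simp
  also have "\<dots> = ennreal (\<theta> T)" using T_pos theta_0 by (simp add: emeasure_N_0 emeasure_N_Ioc)
  finally show "emeasure N (space N) \<noteq> \<infinity>" by (auto simp: top_unique)
qed

lemma measure_N_Ioc: "0 \<le> s \<Longrightarrow> s \<le> t \<Longrightarrow> t \<le> T \<Longrightarrow> measure N {s<..t} = \<theta> t - \<theta> s"
  using emeasure_N_Ioc[of s t] theta_mono[of s t] by (simp add: measure_def)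

lemma AE_N_pos: "AE t in N. 0 < t"
proof (rule AE_I[where N="{0}"])
  show "{0} \<in> sets N" unfolding sets_N using T_pos by (auto simp: sets_restrict_space_iff)
qed (auto simp: space_N emeasure_N_0)

lemma set_integrable_N:
  fixes g :: "real \<Rightarrow> 'c::{banach, second_countable_topology}"
  assumes "integrable N g" "0 \<le> s" "t \<le> T"
  shows "set_integrable N {s<..t} g"
  unfolding set_integrable_def using assms by (intro integrable_mult_indicator) auto

text \<open>The quotient is 0 on degenerate grid intervals.\<close>
definition quotient :: "(real \<Rightarrow> 'b::real_normed_vector) \<Rightarrow> nat \<Rightarrow> nat \<Rightarrow> 'b" where
  "quotient U n k = (U (grid n (Suc k)) - U (grid n k)) /\<^sub>R (\<theta> (grid n (Suc k)) - \<theta> (grid n k))"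

definition quotient_fun :: "(real \<Rightarrow> 'b::real_normed_vector) \<Rightarrow> nat \<Rightarrow> real \<Rightarrow> 'b" where
  "quotient_fun U n t = (\<Sum>k<2^n. indicator {grid n k<..grid n (Suc k)} t *\<^sub>R quotient U n k)"

lemma quotient_fun_block:
  assumes "k < 2 ^ n" "t \<in> {grid n k<..grid n (Suc k)}"
  shows "quotient_fun U n t = quotient U n k"
proof -
  have "indicator {grid n j<..grid n (Suc j)} t *\<^sub>R quotient U n j = (if j = k then quotient U n k else 0)"
    if "j < 2 ^ n" for j
  proof (cases "t \<in> {grid n j<..grid n (Suc j)}")
    case True
    then have "block n t = j" using block_unique[OF that, of t] by simp
    moreover have "block n t = k" using block_unique[OF assms(1), of t] assms(2) by simp
    ultimately show ?thesis using True by simp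
  qed (use assms in auto)
  then have "quotient_fun U n t = (\<Sum>j<2^n. if j = k then quotient U n k else 0)"
    unfolding quotient_fun_def by (intro sum.cong) auto
  then show ?thesis using assms(1) by simp
qed

lemma quotient_fun_eq:
  "0 < t \<Longrightarrow> t \<le> T \<Longrightarrow> quotient_fun U n t = quotient U n (block n t)"
  using block_props[of t n] by (intro quotient_fun_block) auto

section \<open>The martingale of difference quotients\<close>

context
  fixes U :: "real \<Rightarrow> 'b::{real_inner, banach, second_countable_topology}" and M :: real
  assumes lip: "0 \<le> s \<Longrightarrow> s \<le> t \<Longrightarrow> t \<le> T \<Longrightarrow> norm (U t - U s) \<le> M * (\<theta> t - \<theta> s)"
begin

lemma lip_const_nonneg: "0 \<le> M"
proof -
  have "0 \<le> norm (U T - U 0)" by simp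
  also have "\<dots> \<le> M * \<theta> T" using lip[of 0 T] T_pos theta_0 by simp
  finally show ?thesis using theta_T_pos by (simp add: zero_le_mult_iff)
qed

lemma norm_quotient_le:
  assumes "k < 2 ^ n"
  shows "norm (quotient U n k) \<le> M"
proof -
  have g: "grid n k \<le> grid n (Suc k)" using assms by (intro grid_mono) auto
  have b: "0 \<le> grid n k" "grid n (Suc k) \<le> T" using assms grid_bounds by auto
  let ?d = "\<theta> (grid n (Suc k)) - \<theta> (grid n k)"
  have "norm (quotient U n k) = norm (U (grid n (Suc k)) - U (grid n k)) / \<bar>?d\<bar>"
    by (simp add: quotient_def divide_inverse mult.commute)
  also have "\<dots> \<le> M"
  proof (cases "?d = 0")
    case False
    then have "0 < ?d" using theta_mono[OF b(1) g b(2)] by simp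
    then show ?thesis using lip[OF b(1) g b(2)] by (simp add: pos_divide_le_eq)
  qed (simp add: lip_const_nonneg)
  finally show ?thesis .
qed

lemma scaleR_quotient:
  assumes "k < 2 ^ n"
  shows "(\<theta> (grid n (Suc k)) - \<theta> (grid n k)) *\<^sub>R quotient U n k = U (grid n (Suc k)) - U (grid n k)"
proof (cases "grid n (Suc k) = grid n k")
  case False
  then have "\<theta> (grid n k) < \<theta> (grid n (Suc k))"
    using assms grid_mono[of k "Suc k" n] grid_bounds[of k n] grid_bounds[of "Suc k" n]
    by (intro theta_less) auto
  then show ?thesis by (simp add: quotient_def)
qed simp

lemma norm_quotient_fun_le: "norm (quotient_fun U n t) \<le> M"
proof (cases "\<exists>k<2^n. t \<in> {grid n k<..grid n (Suc k)}")
  case True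
  then obtain k where k: "k < 2 ^ n" "t \<in> {grid n k<..grid n (Suc k)}" by blast
  then show ?thesis using quotient_fun_block[OF k, of U] norm_quotient_le[OF k(1)] by simp
next
  case False
  then have "quotient_fun U n t = 0" unfolding quotient_fun_def by (intro sum.neutral) auto
  then show ?thesis using lip_const_nonneg by simp
qed

lemma quotient_fun_measurable [measurable]: "quotient_fun U n \<in> borel_measurable N"
  unfolding quotient_fun_def
  by (intro borel_measurable_sum borel_measurable_scaleR borel_measurable_indicator
      borel_measurable_const sets_N_Ioc grid_bounds) auto

lemma quotient_fun_integrable: "integrable N (quotient_fun U n)"
  using norm_quotient_fun_le by (intro integrable_const_bound[where B=M]) auto

lemma integral_quotient_fun:
  assumes "j \<le> 2 ^ n"
  shows "set_lebesgue_integral N {0<..grid n j} (quotient_fun U n) = U (grid n j) - U 0"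
  using assms
proof (induction j)
  case 0
  then show ?case by (simp add: set_lebesgue_integral_def)
next
  case (Suc j)
  let ?a = "grid n j" and ?b = "grid n (Suc j)"
  have g: "0 \<le> ?a" "?a \<le> ?b" "?b \<le> T" using Suc.prems grid_bounds grid_mono by auto
  have eq: "{0<..?b} = {0<..?a} \<union> {?a<..?b}" using g by auto
  have "set_lebesgue_integral N {?a<..?b} (quotient_fun U n)
      = set_lebesgue_integral N {?a<..?b} (\<lambda>_. quotient U n j)"
    using Suc.prems g by (intro set_lebesgue_integral_cong) (auto intro!: quotient_fun_block)
  also have "\<dots> = U ?b - U ?a"
  proof -
    have "set_lebesgue_integral N {?a<..?b} (\<lambda>_. quotient U n j) = measure N {?a<..?b} *\<^sub>R quotient U n j"
      unfolding set_lebesgue_integral_def using g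
      by (intro has_bochner_integral_integral_eq has_bochner_integral_indicator) (auto simp: emeasure_N_Ioc)
    then show ?thesis using scaleR_quotient[of j n] Suc.prems g by (simp add: measure_N_Ioc)
  qed
  finally have "set_lebesgue_integral N {?a<..?b} (quotient_fun U n) = U ?b - U ?a" .
  moreover have "set_lebesgue_integral N {0<..?b} (quotient_fun U n)
    = set_lebesgue_integral N {0<..?a} (quotient_fun U n) + set_lebesgue_integral N {?a<..?b} (quotient_fun U n)"
    unfolding eq using g
    by (intro set_integral_Un set_integrable_N quotient_fun_integrable) auto
  ultimately show ?case using Suc by simp
qed

text \<open>The martingale property: the mean of a finer quotient over a coarse block is the coarse
  quotient, because the end points of the block belong to the finer grid and the fine increments
  telescope.\<close>

lemma integral_quotient_fun_refine:
  assumes "k < 2 ^ n" "n \<le> m"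
  shows "set_lebesgue_integral N {grid n k<..grid n (Suc k)} (quotient_fun U m)
    = U (grid n (Suc k)) - U (grid n k)"
proof -
  let ?a = "grid n k" and ?b = "grid n (Suc k)"
  have g: "0 \<le> ?a" "?a \<le> ?b" "?b \<le> T" using assms grid_bounds grid_mono by auto
  have eq: "{0<..?b} = {0<..?a} \<union> {?a<..?b}" using g by auto
  obtain p where m: "m = n + p" using assms(2) le_Suc_ex by blast
  have I: "set_lebesgue_integral N {0<..grid n j} (quotient_fun U m) = U (grid n j) - U 0" if "j \<le> 2 ^ n" for j
    using integral_quotient_fun[of "j * 2 ^ p" m] that by (simp add: m grid_refine power_add)
  have "set_lebesgue_integral N {0<..?b} (quotient_fun U m)
    = set_lebesgue_integral N {0<..?a} (quotient_fun U m) + set_lebesgue_integral N {?a<..?b} (quotient_fun U m)"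
    unfolding eq using g
    by (intro set_integral_Un set_integrable_N quotient_fun_integrable) auto
  then show ?thesis using I[of k] I[of "Suc k"] assms by simp
qed

text \<open>The right side does not depend on \<open>m\<close>. Comparison with \<open>m = n\<close>
  shows that later increments are orthogonal to the quotient of level \<open>n\<close>.\<close>

lemma integral_inner_quotient_fun:
  assumes "n \<le> m"
  shows "(\<integral>t. quotient_fun U m t \<bullet> quotient_fun U n t \<partial>N)
    = (\<Sum>k<2^n. (U (grid n (Suc k)) - U (grid n k)) \<bullet> quotient U n k)"
proof -
  let ?B = "\<lambda>k. {grid n k<..grid n (Suc k)}"
  have si: "set_integrable N (?B k) (quotient_fun U m)" if "k < 2 ^ n" for k
    using that grid_bounds by (intro set_integrable_N quotient_fun_integrable) auto
  have "(\<integral>t. quotient_fun U m t \<bullet> quotient_fun U n t \<partial>N)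
      = (\<integral>t. (\<Sum>k<2^n. (indicator (?B k) t *\<^sub>R quotient_fun U m t) \<bullet> quotient U n k) \<partial>N)"
    by (intro Bochner_Integration.integral_cong) (simp_all add: quotient_fun_def[of U n] inner_sum_right)
  also have "\<dots> = (\<Sum>k<2^n. \<integral>t. (indicator (?B k) t *\<^sub>R quotient_fun U m t) \<bullet> quotient U n k \<partial>N)"
    using si by (intro Bochner_Integration.integral_sum integrable_inner_left) (auto simp: set_integrable_def)
  also have "\<dots> = (\<Sum>k<2^n. set_lebesgue_integral N (?B k) (quotient_fun U m) \<bullet> quotient U n k)"
    using si unfolding set_lebesgue_integral_def set_integrable_def
    by (intro sum.cong refl integral_inner_left) auto
  also have "\<dots> = (\<Sum>k<2^n. (U (grid n (Suc k)) - U (grid n k)) \<bullet> quotient U n k)"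
    using assms by (intro sum.cong refl) (simp add: integral_quotient_fun_refine)
  finally show ?thesis .
qed

text \<open>The quotients form an \<open>L\<^sup>2\<close>-bounded martingale for the filtration generated by the grids,
  hence an \<open>L\<^sup>1\<close>-Cauchy sequence by orthogonality of the increments.\<close>
lemma quotient_fun_L2_increment:
  assumes "n \<le> m"
  shows "(\<integral>t. (norm (quotient_fun U m t - quotient_fun U n t))\<^sup>2 \<partial>N)
    = (\<integral>t. (norm (quotient_fun U m t))\<^sup>2 \<partial>N) - (\<integral>t. (norm (quotient_fun U n t))\<^sup>2 \<partial>N)"
proof -
  have int: "integrable N (\<lambda>t. quotient_fun U i t \<bullet> quotient_fun U j t)" for i j
  proof (rule integrable_const_bound[where B="M * M"])
    have "norm (quotient_fun U i t \<bullet> quotient_fun U j t) \<le> M * M" for t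
      using norm_quotient_fun_le lip_const_nonneg
      unfolding real_norm_def
      by (intro order_trans[OF Cauchy_Schwarz_ineq2] mult_mono) auto
    then show "AE t in N. norm (quotient_fun U i t \<bullet> quotient_fun U j t) \<le> M * M" by simp
  qed measurable
  have "(\<integral>t. (norm (quotient_fun U m t - quotient_fun U n t))\<^sup>2 \<partial>N)
    = (\<integral>t. quotient_fun U m t \<bullet> quotient_fun U m t - 2 * (quotient_fun U m t \<bullet> quotient_fun U n t)
         + quotient_fun U n t \<bullet> quotient_fun U n t \<partial>N)"
    by (simp add: power2_norm_eq_inner inner_diff inner_commute algebra_simps)
  also have "\<dots> = (\<integral>t. quotient_fun U m t \<bullet> quotient_fun U m t \<partial>N)
      - 2 * (\<integral>t. quotient_fun U m t \<bullet> quotient_fun U n t \<partial>N)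
      + (\<integral>t. quotient_fun U n t \<bullet> quotient_fun U n t \<partial>N)"
    by (simp add: int)
  finally show ?thesis
    using integral_inner_quotient_fun[OF assms] integral_inner_quotient_fun[of n n]
    by (simp add: power2_norm_eq_inner)
qed

lemma quotient_fun_L1_Cauchy:
  assumes "e > 0"
  shows "\<exists>n0. \<forall>i\<ge>n0. \<forall>j\<ge>n0. (\<integral>t. norm (quotient_fun U i t - quotient_fun U j t) \<partial>N) < e"
proof -
  define E where "E n = (\<integral>t. (norm (quotient_fun U n t))\<^sup>2 \<partial>N)" for n
  \<comment> \<open>A norm \<open>d\<close> satisfies \<open>d \<le> b\<close> or
    \<open>d \<le> d\<^sup>2 / b\<close>, which turns the estimate of squares into one of norms.
    This \<open>b\<close> keeps the first part below \<open>e / 2\<close>; the added 1 keeps the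
    denominator positive.\<close>
  define b where "b = e / (2 * (measure N (space N) + 1))"
  have b: "b > 0" using assms measure_nonneg[of N "space N"] by (simp add: b_def add_nonneg_pos)
  have bN: "b * measure N (space N) \<le> e / 2"
  proof -
    have "b * measure N (space N) \<le> b * (measure N (space N) + 1)" using b by simp
    also have "\<dots> = e / 2"
      using measure_nonneg[of N "space N"] by (simp add: b_def field_simps add_nonneg_eq_0_iff)
    finally show ?thesis .
  qed
  have "incseq E"
  proof (rule incseq_SucI)
    fix n
    have "0 \<le> E (Suc n) - E n"
      unfolding E_def using quotient_fun_L2_increment[of n "Suc n"]
        Bochner_Integration.integral_nonneg[of N "\<lambda>t. (norm (quotient_fun U (Suc n) t - quotient_fun U n t))\<^sup>2"] by simp
    then show "E n \<le> E (Suc n)" by simp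
  qed
  moreover have "E n \<le> M\<^sup>2 * measure N (space N)" for n
  proof -
    have "E n \<le> (\<integral>t. M\<^sup>2 \<partial>N)" unfolding E_def
    proof (rule integral_mono)
      show "integrable N (\<lambda>t. (norm (quotient_fun U n t))\<^sup>2)"
        using norm_quotient_fun_le by (intro integrable_const_bound[where B="M\<^sup>2"]) (auto intro!: power_mono)
    qed (use norm_quotient_fun_le in \<open>auto intro!: power_mono\<close>)
    then show ?thesis by (simp add: mult.commute)
  qed
  ultimately have "convergent E" by (meson incseq_convergent convergent_def)
  then have "Cauchy E" by (rule convergent_Cauchy)
  then obtain n0 where n0: "\<And>i j. i \<ge> n0 \<Longrightarrow> j \<ge> n0 \<Longrightarrow> dist (E i) (E j) < b * (e / 2)"
  proof -
    have "0 < b * (e / 2)" using b assms by simp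
    from metric_CauchyD[OF \<open>Cauchy E\<close> this] show ?thesis using that by blast
  qed
  have *: "(\<integral>t. norm (quotient_fun U i t - quotient_fun U j t) \<partial>N) < e"
    if ij: "n0 \<le> j" "j \<le> i" for i j
  proof -
    let ?d = "\<lambda>t. norm (quotient_fun U i t - quotient_fun U j t)"
    have d_le: "?d t \<le> 2 * M" for t
      using norm_triangle_ineq4[of "quotient_fun U i t" "quotient_fun U j t"]
        norm_quotient_fun_le[of i t] norm_quotient_fun_le[of j t] by simp
    have int2: "integrable N (\<lambda>t. (?d t)\<^sup>2)"
    proof (rule integrable_const_bound[where B="(2 * M)\<^sup>2"])
      have "norm ((?d t)\<^sup>2) \<le> (2 * M)\<^sup>2" for t
        using power_mono[OF d_le[of t] norm_ge_zero, of 2] by simp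
      then show "AE t in N. norm ((?d t)\<^sup>2) \<le> (2 * M)\<^sup>2" by simp
    qed measurable
    have pw: "?d t \<le> b + (?d t)\<^sup>2 / b" for t
    proof (cases "?d t \<le> b")
      case False
      then have "?d t * b \<le> ?d t * ?d t" by (intro mult_left_mono) auto
      then have "?d t \<le> (?d t)\<^sup>2 / b" using b by (simp add: pos_le_divide_eq power2_eq_square)
      then show ?thesis using b by simp
    qed (use b in \<open>simp add: add_increasing2\<close>)
    have "(\<integral>t. ?d t \<partial>N) \<le> (\<integral>t. b + (?d t)\<^sup>2 / b \<partial>N)"
      using pw int2 quotient_fun_integrable by (intro integral_mono) auto
    also have "\<dots> = b * measure N (space N) + (\<integral>t. (?d t)\<^sup>2 \<partial>N) / b"
      using int2 by simp
    also have "(\<integral>t. (?d t)\<^sup>2 \<partial>N) = E i - E j"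
      unfolding E_def by (rule quotient_fun_L2_increment[OF ij(2)])
    also have "(E i - E j) / b < e / 2"
    proof -
      have "E i - E j < b * (e / 2)"
        using n0[of i j] ij unfolding dist_real_def by linarith
      then show ?thesis using b by (simp add: pos_divide_less_eq mult.commute)
    qed
    finally show ?thesis using bN by linarith
  qed
  have "(\<integral>t. norm (quotient_fun U i t - quotient_fun U j t) \<partial>N) < e" if "i \<ge> n0" "j \<ge> n0" for i j
  proof (cases "j \<le> i")
    case False
    then show ?thesis using *[of i j] that by (simp add: norm_minus_commute[of "quotient_fun U i _"])
  qed (use * that in simp)
  then show ?thesis by blast
qed

text \<open>An \<open>L\<^sup>1\<close>-Cauchy sequence has an almost everywhere Cauchy subsequence,
  whose limit inherits the bound \<open>M\<close>. The primitive is recovered exactly at grid points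
  by dominated convergence; a general \<open>t\<close> exceeds a grid point by at most
  \<open>eps n\<close> in \<open>\<theta>\<close>, and both sides are Lipschitz in
  \<open>\<theta>\<close>.\<close>

theorem grid_differentiation:
  obtains r v where "strict_mono r" "integrable N v"
    "AE t in N. (\<lambda>i. quotient_fun U (r i) t) \<longlonglongrightarrow> v t"
    "\<And>t. 0 \<le> t \<Longrightarrow> t \<le> T \<Longrightarrow> U t = U 0 + set_lebesgue_integral N {0<..t} v"
proof -
  obtain r where r: "strict_mono r" and ae: "AE t in N. Cauchy (\<lambda>i. quotient_fun U (r i) t)"
    using cauchy_L1_AE_cauchy_subseq[OF quotient_fun_integrable quotient_fun_L1_Cauchy] by blast
  define v where "v t = lim (\<lambda>i. quotient_fun U (r i) t)" for t
  have [measurable]: "v \<in> borel_measurable N"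
    unfolding v_def[abs_def] by (rule borel_measurable_lim_metric) measurable
  have conv: "AE t in N. (\<lambda>i. quotient_fun U (r i) t) \<longlonglongrightarrow> v t"
    using ae by eventually_elim (auto simp: v_def intro!: Cauchy_convergent convergent_LIMSEQ_iff[THEN iffD1])
  have v_le: "AE t in N. norm (v t) \<le> M"
    using conv
  proof eventually_elim
    case (elim t)
    then show ?case
      using norm_quotient_fun_le by (intro Lim_norm_ubound[OF _ elim]) auto
  qed
  have v_int: "integrable N v"
    using v_le by (intro integrable_const_bound[where B=M]) auto
  have grid_eq: "set_lebesgue_integral N {0<..grid n k} v = U (grid n k) - U 0" if k: "k \<le> 2 ^ n" for n k
  proof -
    have ms: "{0<..grid n k} \<in> sets N" using k grid_bounds by simp
    have "(\<lambda>i. set_lebesgue_integral N {0<..grid n k} (quotient_fun U (r i)))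
        \<longlonglongrightarrow> set_lebesgue_integral N {0<..grid n k} v"
      unfolding set_lebesgue_integral_def
    proof (rule integral_dominated_convergence[where w="\<lambda>_. M"])
      show "AE t in N. (\<lambda>i. indicator {0<..grid n k} t *\<^sub>R quotient_fun U (r i) t)
          \<longlonglongrightarrow> indicator {0<..grid n k} t *\<^sub>R v t"
        using conv by eventually_elim (intro tendsto_intros)
      show "AE t in N. norm (indicator {0<..grid n k} t *\<^sub>R quotient_fun U (r i) t) \<le> M" for i
        using norm_quotient_fun_le lip_const_nonneg by (auto simp: indicator_def)
      show "(\<lambda>t. indicator {0<..grid n k} t *\<^sub>R v t) \<in> borel_measurable N"
        "(\<lambda>t. indicator {0<..grid n k} t *\<^sub>R quotient_fun U (r i) t) \<in> borel_measurable N" for i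
        by (intro borel_measurable_scaleR borel_measurable_indicator ms; measurable)+
    qed simp
    \<comment> \<open>From \<open>i = n\<close> on, the grid of level \<open>r i\<close> contains
      \<open>grid n k\<close>, so the sequence is eventually constant.\<close>
    moreover have "\<forall>\<^sub>F i in sequentially. set_lebesgue_integral N {0<..grid n k} (quotient_fun U (r i))
        = U (grid n k) - U 0"
    proof (rule eventually_sequentiallyI[of n])
      fix i assume "n \<le> i"
      then have "n \<le> r i" using seq_suble[OF r, of i] by simp
      then obtain p where p: "r i = n + p" using le_Suc_ex by blast
      show "set_lebesgue_integral N {0<..grid n k} (quotient_fun U (r i)) = U (grid n k) - U 0"
        using integral_quotient_fun[of "k * 2 ^ p" "r i"] k by (simp add: p grid_refine power_add)
    qed
    ultimately show ?thesis
      by (intro LIMSEQ_unique[OF _ tendsto_eventually])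
  qed
  have "U t = U 0 + set_lebesgue_integral N {0<..t} v" if t: "0 \<le> t" "t \<le> T" for t
  proof -
    let ?D = "set_lebesgue_integral N {0<..t} v - (U t - U 0)"
    have "norm ?D \<le> 2 * M * eps n" for n
    proof -
      let ?q = "grid n (pre_index n t)"
      note p = pre_index_props[OF t, of n]
      have q: "0 \<le> ?q" "?q \<le> t" using p grid_bounds by auto
      have eq: "{0<..t} = {0<..?q} \<union> {?q<..t}" using q by auto
      have "set_lebesgue_integral N {0<..t} v
        = set_lebesgue_integral N {0<..?q} v + set_lebesgue_integral N {?q<..t} v"
        unfolding eq using q t by (intro set_integral_Un set_integrable_N v_int) auto
      then have D: "?D = set_lebesgue_integral N {?q<..t} v - (U t - U ?q)"
        using grid_eq[OF p(1)] by simp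
      have vi: "integrable N (\<lambda>s. indicator {?q<..t} s *\<^sub>R v s)"
        using set_integrable_N[OF v_int, of ?q t] q t by (simp add: set_integrable_def)
      have "norm (set_lebesgue_integral N {?q<..t} v) \<le> (\<integral>s. norm (indicator {?q<..t} s *\<^sub>R v s) \<partial>N)"
        unfolding set_lebesgue_integral_def by (rule integral_norm_bound)
      also have "\<dots> \<le> (\<integral>s. M * indicator {?q<..t} s \<partial>N)"
      proof (rule integral_mono_AE)
        show "integrable N (\<lambda>s. M * indicator {?q<..t} s)"
          using q t by (intro integrable_mult_right integrable_real_indicator) (auto simp: emeasure_N_Ioc)
        show "AE s in N. norm (indicator {?q<..t} s *\<^sub>R v s) \<le> M * indicator {?q<..t} s"
          using v_le by eventually_elim (auto simp: indicator_def)
        show "integrable N (\<lambda>s. norm (indicator {?q<..t} s *\<^sub>R v s))"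
          using vi by (rule integrable_norm)
      qed
      also have "\<dots> = M * (\<theta> t - \<theta> ?q)" using q t by (simp add: measure_N_Ioc space_N Int_absorb2 subset_eq)
      finally have "norm (set_lebesgue_integral N {?q<..t} v) \<le> M * (\<theta> t - \<theta> ?q)" .
      moreover have "norm (U t - U ?q) \<le> M * (\<theta> t - \<theta> ?q)" using q t by (intro lip) auto
      moreover have "M * (\<theta> t - \<theta> ?q) \<le> M * eps n"
        using p(3) lip_const_nonneg by (intro mult_left_mono) auto
      ultimately show ?thesis
        unfolding D using norm_triangle_ineq4[of "set_lebesgue_integral N {?q<..t} v" "U t - U ?q"] by linarith
    qed
    moreover have "(\<lambda>n. 2 * M * eps n) \<longlonglongrightarrow> 2 * M * 0" by (intro tendsto_intros eps_tendsto_0)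
    ultimately have "norm ?D \<le> 2 * M * 0" by (intro LIMSEQ_le_const) auto
    then show ?thesis by (simp add: algebra_simps)
  qed
  then show thesis using that r v_int conv by blast
qed

end

end

section \<open>The implicit Euler scheme\<close>

text \<open>
  The Lipschitz constant \<open>\<alpha>\<close> of the theorem is only Lebesgue measurable. Here \<open>a\<close> is a Borel function
  that agrees with \<open>\<bar>\<alpha>\<bar>\<close> up to a null set; therefore continuity of \<open>f t\<close> for every \<open>t\<close> is a separate assumption.
\<close>
locale evolution =
  fixes T :: real
    and A :: "real \<Rightarrow> 'a::{real_inner, banach, second_countable_topology} \<Rightarrow> 'a set"
    and f :: "real \<Rightarrow> 'a \<Rightarrow> 'a"
    and \<rho> a :: "real \<Rightarrow> real"
    and c m :: real
    and u0 :: 'a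
  assumes T_pos: "T > 0"
    and A_maximal: "t \<in> {0..T} \<Longrightarrow> maximal_monotone (A t)"
    and rho_right_continuous: "t \<in> {0..<T} \<Longrightarrow> continuous (at_right t) \<rho>"
    and rho_mono: "mono_on {0..T} \<rho>"
    and rho_0: "\<rho> 0 = 0"
    and A_dis: "0 \<le> s \<Longrightarrow> s \<le> t \<Longrightarrow> t \<le> T \<Longrightarrow> vladimirov_dis (A t) (A s) \<le> ereal (\<rho> t - \<rho> s)"
    and c_nonneg: "c \<ge> 0"
    and A_growth: "t \<in> {0..T} \<Longrightarrow> x \<in> op_domain (A t) \<Longrightarrow> norm (min_section (A t) x) \<le> c * (1 + norm x)"
    and f_measurable: "(\<lambda>t. f t x) \<in> borel_measurable (lebesgue_measure_I T)"
    and m_nonneg: "m \<ge> 0"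
    and f_growth: "t \<in> {0..T} \<Longrightarrow> norm (f t x) \<le> m * (1 + norm x)"
    and a_integrable: "integrable (lebesgue_measure_I T) a"
    and a_nonneg: "0 \<le> a t"
    and f_lipschitz: "AE t in lebesgue_measure_I T. \<forall>x y. norm (f t x - f t y) \<le> a t * norm (x - y)"
    and f_continuous: "t \<in> {0..T} \<Longrightarrow> continuous_on UNIV (f t)"
    and u0_domain: "u0 \<in> op_domain (A 0)"
begin

definition \<theta> :: "real \<Rightarrow> real" where "\<theta> t = t + \<rho> t"

lemma rho_le: "0 \<le> s \<Longrightarrow> s \<le> t \<Longrightarrow> t \<le> T \<Longrightarrow> \<rho> s \<le> \<rho> t"
  using mono_onD[OF rho_mono, of s t] by auto

sublocale time_change T \<theta>
proof
  show "(\<theta> \<longlongrightarrow> \<theta> t) (at_right t)" if "0 \<le> t" "t < T" for t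
    unfolding \<theta>_def[abs_def]
    using rho_right_continuous[of t] that by (intro tendsto_intros) (auto simp: continuous_within)
qed (use T_pos rho_0 rho_le in \<open>auto simp: \<theta>_def\<close>)

abbreviation L :: "real measure" where "L \<equiv> lebesgue_measure_I T"

lemma sets_L: "sets L = sets (restrict_space borel {0..T})"
  by (simp add: lebesgue_measure_I_def sets_restrict_space)

lemma emeasure_L_Ioc: "0 \<le> s \<Longrightarrow> s \<le> t \<Longrightarrow> t \<le> T \<Longrightarrow> emeasure L {s<..t} = ennreal (t - s)"
  unfolding lebesgue_measure_I_def by (subst emeasure_restrict_space) auto

sublocale leb: time_change_measure T "\<lambda>t. t" L
proof
  show "emeasure L {0} = 0"
    unfolding lebesgue_measure_I_def using T_pos by (subst emeasure_restrict_space) auto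
qed (use T_pos sets_L emeasure_L_Ioc in auto)

lemma bounded_integrable_L:
  fixes g :: "real \<Rightarrow> 'a"
  assumes "g \<in> borel_measurable L" "\<And>t. t \<in> {0..T} \<Longrightarrow> norm (g t) \<le> K"
  shows "integrable L g"
  using assms by (intro leb.integrable_const_bound[where B=K]) (auto simp: leb.space_N)

text \<open>The perturbation enters a step as an exact time integral with \<open>x\<close> frozen:
  \<open>f\<close> is only measurable in time, so sampled values would carry no information in the
  limit.\<close>

definition drift :: "real \<Rightarrow> real \<Rightarrow> 'a \<Rightarrow> 'a" where
  "drift s t x = set_lebesgue_integral L {s<..t} (\<lambda>r. f r x)"

lemma f_integrable: "integrable L (\<lambda>r. f r x)"
  by (rule bounded_integrable_L[OF f_measurable f_growth])

lemma set_integral_Ioc_add: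
  fixes g :: "real \<Rightarrow> 'b::{banach, second_countable_topology}"
  assumes "integrable L g" "0 \<le> r" "r \<le> s" "s \<le> t" "t \<le> T"
  shows "set_lebesgue_integral L {r<..t} g
    = set_lebesgue_integral L {r<..s} g + set_lebesgue_integral L {s<..t} g"
proof -
  have eq: "{r<..t} = {r<..s} \<union> {s<..t}" using assms by auto
  show ?thesis
    unfolding eq using assms by (intro set_integral_Un leb.set_integrable_N) auto
qed

text \<open>A bound on the open interval suffices because \<open>{t}\<close> is a Lebesgue null set.
  This matters where the bound comes from \<open>theta_grid_gap\<close>, which says nothing at a
  right end point.\<close>

lemma norm_set_integral_L_le:
  fixes g :: "real \<Rightarrow> 'b::{banach, second_countable_topology}"
  assumes "integrable L g" "integrable L h" "0 \<le> s" "t \<le> T"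
    and "AE r in L. r \<in> {s<..<t} \<longrightarrow> norm (g r) \<le> h r"
  shows "norm (set_lebesgue_integral L {s<..t} g) \<le> set_lebesgue_integral L {s<..t} h"
proof -
  have gi: "integrable L (\<lambda>r. indicator {s<..t} r *\<^sub>R g r)"
    using leb.set_integrable_N[OF assms(1,3,4)] by (simp add: set_integrable_def)
  have hi: "integrable L (\<lambda>r. indicator {s<..t} r *\<^sub>R h r)"
    using leb.set_integrable_N[OF assms(2,3,4)] by (simp add: set_integrable_def)
  have "AE r in lborel. r \<noteq> t" by (rule AE_lborel_singleton)
  then have ne: "AE r in L. r \<noteq> t"
    unfolding lebesgue_measure_I_def by (subst AE_restrict_space_iff) auto
  have "norm (set_lebesgue_integral L {s<..t} g) \<le> (\<integral>r. norm (indicator {s<..t} r *\<^sub>R g r) \<partial>L)"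
    unfolding set_lebesgue_integral_def by (rule integral_norm_bound)
  also have "\<dots> \<le> (\<integral>r. indicator {s<..t} r *\<^sub>R h r \<partial>L)"
  proof (rule integral_mono_AE[OF integrable_norm[OF gi] hi])
    show "AE r in L. norm (indicator {s<..t} r *\<^sub>R g r) \<le> indicator {s<..t} r *\<^sub>R h r"
      using assms(5) ne by eventually_elim (auto simp: indicator_def)
  qed
  finally show ?thesis by (simp add: set_lebesgue_integral_def)
qed

lemma set_integral_const_L: "0 \<le> s \<Longrightarrow> s \<le> t \<Longrightarrow> t \<le> T \<Longrightarrow> set_lebesgue_integral L {s<..t} (\<lambda>_. K::real) = (t - s) * K"
  unfolding set_lebesgue_integral_def
  using leb.measure_N_Ioc[of s t]
  by (subst has_bochner_integral_integral_eq[OF has_bochner_integral_indicator]) (auto simp: emeasure_L_Ioc)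

lemma norm_drift_le:
  assumes "0 \<le> s" "s \<le> t" "t \<le> T"
  shows "norm (drift s t x) \<le> (t - s) * (m * (1 + norm x))"
proof -
  have "norm (drift s t x) \<le> set_lebesgue_integral L {s<..t} (\<lambda>_. m * (1 + norm x))"
    unfolding drift_def using assms f_growth by (intro norm_set_integral_L_le f_integrable) auto
  then show ?thesis unfolding set_integral_const_L[OF assms] .
qed

lemma drift_refl [simp]: "drift s s x = 0"
  by (simp add: drift_def set_lebesgue_integral_def)

lemma drift_add:
  "0 \<le> r \<Longrightarrow> r \<le> s \<Longrightarrow> s \<le> t \<Longrightarrow> t \<le> T \<Longrightarrow> drift r t x = drift r s x + drift s t x"
  unfolding drift_def by (intro set_integral_Ioc_add f_integrable)

definition aint :: "real \<Rightarrow> real \<Rightarrow> real" where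
  "aint s t = set_lebesgue_integral L {s<..t} a"

lemma aint_refl [simp]: "aint s s = 0"
  by (simp add: aint_def set_lebesgue_integral_def)

lemma aint_add:
  "0 \<le> r \<Longrightarrow> r \<le> s \<Longrightarrow> s \<le> t \<Longrightarrow> t \<le> T \<Longrightarrow> aint r t = aint r s + aint s t"
  unfolding aint_def by (intro set_integral_Ioc_add a_integrable)

lemma aint_nonneg: "0 \<le> aint s t"
  unfolding aint_def set_lebesgue_integral_def
  by (intro Bochner_Integration.integral_nonneg) (simp add: a_nonneg)

lemma drift_lipschitz:
  assumes "0 \<le> s" "s \<le> t" "t \<le> T"
  shows "norm (drift s t x - drift s t y) \<le> aint s t * norm (x - y)"
proof -
  have "drift s t x - drift s t y = set_lebesgue_integral L {s<..t} (\<lambda>r. f r x - f r y)"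
    unfolding drift_def using assms by (intro set_integral_diff(2)[symmetric] leb.set_integrable_N f_integrable) auto
  also have "norm \<dots> \<le> set_lebesgue_integral L {s<..t} (\<lambda>r. a r * norm (x - y))"
  proof (rule norm_set_integral_L_le)
    show "AE r in L. r \<in> {s<..<t} \<longrightarrow> norm (f r x - f r y) \<le> a r * norm (x - y)"
      using f_lipschitz by eventually_elim auto
  qed (use assms f_integrable a_integrable in auto)
  finally show ?thesis by (simp add: aint_def)
qed

text \<open>
  Along every scheme \<open>1 + \<parallel>w\<parallel> \<le> B\<close>, and \<open>M\<close> bounds both the selections \<open>z\<close> and the Lipschitz constant
  of \<open>w\<close> with respect to \<open>\<theta>\<close>.
\<close>
definition C1 :: real where "C1 = 2 * (m + c + 2)"

definition C2 :: real where "C2 = m + C1"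

definition B :: real where "B = (1 + norm u0) * exp (C2 * \<theta> T)"

definition M :: real where "M = C2 * B"

lemma constants: "0 \<le> C1" "0 \<le> C2" "1 \<le> B" "0 \<le> M" "m * B + C1 * B = M"
proof -
  show C: "0 \<le> C1" "0 \<le> C2" using m_nonneg c_nonneg by (auto simp: C1_def C2_def)
  have "1 * 1 \<le> (1 + norm u0) * exp (C2 * \<theta> T)"
    using C theta_T_pos by (intro mult_mono) auto
  then show B: "1 \<le> B" by (simp add: B_def)
  then show "0 \<le> M" using C by (simp add: M_def)
  show "m * B + C1 * B = M" by (simp add: M_def C2_def algebra_simps)
qed

lemma A_monotone: "t \<in> {0..T} \<Longrightarrow> y \<in> A t x \<Longrightarrow> y' \<in> A t x' \<Longrightarrow> 0 \<le> (y - y') \<bullet> (x - x')"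
  using monotone_opD[OF maximal_monotone_imp_monotone[OF A_maximal]] .

text \<open>Minty's theorem solves the step with parameter \<open>\<theta> t - \<theta> s\<close>,
  which dominates both \<open>\<rho> t - \<rho> s\<close> and \<open>t - s\<close>. Comparison with
  the minimal section at \<open>x\<close> then bounds \<open>z\<close> independently of the
  step.\<close>

lemma euler_step_exists:
  assumes st: "0 \<le> s" "s \<le> t" "t \<le> T" and x: "x \<in> op_domain (A s)"
  obtains x' z where "z \<in> A t x'" "x' = x - drift s t x - (\<theta> t - \<theta> s) *\<^sub>R z"
    "norm z \<le> C1 * (1 + norm x)"
proof -
  have s: "s \<in> {0..T}" and t: "t \<in> {0..T}" using st by auto
  define y where "y = min_section (A s) x"
  have y: "y \<in> A s x" unfolding y_def by (rule min_section_mem[OF A_maximal[OF s] x])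
  have ny: "norm y \<le> c * (1 + norm x)" unfolding y_def by (rule A_growth[OF s x])
  show thesis
  proof (cases "s = t")
    \<comment> \<open>A degenerate step, as between coinciding grid points: \<open>x\<close> stays,
      and the minimal section serves as \<open>z\<close>.\<close>
    case True
    have "c * (1 + norm x) \<le> C1 * (1 + norm x)"
      using m_nonneg c_nonneg by (intro mult_right_mono) (auto simp: C1_def)
    then show thesis using that[of y x] True y ny by auto
  next
    case False
    let ?h = "\<theta> t - \<theta> s"
    have h: "0 < ?h" "t - s \<le> ?h" using False st theta_less[of s t] theta_expanding[of s t] by auto
    obtain x' z where z: "z \<in> A t x'" and eq: "x' + ?h *\<^sub>R z = x - drift s t x"
      using minty_resolvent_exists[OF A_maximal[OF t] h(1), of "x - drift s t x"] by blast
    have "norm z \<le> 2 * (m * (1 + norm x) + norm y + 2)"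
    proof (rule resolvent_displacement_bound[OF A_dis[OF st] _ _ h(1) y z eq])
      show "0 \<le> \<rho> t - \<rho> s" using rho_le[OF st] by simp
      show "\<rho> t - \<rho> s \<le> ?h" using st by (simp add: \<theta>_def)
      have "norm (drift s t x) \<le> (t - s) * (m * (1 + norm x))" by (rule norm_drift_le[OF st])
      also have "\<dots> \<le> ?h * (m * (1 + norm x))"
        using h m_nonneg by (intro mult_right_mono) auto
      finally show "norm (drift s t x) \<le> ?h * (m * (1 + norm x))" .
    qed (use m_nonneg in auto)
    \<comment> \<open>Each of the three terms is made a multiple of \<open>1 + norm x\<close>; this
      is the origin of \<open>C1\<close>.\<close>
    also have "\<dots> \<le> 2 * (m * (1 + norm x) + c * (1 + norm x) + 2 * (1 + norm x))"
      using ny m_nonneg by (intro mult_left_mono add_mono) auto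
    also have "\<dots> = C1 * (1 + norm x)" by (simp add: C1_def algebra_simps)
    finally show thesis using that[OF z] eq by (simp add: algebra_simps)
  qed
qed

text \<open>All natural numbers serve as indices, so that schemes need no terminal case: a finite
  grid is continued by repeating \<open>T\<close>, and the extra steps are degenerate.\<close>

definition mesh :: "(nat \<Rightarrow> real) \<Rightarrow> bool" where
  "mesh s \<longleftrightarrow> s 0 = 0 \<and> mono s \<and> (\<forall>j. s j \<le> T)"

lemma meshD:
  assumes "mesh s"
  shows "s 0 = 0" "0 \<le> s j" "s j \<le> T" "i \<le> j \<Longrightarrow> s i \<le> s j"
  using assms monoD[of s 0 j] monoD[of s i j] by (auto simp: mesh_def)

lemma mesh_theta_le: "mesh s \<Longrightarrow> i \<le> j \<Longrightarrow> \<theta> (s i) \<le> \<theta> (s j)"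
  using meshD[of s] by (intro theta_mono) auto

definition scheme :: "(nat \<Rightarrow> real) \<Rightarrow> (nat \<Rightarrow> 'a) \<Rightarrow> (nat \<Rightarrow> 'a) \<Rightarrow> bool" where
  "scheme s w z \<longleftrightarrow> w 0 = u0 \<and> (\<forall>j.
     z (Suc j) \<in> A (s (Suc j)) (w (Suc j)) \<and>
     w (Suc j) = w j - drift (s j) (s (Suc j)) (w j) - (\<theta> (s (Suc j)) - \<theta> (s j)) *\<^sub>R z (Suc j) \<and>
     norm (z (Suc j)) \<le> C1 * (1 + norm (w j)))"

text \<open>Dependent choice with the invariant that the current point lies in the domain of the
  current operator, as the next step needs its minimal section.\<close>

lemma scheme_exists:
  assumes s: "mesh s"
  shows "\<exists>w z. scheme s w z"
proof -
  let ?P = "\<lambda>j p. fst p \<in> op_domain (A (s j)) \<and> (j = 0 \<longrightarrow> fst p = u0)"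
  let ?Q = "\<lambda>j p q. snd q \<in> A (s (Suc j)) (fst q) \<and>
     fst q = fst p - drift (s j) (s (Suc j)) (fst p) - (\<theta> (s (Suc j)) - \<theta> (s j)) *\<^sub>R snd q \<and>
     norm (snd q) \<le> C1 * (1 + norm (fst p))"
  have "\<exists>g. \<forall>j. ?P j (g j) \<and> ?Q j (g j) (g (Suc j))"
  proof (rule dependent_nat_choice)
    show "\<exists>p. ?P 0 p" using u0_domain meshD(1)[OF s] by auto
  next
    fix p j assume "?P j p"
    then obtain x' z where "z \<in> A (s (Suc j)) x'"
      "x' = fst p - drift (s j) (s (Suc j)) (fst p) - (\<theta> (s (Suc j)) - \<theta> (s j)) *\<^sub>R z"
      "norm z \<le> C1 * (1 + norm (fst p))"
      using euler_step_exists[of "s j" "s (Suc j)" "fst p"] meshD[OF s] by (metis le_Suc_eq order_refl)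
    then show "\<exists>q. ?P (Suc j) q \<and> ?Q j p q"
      by (intro exI[of _ "(x', z)"]) (auto simp: op_domain_def)
  qed
  then obtain g where "\<And>j. ?P j (g j) \<and> ?Q j (g j) (g (Suc j))" by blast
  then have "scheme s (\<lambda>j. fst (g j)) (\<lambda>j. snd (g j))" unfolding scheme_def by blast
  then show ?thesis by blast
qed

section \<open>A priori bounds along a scheme\<close>

context
  fixes s w z
  assumes s: "mesh s" and sch: "scheme s w z"
begin

lemma schemeD:
  "w 0 = u0" "z (Suc j) \<in> A (s (Suc j)) (w (Suc j))"
  "w (Suc j) = w j - drift (s j) (s (Suc j)) (w j) - (\<theta> (s (Suc j)) - \<theta> (s j)) *\<^sub>R z (Suc j)"
  "norm (z (Suc j)) \<le> C1 * (1 + norm (w j))"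
  using sch unfolding scheme_def by blast+

lemma scheme_drift_le:
  "norm (drift (s j) (s (Suc j)) x) \<le> (\<theta> (s (Suc j)) - \<theta> (s j)) * (m * (1 + norm x))"
proof -
  have st: "0 \<le> s j" "s j \<le> s (Suc j)" "s (Suc j) \<le> T" using meshD[OF s] by auto
  note norm_drift_le[OF st, of x]
  also have "(s (Suc j) - s j) * (m * (1 + norm x)) \<le> (\<theta> (s (Suc j)) - \<theta> (s j)) * (m * (1 + norm x))"
    using theta_expanding[OF st] m_nonneg by (intro mult_right_mono) auto
  finally show ?thesis .
qed

lemma scheme_step_le:
  "norm (w (Suc j) - w j) \<le> (\<theta> (s (Suc j)) - \<theta> (s j)) * (C2 * (1 + norm (w j)))"
proof -
  let ?n = "\<theta> (s (Suc j)) - \<theta> (s j)"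
  have n: "0 \<le> ?n" using mesh_theta_le[OF s, of j "Suc j"] by simp
  have "norm (w (Suc j) - w j) \<le> norm (drift (s j) (s (Suc j)) (w j)) + norm (?n *\<^sub>R z (Suc j))"
    unfolding schemeD(3) using norm_triangle_ineq4[of "- drift (s j) (s (Suc j)) (w j)" "?n *\<^sub>R z (Suc j)"]
    by simp
  also have "\<dots> \<le> ?n * (m * (1 + norm (w j))) + ?n * (C1 * (1 + norm (w j)))"
    using scheme_drift_le n schemeD(4) by (intro add_mono) (auto intro: mult_left_mono)
  also have "\<dots> = ?n * (C2 * (1 + norm (w j)))" by (simp add: C2_def algebra_simps)
  finally show ?thesis .
qed

text \<open>Discrete Gronwall: a step of \<open>\<theta>\<close>-length \<open>h\<close> multiplies
  \<open>1 + norm (w j)\<close> by at most \<open>1 + C2 * h\<close>, hence by at most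
  \<open>exp (C2 * h)\<close>, and the lengths add up to at most \<open>\<theta> T\<close>.\<close>

lemma scheme_bound: "1 + norm (w j) \<le> B"
proof -
  have "1 + norm (w j) \<le> (1 + norm u0) * exp (C2 * \<theta> (s j))"
  proof (induction j)
    case 0
    then show ?case using schemeD(1) meshD(1)[OF s] theta_0 by simp
  next
    case (Suc j)
    let ?n = "\<theta> (s (Suc j)) - \<theta> (s j)"
    have "norm (w (Suc j)) \<le> norm (w j) + norm (w (Suc j) - w j)" by (rule norm_triangle_sub)
    then have "1 + norm (w (Suc j)) \<le> (1 + norm (w j)) * (1 + C2 * ?n)"
      using scheme_step_le[of j] by (simp add: algebra_simps)
    also have "\<dots> \<le> (1 + norm (w j)) * exp (C2 * ?n)"
      by (intro mult_left_mono exp_ge_add_one_self) auto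
    also have "\<dots> \<le> (1 + norm u0) * exp (C2 * \<theta> (s j)) * exp (C2 * ?n)"
      by (intro mult_right_mono Suc) auto
    also have "\<dots> = (1 + norm u0) * exp (C2 * \<theta> (s (Suc j)))"
      by (simp add: mult_exp_exp algebra_simps)
    finally show ?case .
  qed
  also have "\<dots> \<le> B"
    unfolding B_def using constants theta_mono[of "s j" T] meshD[OF s]
    by (intro mult_left_mono) (auto intro!: mult_left_mono)
  finally show ?thesis .
qed

lemma scheme_z_bound: "norm (z (Suc j)) \<le> M"
proof -
  have "norm (z (Suc j)) \<le> C1 * B"
    using schemeD(4)[of j] scheme_bound[of j] constants by (meson mult_left_mono order_trans)
  also have "\<dots> \<le> C2 * B" using constants m_nonneg by (intro mult_right_mono) (auto simp: C2_def)
  finally show ?thesis by (simp add: M_def)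
qed

lemma scheme_lipschitz:
  assumes "i \<le> j"
  shows "norm (w j - w i) \<le> M * (\<theta> (s j) - \<theta> (s i))"
  using assms
proof (induction j rule: dec_induct)
  case (step j)
  have n: "0 \<le> \<theta> (s (Suc j)) - \<theta> (s j)" using mesh_theta_le[OF s, of j "Suc j"] by simp
  have "norm (w (Suc j) - w j) \<le> (\<theta> (s (Suc j)) - \<theta> (s j)) * M"
    using scheme_step_le[of j] n scheme_bound[of j] constants unfolding M_def
    by (meson mult_left_mono order_trans)
  moreover have "norm (w (Suc j) - w i) \<le> norm (w (Suc j) - w j) + norm (w j - w i)"
    using norm_triangle_ineq[of "w (Suc j) - w j" "w j - w i"] by simp
  ultimately show ?case using step.IH by (simp add: algebra_simps)
qed simp

end

subsection \<open>Comparison of a scheme with one step of a coarser scheme\<close>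

text \<open>With selections bounded by \<open>M\<close>, the pseudo-distance contributes
  \<open>1 + 2 * M\<close>, and the rest of the comparison curve contributes a displacement factor
  \<open>M\<close> times \<open>2 * M\<close> for the difference of the selections. The outer 2
  comes from expanding a square.\<close>

definition K2 :: real where "K2 = 2 * (1 + 2 * M + 2 * M\<^sup>2)"

lemma K2_nonneg: "0 \<le> K2" using constants by (simp add: K2_def)

lemma square_growth_le_exp:
  fixes e b d :: real
  assumes "0 \<le> e" "0 \<le> b" "0 \<le> d"
  shows "(e + b * (e + d))\<^sup>2 \<le> exp (3 * b) * (e\<^sup>2 + 2 * b * d\<^sup>2)"
proof -
  have "(1 + b) * (e\<^sup>2 + b * (e + d)\<^sup>2) - (e + b * (e + d))\<^sup>2 = b * d\<^sup>2"
    by (simp add: power2_eq_square algebra_simps)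
  then have "(e + b * (e + d))\<^sup>2 \<le> (1 + b) * (e\<^sup>2 + b * (e + d)\<^sup>2)"
    using assms(2) by (smt (verit) mult_nonneg_nonneg zero_le_power2)
  also have "(e + d)\<^sup>2 \<le> 2 * e\<^sup>2 + 2 * d\<^sup>2"
    using zero_le_power2[of "e - d"] by (simp add: power2_eq_square algebra_simps)
  then have "(1 + b) * (e\<^sup>2 + b * (e + d)\<^sup>2) \<le> (1 + b) * (e\<^sup>2 + b * (2 * e\<^sup>2 + 2 * d\<^sup>2))"
    using assms by (intro mult_left_mono add_left_mono) auto
  also have "\<dots> \<le> (1 + b) * ((1 + 2 * b) * (e\<^sup>2 + 2 * b * d\<^sup>2))"
    using assms by (intro mult_left_mono) (auto simp: algebra_simps)
  also have "\<dots> \<le> exp b * (exp (2 * b) * (e\<^sup>2 + 2 * b * d\<^sup>2))"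
    using assms exp_ge_add_one_self[of b] exp_ge_add_one_self[of "2 * b"]
    by (intro mult_mono) auto
  also have "\<dots> = exp (3 * b) * (e\<^sup>2 + 2 * b * d\<^sup>2)"
    by (simp add: mult_exp_exp flip: mult.assoc)
  finally show ?thesis .
qed

text \<open>The Euler step from \<open>uc\<close> to \<open>uc'\<close> is joined by the curve \<open>x\<close> that is affine in \<open>\<theta>\<close> up to
  the drift. In the sum over the fine steps, the product of the increment of \<open>\<theta>\<close> and the distance to
  the right end point telescopes after truncation of \<open>\<theta>\<close> at \<open>\<epsilon>\<close>, because the last fine
  step, which may carry a large jump, does not contribute.\<close>
lemma block_comparison:
  assumes s: "mesh s" and sch: "scheme s w z" and ij: "i \<le> n"
    and gap: "\<And>j. i \<le> j \<Longrightarrow> j \<le> n \<Longrightarrow> \<theta> (s j) - \<theta> (s i) \<le> \<epsilon> \<or> s j = s n" and e: "0 \<le> \<epsilon>"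
    and zc: "zc \<in> A (s n) uc'" "norm zc \<le> C1 * B" and uc: "1 + norm uc \<le> B"
    and uc': "uc' = uc - drift (s i) (s n) uc - (\<theta> (s n) - \<theta> (s i)) *\<^sub>R zc"
  shows "(norm (w n - uc'))\<^sup>2 \<le> exp (3 * aint (s i) (s n)) *
    ((norm (w i - uc))\<^sup>2 + 2 * aint (s i) (s n) * (M * \<epsilon>)\<^sup>2 + K2 * (\<theta> (s n) - \<theta> (s i)) * \<epsilon>)"
proof -
  define x where "x j = uc - drift (s i) (s j) uc - (\<theta> (s j) - \<theta> (s i)) *\<^sub>R zc" for j
  define g where "g j = min (\<theta> (s j) - \<theta> (s i)) \<epsilon>" for j
  define \<nu> where "\<nu> = \<theta> (s n) - \<theta> (s i)"
  have sn: "0 \<le> s j" "s j \<le> T" for j using meshD[OF s] by auto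
  have smono: "s j \<le> s k" if "j \<le> k" for j k using meshD(4)[OF s that] .
  have tmono: "\<theta> (s j) \<le> \<theta> (s k)" if "j \<le> k" for j k using mesh_theta_le[OF s that] .
  have nu0: "0 \<le> \<nu>" using tmono[OF ij] by (simp add: \<nu>_def)
  have xdiff: "norm (x k - x j) \<le> M * (\<theta> (s k) - \<theta> (s j))" if "i \<le> j" "j \<le> k" for j k
  proof -
    have eq: "x k - x j = - drift (s j) (s k) uc - (\<theta> (s k) - \<theta> (s j)) *\<^sub>R zc"
      using drift_add[of "s i" "s j" "s k" uc] sn smono that by (simp add: x_def algebra_simps)
    have t0: "0 \<le> \<theta> (s k) - \<theta> (s j)" using tmono[OF that(2)] by simp
    have "norm (x k - x j) \<le> norm (drift (s j) (s k) uc) + norm ((\<theta> (s k) - \<theta> (s j)) *\<^sub>R zc)"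
      unfolding eq using norm_triangle_ineq4[of "- drift (s j) (s k) uc" "(\<theta> (s k) - \<theta> (s j)) *\<^sub>R zc"] by simp
    also have "norm (drift (s j) (s k) uc) \<le> (s k - s j) * (m * (1 + norm uc))"
      using sn smono that by (intro norm_drift_le) auto
    also have "\<dots> \<le> (\<theta> (s k) - \<theta> (s j)) * (m * B)"
      using theta_expanding[of "s j" "s k"] sn smono[OF that(2)] uc m_nonneg t0
      by (intro mult_mono mult_left_mono) auto
    also have "norm ((\<theta> (s k) - \<theta> (s j)) *\<^sub>R zc) \<le> (\<theta> (s k) - \<theta> (s j)) * (C1 * B)"
      using zc(2) t0 by (simp add: mult_left_mono)
    finally show ?thesis using constants(5) by (simp add: algebra_simps flip: constants(5))
  qed
  have zcM: "norm zc \<le> M" using zc(2) constants m_nonneg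
    by (smt (verit) mult_nonneg_nonneg)
  have xi: "x i = uc" by (simp add: x_def)
  have xn: "x n = uc'" by (simp add: x_def uc')
  have gmono: "g j \<le> g k" if "j \<le> k" for j k using tmono[OF that] by (auto simp: g_def)
  have step: "(norm (w (Suc j) - x (Suc j)))\<^sup>2 \<le> exp (3 * aint (s j) (s (Suc j))) *
      ((norm (w j - x j))\<^sup>2 + 2 * aint (s j) (s (Suc j)) * (M * \<epsilon>)\<^sup>2) + K2 * \<nu> * (g (Suc j) - g j)"
    if j: "i \<le> j" "j < n" for j
  proof -
    let ?b = "aint (s j) (s (Suc j))" and ?h = "\<theta> (s (Suc j)) - \<theta> (s j)"
    let ?\<eta> = "\<theta> (s n) - \<theta> (s (Suc j))"
    have h0: "0 \<le> ?h" using tmono[of j "Suc j"] by simp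
    have eta0: "0 \<le> ?\<eta>" using tmono[of "Suc j" n] j by simp
    define p where "p = (w j - x j) - (drift (s j) (s (Suc j)) (w j) - drift (s j) (s (Suc j)) uc)"
    let ?d = "w (Suc j) - x (Suc j)" and ?y = "z (Suc j) - zc"
    have deq: "?d = p - ?h *\<^sub>R ?y"
      using drift_add[of "s i" "s j" "s (Suc j)" uc] sn smono j
      by (simp add: schemeD(3)[OF s sch] x_def p_def algebra_simps)
    have zM: "norm (z (Suc j)) \<le> M" by (rule scheme_z_bound[OF s sch])
    have ynorm: "norm ?y \<le> 2 * M" using norm_triangle_ineq4[of "z (Suc j)" zc] zM zcM by simp
    have mon: "- (?d \<bullet> ?y) \<le> (1 + 2 * M + 2 * M\<^sup>2) * ?\<eta>"
    proof -
      have "vladimirov_dis (A (s n)) (A (s (Suc j))) \<le> ereal (\<rho> (s n) - \<rho> (s (Suc j)))"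
        using sn smono j by (intro A_dis) auto
      from vladimirov_disD[OF this zc(1) schemeD(2)[OF s sch]]
      have "(zc - z (Suc j)) \<bullet> (w (Suc j) - uc') \<le> (\<rho> (s n) - \<rho> (s (Suc j))) * (1 + norm zc + norm (z (Suc j)))" .
      also have "\<dots> \<le> ?\<eta> * (1 + M + M)"
        using zcM zM smono[of "Suc j" n] j rho_le[of "s (Suc j)" "s n"] sn
        by (intro mult_mono) (auto simp: \<theta>_def)
      finally have 1: "- ((w (Suc j) - uc') \<bullet> ?y) \<le> ?\<eta> * (1 + 2 * M)"
        by (simp add: inner_diff inner_commute algebra_simps)
      have "- ((x n - x (Suc j)) \<bullet> ?y) \<le> norm (x n - x (Suc j)) * norm ?y"
        using Cauchy_Schwarz_ineq2[of "x n - x (Suc j)" ?y] by linarith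
      also have "\<dots> \<le> (M * ?\<eta>) * (2 * M)"
        using xdiff[of "Suc j" n] j ynorm constants(4) eta0 by (intro mult_mono) auto
      finally have 2: "- ((x n - x (Suc j)) \<bullet> ?y) \<le> ?\<eta> * (2 * M\<^sup>2)" by (simp add: power2_eq_square algebra_simps)
      have "?d = (w (Suc j) - uc') + (x n - x (Suc j))" by (simp add: xn)
      then have "?d \<bullet> ?y = (w (Suc j) - uc') \<bullet> ?y + (x n - x (Suc j)) \<bullet> ?y"
        by (simp only: inner_add_left)
      then have "- (?d \<bullet> ?y) \<le> ?\<eta> * (1 + 2 * M) + ?\<eta> * (2 * M\<^sup>2)" using 1 2 by linarith
      then show ?thesis by (simp add: algebra_simps)
    qed
    \<comment> \<open>\<open>p\<close> is the error after the explicit part of the step. Expanding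
      \<open>p = ?d + ?h *\<^sub>R ?y\<close> and dropping the last square leaves only the defect of
      monotonicity.\<close>
    have "(norm ?d)\<^sup>2 \<le> (norm p)\<^sup>2 + 2 * ?h * (- (?d \<bullet> ?y))"
    proof -
      have peq: "p = ?d + ?h *\<^sub>R ?y" using deq by simp
      have "(norm p)\<^sup>2 = (norm ?d)\<^sup>2 + 2 * ?h * (?d \<bullet> ?y) + (norm (?h *\<^sub>R ?y))\<^sup>2"
        unfolding peq power2_norm_eq_inner by (simp add: inner_add inner_commute algebra_simps)
      then show ?thesis using zero_le_power2[of "norm (?h *\<^sub>R ?y)"] by simp
    qed
    also have "2 * ?h * (- (?d \<bullet> ?y)) \<le> 2 * ?h * ((1 + 2 * M + 2 * M\<^sup>2) * ?\<eta>)"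
      using mon h0 by (intro mult_left_mono) auto
    also have "2 * ?h * ((1 + 2 * M + 2 * M\<^sup>2) * ?\<eta>) = K2 * (?h * ?\<eta>)" unfolding K2_def by algebra
    \<comment> \<open>A step that ends at \<open>s n\<close> has \<open>?\<eta> = 0\<close>,
      whatever its length. Otherwise the truncation in \<open>g\<close> is inactive at its end, so
      \<open>?h\<close> is at most the increment of \<open>g\<close>.\<close>
    also have "K2 * (?h * ?\<eta>) \<le> K2 * (\<nu> * (g (Suc j) - g j))"
    proof (intro mult_left_mono K2_nonneg)
      show "?h * ?\<eta> \<le> \<nu> * (g (Suc j) - g j)"
      proof (cases "s (Suc j) = s n")
        case True
        then show ?thesis using nu0 gmono[of j "Suc j"] by simp
      next
        case False
        then have "g (Suc j) = \<theta> (s (Suc j)) - \<theta> (s i)"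
          using gap[of "Suc j"] j by (simp add: g_def)
        moreover have "g j \<le> \<theta> (s j) - \<theta> (s i)" by (simp add: g_def)
        ultimately have "?h \<le> g (Suc j) - g j" by simp
        moreover have "?\<eta> \<le> \<nu>" using tmono[of i "Suc j"] j by (simp add: \<nu>_def)
        ultimately have "?h * ?\<eta> \<le> (g (Suc j) - g j) * \<nu>"
          using h0 eta0 by (intro mult_mono) auto
        then show ?thesis by (simp add: mult.commute)
      qed
    qed
    also have "(norm p)\<^sup>2 \<le> exp (3 * ?b) * ((norm (w j - x j))\<^sup>2 + 2 * ?b * (M * \<epsilon>)\<^sup>2)"
    proof (cases "s j = s n")
      case True
      then have "s (Suc j) = s j" using smono[of j "Suc j"] smono[of "Suc j" n] j by simp
      then show ?thesis by (simp add: p_def)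
    next
      case False
      have st: "0 \<le> s j" "s j \<le> s (Suc j)" "s (Suc j) \<le> T" using sn smono by auto
      have "norm p \<le> norm (w j - x j) + norm (drift (s j) (s (Suc j)) (w j) - drift (s j) (s (Suc j)) uc)"
        unfolding p_def by (rule norm_triangle_ineq4)
      also have "\<dots> \<le> norm (w j - x j) + ?b * norm (w j - uc)"
        using drift_lipschitz[OF st] by simp
      also have "\<dots> \<le> norm (w j - x j) + ?b * (norm (w j - x j) + M * \<epsilon>)"
      proof (intro add_left_mono mult_left_mono aint_nonneg)
        have "norm (x j - uc) \<le> M * (\<theta> (s j) - \<theta> (s i))" using xdiff[of i j] j xi by simp
        also have "\<dots> \<le> M * \<epsilon>" using gap[of j] j False constants by (intro mult_left_mono) auto
        finally show "norm (w j - uc) \<le> norm (w j - x j) + M * \<epsilon>"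
          using norm_triangle_ineq[of "w j - x j" "x j - uc"] by simp
      qed
      finally have "(norm p)\<^sup>2 \<le> (norm (w j - x j) + ?b * (norm (w j - x j) + M * \<epsilon>))\<^sup>2"
        by (intro power_mono) auto
      also have "\<dots> \<le> exp (3 * ?b) * ((norm (w j - x j))\<^sup>2 + 2 * ?b * (M * \<epsilon>)\<^sup>2)"
        using e constants by (intro square_growth_le_exp aint_nonneg) auto
      finally show ?thesis .
    qed
    finally show ?thesis by (simp add: mult.assoc)
  qed
  have "(norm (w j - x j))\<^sup>2 \<le> exp (3 * aint (s i) (s j)) *
    ((norm (w i - uc))\<^sup>2 + 2 * aint (s i) (s j) * (M * \<epsilon>)\<^sup>2 + K2 * \<nu> * g j)"
    if "i \<le> j" "j \<le> n" for j
    using that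
  proof (induction j rule: dec_induct)
    case base
    then show ?case using e by (simp add: xi g_def)
  next
    case (step j)
    let ?a = "aint (s i) (s j)" and ?b = "aint (s j) (s (Suc j))"
    let ?X = "(norm (w i - uc))\<^sup>2 + 2 * ?a * (M * \<epsilon>)\<^sup>2 + K2 * \<nu> * g j"
    have ab: "0 \<le> ?a" "0 \<le> ?b" by (simp_all add: aint_nonneg)
    have ad: "aint (s i) (s (Suc j)) = ?a + ?b"
      using sn smono step.hyps by (intro aint_add) auto
    have 1: "2 * ?b * (M * \<epsilon>)\<^sup>2 \<le> exp (3 * ?a) * (2 * ?b * (M * \<epsilon>)\<^sup>2)"
      using mult_right_mono[of 1 "exp (3 * ?a)" "2 * ?b * (M * \<epsilon>)\<^sup>2"] ab by simp
    have G: "0 \<le> K2 * \<nu> * (g (Suc j) - g j)"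
      using gmono[of j "Suc j"] nu0 K2_nonneg by (intro mult_nonneg_nonneg) auto
    then have 2: "K2 * \<nu> * (g (Suc j) - g j) \<le> exp (3 * (?a + ?b)) * (K2 * \<nu> * (g (Suc j) - g j))"
      using mult_right_mono[of 1 "exp (3 * (?a + ?b))" "K2 * \<nu> * (g (Suc j) - g j)"] ab by simp
    have "(norm (w (Suc j) - x (Suc j)))\<^sup>2 \<le> exp (3 * ?b) *
      ((norm (w j - x j))\<^sup>2 + 2 * ?b * (M * \<epsilon>)\<^sup>2) + K2 * \<nu> * (g (Suc j) - g j)"
      using step.hyps step.prems by (intro \<open>\<And>j. i \<le> j \<Longrightarrow> j < n \<Longrightarrow> _\<close>) auto
    also have "\<dots> \<le> exp (3 * ?b) * (exp (3 * ?a) * ?X + exp (3 * ?a) * (2 * ?b * (M * \<epsilon>)\<^sup>2))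
       + exp (3 * (?a + ?b)) * (K2 * \<nu> * (g (Suc j) - g j))"
      using step.IH step.prems 1 2 by (intro add_mono mult_left_mono) auto
    also have "\<dots> = exp (3 * (?a + ?b)) * (?X + 2 * ?b * (M * \<epsilon>)\<^sup>2 + K2 * \<nu> * (g (Suc j) - g j))"
      by (simp add: exp_add algebra_simps)
    finally show ?case unfolding ad by (simp add: algebra_simps)
  qed
  from this[OF ij order_refl]
  have "(norm (w n - uc'))\<^sup>2 \<le> exp (3 * aint (s i) (s n)) *
    ((norm (w i - uc))\<^sup>2 + 2 * aint (s i) (s n) * (M * \<epsilon>)\<^sup>2 + K2 * \<nu> * g n)"
    by (simp add: xn)
  also have "\<dots> \<le> exp (3 * aint (s i) (s n)) *
    ((norm (w i - uc))\<^sup>2 + 2 * aint (s i) (s n) * (M * \<epsilon>)\<^sup>2 + K2 * \<nu> * \<epsilon>)"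
    using K2_nonneg nu0 by (intro mult_left_mono add_left_mono) (auto simp: g_def)
  finally show ?thesis by (simp add: \<nu>_def)
qed

section \<open>The limit of the schemes\<close>

definition mesh_seq :: "nat \<Rightarrow> nat \<Rightarrow> real" where
  "mesh_seq n j = grid n (min j (2 ^ n))"

lemma mesh_mesh_seq: "mesh (mesh_seq n)"
  unfolding mesh_def mesh_seq_def by (auto intro!: monoI grid_mono grid_bounds(2))

lemma mesh_seq_grid: "j \<le> 2 ^ n \<Longrightarrow> mesh_seq n j = grid n j"
  by (simp add: mesh_seq_def min_absorb1)

lemma mesh_seq_refine: "k \<le> 2 ^ n \<Longrightarrow> mesh_seq (n + p) (k * 2 ^ p) = grid n k"
  by (subst mesh_seq_grid) (simp_all add: power_add grid_refine)

definition euler :: "nat \<Rightarrow> (nat \<Rightarrow> 'a) \<times> (nat \<Rightarrow> 'a)" where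
  "euler n = (SOME p. scheme (mesh_seq n) (fst p) (snd p))"

definition W :: "nat \<Rightarrow> nat \<Rightarrow> 'a" where "W n = fst (euler n)"
definition Z :: "nat \<Rightarrow> nat \<Rightarrow> 'a" where "Z n = snd (euler n)"

lemma scheme_WZ: "scheme (mesh_seq n) (W n) (Z n)"
proof -
  obtain w z where "scheme (mesh_seq n) w z" using scheme_exists[OF mesh_mesh_seq] by blast
  then have "scheme (mesh_seq n) (fst (w, z)) (snd (w, z))" by simp
  then show ?thesis unfolding W_def Z_def euler_def by (rule someI)
qed

lemmas W_bound = scheme_bound[OF mesh_mesh_seq scheme_WZ]
  and Z_bound = scheme_z_bound[OF mesh_mesh_seq scheme_WZ]
  and W_lipschitz = scheme_lipschitz[OF mesh_mesh_seq scheme_WZ]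
  and WZ = schemeD[OF mesh_mesh_seq scheme_WZ]

text \<open>The bound of \<open>block_comparison\<close> accumulated over \<open>[0,T]\<close> from
  initial error 0; the square root undoes the squared norm.\<close>

definition delta :: "nat \<Rightarrow> real" where
  "delta n = sqrt (exp (3 * aint 0 T) * (2 * aint 0 T * (M * eps n)\<^sup>2 + K2 * \<theta> T * eps n))"

text \<open>The second summand pays for the motion of a finer scheme after the last coarse grid
  point up to time \<open>t\<close>.\<close>

definition err :: "nat \<Rightarrow> real" where "err n = delta n + M * eps n"

lemma delta_tendsto_0: "delta \<longlonglongrightarrow> 0"
proof -
  have "(\<lambda>n. sqrt (exp (3 * aint 0 T) * (2 * aint 0 T * (M * eps n)\<^sup>2 + K2 * \<theta> T * eps n)))
      \<longlonglongrightarrow> sqrt (exp (3 * aint 0 T) * (2 * aint 0 T * (M * 0)\<^sup>2 + K2 * \<theta> T * 0))"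
    by (intro tendsto_intros eps_tendsto_0)
  then show ?thesis by (simp add: delta_def[abs_def])
qed

lemma err_tendsto_0: "err \<longlonglongrightarrow> 0"
proof -
  have "(\<lambda>n. delta n + M * eps n) \<longlonglongrightarrow> 0 + M * 0"
    by (intro tendsto_intros delta_tendsto_0 eps_tendsto_0)
  then show ?thesis by (simp add: err_def[abs_def])
qed

lemma err_nonneg: "0 \<le> err n"
  using constants eps_pos[of n] aint_nonneg[of 0 T] K2_nonneg theta_T_pos
  by (simp add: err_def delta_def)

text \<open>One application of \<open>block_comparison\<close> per coarse interval.
  \<open>aint\<close> and the increments of \<open>\<theta>\<close> are additive, so the squared
  errors add up under a common exponential factor.\<close>

lemma W_compare:
  assumes "k \<le> 2 ^ n"
  shows "norm (W (n + p) (k * 2 ^ p) - W n k) \<le> delta n"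
proof -
  have "(norm (W (n + p) (k * 2 ^ p) - W n k))\<^sup>2 \<le> exp (3 * aint 0 (grid n k)) *
    (2 * aint 0 (grid n k) * (M * eps n)\<^sup>2 + K2 * \<theta> (grid n k) * eps n)"
    using assms
  proof (induction k)
    case 0
    then show ?case by (simp add: WZ(1) theta_0)
  next
    case (Suc k)
    let ?i = "k * 2 ^ p" and ?j = "Suc k * 2 ^ p" and ?s = "mesh_seq (n + p)"
    have si: "?s ?i = grid n k" and sj: "?s ?j = grid n (Suc k)"
      using mesh_seq_refine[of k n p] mesh_seq_refine[of "Suc k" n p] Suc.prems by auto
    have g: "0 \<le> grid n k" "grid n k \<le> grid n (Suc k)" "grid n (Suc k) \<le> T"
      using Suc.prems grid_bounds grid_mono by auto
    let ?a = "aint 0 (grid n k)" and ?b = "aint (grid n k) (grid n (Suc k))"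
    let ?\<nu> = "\<theta> (grid n (Suc k)) - \<theta> (grid n k)"
    let ?e = "(norm (W (n + p) ?i - W n k))\<^sup>2"
    have ab: "aint 0 (grid n (Suc k)) = ?a + ?b" using g by (intro aint_add) auto
    have nn: "0 \<le> ?a" "0 \<le> ?b" by (simp_all add: aint_nonneg)
    have nu: "0 \<le> ?\<nu>" using theta_mono[OF g] by simp
    have "(norm (W (n + p) ?j - W n (Suc k)))\<^sup>2 \<le> exp (3 * aint (?s ?i) (?s ?j)) *
      (?e + 2 * aint (?s ?i) (?s ?j) * (M * eps n)\<^sup>2 + K2 * (\<theta> (?s ?j) - \<theta> (?s ?i)) * eps n)"
    proof (rule block_comparison[OF mesh_mesh_seq scheme_WZ, where zc="Z n (Suc k)"])
      fix j assume j: "?i \<le> j" "j \<le> ?j"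
      have "grid n k \<le> ?s j" "?s j \<le> grid n (Suc k)"
        using meshD(4)[OF mesh_mesh_seq j(1), of "n + p"] meshD(4)[OF mesh_mesh_seq j(2), of "n + p"] si sj by auto
      then show "\<theta> (?s j) - \<theta> (?s ?i) \<le> eps n \<or> ?s j = ?s ?j"
        using theta_grid_gap[of k n "?s j"] Suc.prems si sj by fastforce
    next
      have ms: "mesh_seq n k = grid n k" "mesh_seq n (Suc k) = grid n (Suc k)"
        using mesh_seq_grid Suc.prems by auto
      show "Z n (Suc k) \<in> A (?s ?j) (W n (Suc k))"
        using WZ(2)[of n k] by (simp only: sj ms)
      show "W n (Suc k) = W n k - drift (?s ?i) (?s ?j) (W n k) - (\<theta> (?s ?j) - \<theta> (?s ?i)) *\<^sub>R Z n (Suc k)"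
        using WZ(3)[of n k] by (simp only: si sj ms)
      show "norm (Z n (Suc k)) \<le> C1 * B"
        using WZ(4)[of n k] W_bound[of n k] constants by (meson mult_left_mono order_trans)
    qed (use eps_pos[of n] W_bound in auto)
    also have "\<dots> \<le> exp (3 * ?b) * (exp (3 * ?a) * (2 * ?a * (M * eps n)\<^sup>2 + K2 * \<theta> (grid n k) * eps n)
        + exp (3 * ?a) * (2 * ?b * (M * eps n)\<^sup>2) + exp (3 * ?a) * (K2 * ?\<nu> * eps n))"
      unfolding si sj
    proof (intro mult_left_mono add_mono)
      show "?e \<le> exp (3 * ?a) * (2 * ?a * (M * eps n)\<^sup>2 + K2 * \<theta> (grid n k) * eps n)"
        using Suc by simp
      have e1: "1 \<le> exp (3 * ?a)" using nn by simp
      have "0 \<le> 2 * ?b * (M * eps n)\<^sup>2" using nn by simp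
      from mult_right_mono[OF e1 this]
      show "2 * ?b * (M * eps n)\<^sup>2 \<le> exp (3 * ?a) * (2 * ?b * (M * eps n)\<^sup>2)" by simp
      have "0 \<le> K2 * ?\<nu> * eps n" using K2_nonneg nu eps_pos[of n] by simp
      from mult_right_mono[OF e1 this]
      show "K2 * ?\<nu> * eps n \<le> exp (3 * ?a) * (K2 * ?\<nu> * eps n)" by simp
    qed simp
    also have "\<dots> = exp (3 * (?a + ?b)) * (2 * (?a + ?b) * (M * eps n)\<^sup>2 + K2 * \<theta> (grid n (Suc k)) * eps n)"
      by (simp add: exp_add algebra_simps)
    finally show ?case by (simp only: ab)
  qed
  also have "\<dots> \<le> exp (3 * aint 0 T) * (2 * aint 0 T * (M * eps n)\<^sup>2 + K2 * \<theta> T * eps n)"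
  proof -
    have "aint 0 T = aint 0 (grid n k) + aint (grid n k) T"
      using grid_bounds[OF assms] by (intro aint_add) auto
    then have 1: "aint 0 (grid n k) \<le> aint 0 T" using aint_nonneg[of "grid n k" T] by simp
    have 2: "\<theta> (grid n k) \<le> \<theta> T" using grid_bounds[OF assms] by (intro theta_mono) auto
    show ?thesis
      using 1 2 aint_nonneg K2_nonneg eps_pos[of n] theta_nonneg grid_bounds[OF assms]
      by (intro mult_mono add_mono) (auto intro!: mult_nonneg_nonneg add_nonneg_nonneg)
  qed
  finally show ?thesis unfolding delta_def by (rule real_le_rsqrt)
qed

lemma W_pre_index_diff:
  assumes t: "0 \<le> t" "t \<le> T"
  shows "norm (W (n + p) (pre_index (n + p) t) - W n (pre_index n t)) \<le> err n"
proof -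
  let ?k = "pre_index n t" and ?l = "pre_index (n + p) t"
  note k = pre_index_props[OF t, where n=n] and l = pre_index_props[OF t, where n="n + p"]
  have "?k * 2 ^ p \<le> 2 ^ (n + p)" using k(1) by (simp add: power_add)
  moreover have "grid (n + p) (?k * 2 ^ p) \<le> t" using k(2) by (simp only: grid_refine)
  ultimately have kl: "?k * 2 ^ p \<le> ?l" by (rule l(4))
  have "norm (W (n + p) ?l - W (n + p) (?k * 2 ^ p)) \<le> M * (\<theta> (grid (n + p) ?l) - \<theta> (grid n ?k))"
    using W_lipschitz[OF kl, of "n + p"] by (simp only: mesh_seq_refine[OF k(1), of p] mesh_seq_grid[OF l(1)])
  also have "\<theta> (grid (n + p) ?l) \<le> \<theta> t"
    using l t grid_bounds[OF l(1)] by (intro theta_mono) auto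
  then have "M * (\<theta> (grid (n + p) ?l) - \<theta> (grid n ?k)) \<le> M * eps n"
    using k(3) constants by (intro mult_left_mono) auto
  finally have "norm (W (n + p) ?l - W (n + p) (?k * 2 ^ p)) \<le> M * eps n" .
  then have "norm ((W (n + p) ?l - W (n + p) (?k * 2 ^ p)) + (W (n + p) (?k * 2 ^ p) - W n ?k)) \<le> M * eps n + delta n"
    by (rule order_trans[OF norm_triangle_ineq add_mono[OF _ W_compare[OF k(1)]]])
  then show ?thesis by (simp add: err_def add.commute)
qed

definition u :: "real \<Rightarrow> 'a" where
  "u t = lim (\<lambda>n. W n (pre_index n t))"

lemma W_tendsto_u:
  assumes t: "0 \<le> t" "t \<le> T"
  shows "(\<lambda>n. W n (pre_index n t)) \<longlonglongrightarrow> u t"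
proof -
  have "Cauchy (\<lambda>n. W n (pre_index n t))"
  proof (rule Cauchy_if_norm_diff_squared_le)
    fix m n :: nat assume "m \<le> n"
    then obtain p where "n = m + p" using le_Suc_ex by blast
    then have "norm (W m (pre_index m t) - W n (pre_index n t)) \<le> err m"
      using W_pre_index_diff[OF t, of m p] by (simp add: norm_minus_commute)
    then show "(norm (W m (pre_index m t) - W n (pre_index n t)))\<^sup>2 \<le> (err m)\<^sup>2"
      by (intro power_mono) auto
  next
    show "(\<lambda>m. (err m)\<^sup>2) \<longlonglongrightarrow> 0" using tendsto_power[OF err_tendsto_0, of 2] by simp
  qed
  then show ?thesis unfolding u_def by (metis Cauchy_convergent convergent_LIMSEQ_iff)
qed

lemma W_u_le:
  assumes t: "0 \<le> t" "t \<le> T"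
  shows "norm (W n (pre_index n t) - u t) \<le> err n"
proof (rule LIMSEQ_le_const2)
  show "(\<lambda>l. norm (W n (pre_index n t) - W l (pre_index l t))) \<longlonglongrightarrow> norm (W n (pre_index n t) - u t)"
    by (intro tendsto_intros W_tendsto_u t)
  have "norm (W n (pre_index n t) - W l (pre_index l t)) \<le> err n" if l: "n \<le> l" for l
  proof -
    obtain p where "l = n + p" using l le_Suc_ex by blast
    then show ?thesis using W_pre_index_diff[OF t, of n p] by (simp add: norm_minus_commute)
  qed
  then show "\<exists>N. \<forall>l\<ge>N. norm (W n (pre_index n t) - W l (pre_index l t)) \<le> err n" by blast
qed

lemma u_lipschitz:
  assumes "0 \<le> s" "s \<le> t" "t \<le> T"
  shows "norm (u t - u s) \<le> M * (\<theta> t - \<theta> s)"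
proof (rule LIMSEQ_le)
  show "(\<lambda>n. norm (W n (pre_index n t) - W n (pre_index n s))) \<longlonglongrightarrow> norm (u t - u s)"
    using assms by (intro tendsto_intros W_tendsto_u) auto
  have "(\<lambda>n. M * (\<theta> t - \<theta> s + eps n)) \<longlonglongrightarrow> M * (\<theta> t - \<theta> s + 0)"
    by (intro tendsto_intros eps_tendsto_0)
  then show "(\<lambda>n. M * (\<theta> t - \<theta> s + eps n)) \<longlonglongrightarrow> M * (\<theta> t - \<theta> s)" by simp
  have "norm (W n (pre_index n t) - W n (pre_index n s)) \<le> M * (\<theta> t - \<theta> s + eps n)" for n
  proof -
    have s: "0 \<le> s" "s \<le> T" and t: "0 \<le> t" "t \<le> T" using assms by auto
    note ps = pre_index_props[OF s, where n=n] and pt = pre_index_props[OF t, where n=n]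
    have le: "pre_index n s \<le> pre_index n t" using ps assms by (intro pt(4)) auto
    have "norm (W n (pre_index n t) - W n (pre_index n s))
      \<le> M * (\<theta> (grid n (pre_index n t)) - \<theta> (grid n (pre_index n s)))"
      using W_lipschitz[OF le, of n] mesh_seq_grid[OF ps(1)] mesh_seq_grid[OF pt(1)] by simp
    also have "\<theta> (grid n (pre_index n t)) \<le> \<theta> t"
      using pt t grid_bounds[OF pt(1)] by (intro theta_mono) auto
    then have "M * (\<theta> (grid n (pre_index n t)) - \<theta> (grid n (pre_index n s))) \<le> M * (\<theta> t - \<theta> s + eps n)"
      using ps(3) constants by (intro mult_left_mono) auto
    finally show ?thesis .
  qed
  then show "\<exists>N. \<forall>n\<ge>N. norm (W n (pre_index n t) - W n (pre_index n s)) \<le> M * (\<theta> t - \<theta> s + eps n)"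
    by blast
qed

lemma u_lipschitz_abs:
  assumes "s \<in> {0..T}" "t \<in> {0..T}"
  shows "norm (u t - u s) \<le> M * \<bar>\<theta> t - \<theta> s\<bar>"
proof (cases "s \<le> t")
  case True
  then show ?thesis using u_lipschitz[of s t] theta_mono[of s t] assms by simp
next
  case False
  then show ?thesis using u_lipschitz[of t s] theta_mono[of t s] assms by (simp add: norm_minus_commute)
qed

text \<open>\<open>pre_index n (grid n k)\<close> may differ from \<open>k\<close>, but both indices
  stand for one time, and the Lipschitz bound in \<open>\<theta>\<close> forces equal values of the
  scheme.\<close>

lemma W_grid_le:
  assumes k: "k \<le> 2 ^ n"
  shows "norm (W n k - u (grid n k)) \<le> err n"
proof -
  note b = grid_bounds[OF k]
  note p = pre_index_props[OF b, where n=n]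
  have le: "k \<le> pre_index n (grid n k)" using k by (intro p(4)) auto
  have "norm (W n (pre_index n (grid n k)) - W n k) \<le> 0"
    using W_lipschitz[OF le, of n] mesh_seq_grid[OF p(1)] mesh_seq_grid[OF k] pre_index_grid[OF k] by simp
  then show ?thesis using W_u_le[OF b, of n] by simp
qed

lemma u_0: "u 0 = u0"
proof -
  have "pre_index n 0 = 0" for n by (simp add: pre_index_def theta_0)
  then have "(\<lambda>n. u0) \<longlonglongrightarrow> u 0" using W_tendsto_u[of 0] T_pos by (simp add: WZ(1))
  then show ?thesis using LIMSEQ_unique tendsto_const by blast
qed

lemma u_bound:
  assumes t: "0 \<le> t" "t \<le> T"
  shows "1 + norm (u t) \<le> B"
proof (rule LIMSEQ_le_const2)
  show "(\<lambda>n. 1 + norm (W n (pre_index n t))) \<longlonglongrightarrow> 1 + norm (u t)"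
    by (intro tendsto_intros W_tendsto_u t)
qed (use W_bound in blast)

text \<open>The selections live at the right end points \<open>s n\<close> of the blocks containing
  \<open>t\<close>. As \<open>\<theta> (s n)\<close> tends to \<open>\<theta> t\<close>, the
  pseudo-distance to \<open>A t\<close> vanishes even if \<open>\<theta>\<close> jumps at
  \<open>t\<close>, and \<open>op_domain_limit\<close> applies.\<close>

lemma u_domain:
  assumes "t \<in> {0..T}"
  shows "u t \<in> op_domain (A t)"
proof (cases "t = 0")
  case True
  then show ?thesis using u_0 u0_domain by simp
next
  case False
  then have t: "0 < t" "t \<le> T" using assms by auto
  define k where "k n = block n t" for n
  define s where "s n = grid n (Suc (k n))" for n
  have k: "Suc (k n) \<le> 2 ^ n" and ts: "t \<le> s n" for n
    using block_props[OF t, of n] by (auto simp: k_def s_def Suc_le_eq)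
  have sT: "0 \<le> s n" "s n \<le> T" for n using grid_bounds[OF k] by (auto simp: s_def)
  have lim: "(\<lambda>n. \<theta> (s n) - \<theta> t) \<longlonglongrightarrow> 0"
    using tendsto_diff[OF theta_block_tendsto[OF t] tendsto_const[of "\<theta> t"]] by (simp add: s_def k_def)
  show ?thesis
  proof (rule op_domain_limit[OF A_maximal[OF assms]])
    show "vladimirov_dis (A (s n)) (A t) \<le> ereal (\<theta> (s n) - \<theta> t)" for n
      by (rule order_trans[OF A_dis]) (use ts[of n] sT[of n] t in \<open>auto simp: \<theta>_def\<close>)
    show "Z n (Suc (k n)) \<in> A (s n) (W n (Suc (k n)))" for n
      using WZ(2)[of n "k n"] mesh_seq_grid[OF k, of n] by (simp only: s_def)
    show "norm (Z n (Suc (k n))) \<le> M" for n by (rule Z_bound)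
    have *: "norm (W n (Suc (k n)) - u t) \<le> err n + M * (\<theta> (s n) - \<theta> t)" for n
    proof -
      have "norm (W n (Suc (k n)) - u (s n)) \<le> err n" unfolding s_def by (rule W_grid_le[OF k])
      moreover have "norm (u (s n) - u t) \<le> M * (\<theta> (s n) - \<theta> t)"
        using ts sT t by (intro u_lipschitz) auto
      ultimately show ?thesis
        using norm_triangle_ineq[of "W n (Suc (k n)) - u (s n)" "u (s n) - u t"] by simp
    qed
    have "(\<lambda>n. err n + M * (\<theta> (s n) - \<theta> t)) \<longlonglongrightarrow> 0 + M * 0"
      by (intro tendsto_intros lim err_tendsto_0)
    then have "(\<lambda>n. err n + M * (\<theta> (s n) - \<theta> t)) \<longlonglongrightarrow> 0" by simp
    with always_eventually[OF allI[OF *]] have "(\<lambda>n. W n (Suc (k n)) - u t) \<longlonglongrightarrow> 0"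
      by (rule Lim_null_comparison)
    then show "(\<lambda>n. W n (Suc (k n))) \<longlonglongrightarrow> u t" by (simp add: LIM_zero_iff)
  qed (rule lim)
qed

lemma pre_index_measurable: "pre_index n \<in> measurable L (count_space UNIV)"
proof -
  have "\<theta> \<in> borel_measurable (restrict_space borel {0..T})"
    by (rule borel_measurable_mono_on_fnc) (auto intro!: mono_onI theta_mono)
  then have [measurable]: "\<theta> \<in> borel_measurable L"
    by (simp add: measurable_cong_sets[OF sets_L refl])
  show ?thesis unfolding pre_index_def[abs_def] by measurable
qed

definition fu :: "real \<Rightarrow> 'a" where "fu t = f t (u t)"

text \<open>The Caratheodory argument: \<open>W n (pre_index n t)\<close> has countably many values,
  so measurability for each fixed \<open>x\<close> suffices for the approximations, and continuity
  of \<open>f t\<close> passes to the limit.\<close>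

lemma fu_measurable: "fu \<in> borel_measurable L"
proof (rule borel_measurable_LIMSEQ_metric)
  show "(\<lambda>t. f t (W n (pre_index n t))) \<in> borel_measurable L" for n
    by (rule measurable_compose_countable[OF f_measurable pre_index_measurable])
  show "(\<lambda>n. f t (W n (pre_index n t))) \<longlonglongrightarrow> fu t" if "t \<in> space L" for t
  proof -
    have t: "t \<in> {0..T}" using that by (simp add: leb.space_N)
    show ?thesis unfolding fu_def
      by (rule continuous_on_tendsto_compose[OF f_continuous[OF t] W_tendsto_u]) (use t in auto)
  qed
qed

lemma fu_bound: "t \<in> {0..T} \<Longrightarrow> norm (fu t) \<le> m * B"
  unfolding fu_def using f_growth[of t "u t"] u_bound[of t] m_nonneg
  by (meson atLeastAtMost_iff mult_left_mono order_trans)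

lemma fu_integrable: "integrable L fu"
  by (rule bounded_integrable_L[OF fu_measurable fu_bound])

section \<open>From Euler inclusions to test inequalities\<close>

definition U :: "real \<Rightarrow> 'a" where
  "U t = u t + set_lebesgue_integral L {0<..t} fu"

lemma U_lipschitz:
  assumes "0 \<le> s" "s \<le> t" "t \<le> T"
  shows "norm (U t - U s) \<le> (M + m * B) * (\<theta> t - \<theta> s)"
proof -
  have eq: "U t - U s = (u t - u s) + set_lebesgue_integral L {s<..t} fu"
    unfolding U_def using set_integral_Ioc_add[OF fu_integrable, of 0 s t] assms by simp
  have "norm (set_lebesgue_integral L {s<..t} fu) \<le> set_lebesgue_integral L {s<..t} (\<lambda>_. m * B)"
  proof (rule norm_set_integral_L_le[OF fu_integrable])
    show "AE r in L. r \<in> {s<..<t} \<longrightarrow> norm (fu r) \<le> m * B"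
      using fu_bound assms by (intro AE_I2) auto
  qed (use assms in auto)
  also have "\<dots> = (t - s) * (m * B)" using assms by (rule set_integral_const_L)
  also have "\<dots> \<le> (\<theta> t - \<theta> s) * (m * B)"
    using theta_expanding[OF assms] m_nonneg constants by (intro mult_right_mono) auto
  finally have "norm (set_lebesgue_integral L {s<..t} fu) \<le> (\<theta> t - \<theta> s) * (m * B)" .
  then show ?thesis
    using u_lipschitz[OF assms] norm_triangle_ineq[of "u t - u s" "set_lebesgue_integral L {s<..t} fu"]
    unfolding eq by (simp add: algebra_simps)
qed

text \<open>The error of freezing the argument. The factor \<open>aint\<close> makes the sum over
  all steps at most \<open>aint 0 T\<close> times a null sequence.\<close>

lemma drift_fu_diff:
  assumes j: "j < 2 ^ n"
  shows "norm (drift (grid n j) (grid n (Suc j)) (W n j) - set_lebesgue_integral L {grid n j<..grid n (Suc j)} fu)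
    \<le> aint (grid n j) (grid n (Suc j)) * (err n + M * eps n)"
proof -
  have g: "0 \<le> grid n j" "grid n j \<le> grid n (Suc j)" "grid n (Suc j) \<le> T"
    using j grid_bounds grid_mono by auto
  have eq: "drift (grid n j) (grid n (Suc j)) (W n j) - set_lebesgue_integral L {grid n j<..grid n (Suc j)} fu
      = set_lebesgue_integral L {grid n j<..grid n (Suc j)} (\<lambda>r. f r (W n j) - fu r)"
    unfolding drift_def using g
    by (intro set_integral_diff(2)[symmetric] leb.set_integrable_N f_integrable fu_integrable) auto
  have "norm (set_lebesgue_integral L {grid n j<..grid n (Suc j)} (\<lambda>r. f r (W n j) - fu r))
      \<le> set_lebesgue_integral L {grid n j<..grid n (Suc j)} (\<lambda>r. a r * (err n + M * eps n))"
  proof (rule norm_set_integral_L_le)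
    show "AE r in L. r \<in> {grid n j<..<grid n (Suc j)} \<longrightarrow> norm (f r (W n j) - fu r) \<le> a r * (err n + M * eps n)"
      using f_lipschitz
    proof eventually_elim
      case (elim r)
      show ?case
      proof
        assume r: "r \<in> {grid n j<..<grid n (Suc j)}"
        have "norm (u r - u (grid n j)) \<le> M * (\<theta> r - \<theta> (grid n j))"
          using r g by (intro u_lipschitz) auto
        also have "\<dots> \<le> M * eps n"
          using theta_grid_gap[OF j, of r] r constants by (intro mult_left_mono) auto
        finally have "norm (u r - u (grid n j)) \<le> M * eps n" .
        moreover have "norm (W n j - u (grid n j)) \<le> err n" using j by (intro W_grid_le) simp
        ultimately have "norm (W n j - u r) \<le> err n + M * eps n"
          using norm_triangle_ineq4[of "W n j - u (grid n j)" "u r - u (grid n j)"] by simp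
        then have "a r * norm (W n j - u r) \<le> a r * (err n + M * eps n)"
          by (intro mult_left_mono a_nonneg)
        then show "norm (f r (W n j) - fu r) \<le> a r * (err n + M * eps n)"
          unfolding fu_def by (rule order_trans[OF elim[rule_format]])
      qed
    qed
    show "integrable L (\<lambda>r. f r (W n j) - fu r)"
      by (intro Bochner_Integration.integrable_diff f_integrable fu_integrable)
    show "integrable L (\<lambda>r. a r * (err n + M * eps n))"
      by (intro integrable_mult_left a_integrable)
  qed (use g in simp_all)
  also have "\<dots> = aint (grid n j) (grid n (Suc j)) * (err n + M * eps n)"
    unfolding aint_def by (rule set_integral_mult_left)
  finally show ?thesis unfolding eq .
qed

text \<open>Monotonicity is perturbed twice: the selection belongs to the operator at the grid point
  instead of \<open>t\<close>, at the cost of the pseudo-distance, and \<open>W n (Suc j)\<close> is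
  replaced by \<open>u t\<close>. The constant collects \<open>1 + M + norm y\<close> from the
  former and \<open>(M + norm y) * M\<close> from the latter. The grid point may lie on either side
  of \<open>t\<close>.\<close>

lemma euler_test_inequality:
  assumes j: "j < 2 ^ n" and t: "t \<in> {0..T}" and y: "y \<in> A t x"
  shows "- ((1 + M) * (1 + M + norm y) * \<bar>\<theta> (grid n (Suc j)) - \<theta> t\<bar> + (M + norm y) * err n)
    \<le> (Z n (Suc j) - y) \<bullet> (u t - x)"
proof -
  let ?s = "grid n (Suc j)" and ?z = "Z n (Suc j)" and ?w = "W n (Suc j)"
  let ?D = "\<bar>\<theta> ?s - \<theta> t\<bar>"
  have s: "0 \<le> ?s" "?s \<le> T" using j grid_bounds[of "Suc j" n] by auto
  have z: "?z \<in> A ?s ?w" using WZ(2)[of n j] unfolding mesh_seq_grid[OF Suc_leI[OF j]] .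
  have zM: "norm ?z \<le> M" by (rule Z_bound)
  have D: "\<bar>\<rho> ?s - \<rho> t\<bar> * (1 + norm ?z + norm y) \<le> ?D * (1 + M + norm y)"
  proof (rule mult_mono)
    show "\<bar>\<rho> ?s - \<rho> t\<bar> \<le> ?D"
      using rho_le[of ?s t] rho_le[of t ?s] s t by (cases "?s \<le> t") (auto simp: \<theta>_def)
  qed (use zM constants in auto)
  have "(y - ?z) \<bullet> (?w - x) \<le> \<bar>\<rho> ?s - \<rho> t\<bar> * (1 + norm ?z + norm y)"
  proof (cases "?s \<le> t")
    case True
    then have dis: "vladimirov_dis (A t) (A ?s) \<le> ereal (\<rho> t - \<rho> ?s)" using s t by (intro A_dis) auto
    have "\<rho> t - \<rho> ?s = \<bar>\<rho> ?s - \<rho> t\<bar>" using rho_le[of ?s t] True s t by auto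
    moreover have "1 + norm y + norm ?z = 1 + norm ?z + norm y" by simp
    ultimately show ?thesis using vladimirov_disD[OF dis y z] by (simp only:)
  next
    case False
    then have dis: "vladimirov_dis (A ?s) (A t) \<le> ereal (\<rho> ?s - \<rho> t)" using s t by (intro A_dis) auto
    have "\<rho> ?s - \<rho> t = \<bar>\<rho> ?s - \<rho> t\<bar>" using rho_le[of t ?s] False s t by auto
    moreover have "(y - ?z) \<bullet> (?w - x) = (?z - y) \<bullet> (x - ?w)"
      by (metis inner_minus_left inner_minus_right minus_diff_eq)
    ultimately show ?thesis using vladimirov_disD[OF dis z y] by (simp only:)
  qed
  moreover have "(?z - y) \<bullet> (?w - x) = - ((y - ?z) \<bullet> (?w - x))"
    by (metis inner_minus_left minus_diff_eq)
  ultimately have 1: "- ((1 + M + norm y) * ?D) \<le> (?z - y) \<bullet> (?w - x)"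
    using D by (simp only: mult.commute[of ?D])
  have "norm (?w - u t) \<le> err n + M * ?D"
    using W_grid_le[of "Suc j" n] j u_lipschitz_abs[of t ?s] s t
      norm_triangle_ineq[of "?w - u ?s" "u ?s - u t"] by simp
  then have "norm (?z - y) * norm (?w - u t) \<le> (M + norm y) * (err n + M * ?D)"
    using norm_triangle_ineq4[of ?z y] zM constants by (intro mult_mono) auto
  then have 2: "(?z - y) \<bullet> (?w - u t) \<le> (M + norm y) * (err n + M * ?D)"
    using norm_cauchy_schwarz[of "?z - y" "?w - u t"] by linarith
  have "(?z - y) \<bullet> (u t - x) = (?z - y) \<bullet> (?w - x) - (?z - y) \<bullet> (?w - u t)"
    by (simp flip: inner_diff_right)
  then have "- ((1 + M + norm y) * ?D) - (M + norm y) * (err n + M * ?D) \<le> (?z - y) \<bullet> (u t - x)"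
    using 1 2 by linarith
  moreover have "(1 + M + norm y) * ?D + (M + norm y) * (M * ?D) \<le> (1 + M) * (1 + M + norm y) * ?D"
    using constants by (simp add: algebra_simps)
  ultimately show ?thesis by (simp add: algebra_simps)
qed

text \<open>The test inequalities of the finer scheme are summed over one coarse block. The main
  error has the block mass \<open>\<nu>\<close> as a factor, so that division by
  \<open>\<nu>\<close> still leaves a null sequence.\<close>

lemma block_test_inequality_approx:
  fixes p :: nat
  assumes k: "k < 2 ^ n" and t: "grid n k < t" "t \<le> grid n (Suc k)" and y: "y \<in> A t x"
  defines "i \<equiv> k * 2 ^ p" and "l \<equiv> Suc k * 2 ^ p" and "q \<equiv> n + p"
  defines "\<nu> \<equiv> \<theta> (grid n (Suc k)) - \<theta> (grid n k)" and "\<kappa> \<equiv> \<theta> (grid n (Suc k)) - \<theta> t"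
  shows "- ((1 + M) * (1 + M + norm y) * (\<nu> * (\<kappa> + eps n))
       + (M + norm y) * err q * \<nu> + aint 0 T * (err q + M * eps q) * norm (u t - x))
    \<le> (W q i - W q l - set_lebesgue_integral L {grid n k<..grid n (Suc k)} fu - \<nu> *\<^sub>R y) \<bullet> (u t - x)"
proof -
  let ?K = "(1 + M) * (1 + M + norm y)"
  let ?\<eta> = "err q + M * eps q"
  have l: "l \<le> 2 ^ q" using k by (simp add: l_def q_def power_add Suc_leI flip: mult_Suc)
  have il: "i \<le> l" by (simp add: i_def l_def)
  have gi: "grid q i = grid n k" and gl: "grid q l = grid n (Suc k)"
    unfolding i_def l_def q_def by (rule grid_refine)+
  define g where "g j = min (\<theta> (grid q j) - \<theta> (grid q i)) (eps n)" for j
  have gb: "0 \<le> grid q j" "grid q j \<le> T" if "j \<le> l" for j using that l grid_bounds[of j q] by auto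
  have gm: "grid q j \<le> grid q j'" if "j \<le> j'" "j' \<le> l" for j j' using that l by (intro grid_mono) auto
  have tm: "\<theta> (grid q j) \<le> \<theta> (grid q j')" if "j \<le> j'" "j' \<le> l" for j j'
    using that gm[OF that] gb[of j] gb[of j'] by (intro theta_mono) auto
  have tT: "t \<in> {0..T}" using t gb[OF il] gb[of l] gi gl by auto
  have th: "\<theta> (grid q i) \<le> \<theta> t" "\<theta> t \<le> \<theta> (grid q l)"
    using t gi gl gb[OF il] gb[of l] by (auto intro!: theta_mono)
  have K0: "0 \<le> ?K" using constants by simp
  have eta0: "0 \<le> ?\<eta>" using err_nonneg[of q] constants eps_pos[of q] by simp
  let ?E = "\<lambda>j. ?K * (\<kappa> * (\<theta> (grid q j) - \<theta> (grid q i)) + \<nu> * g j)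
       + (M + norm y) * err q * (\<theta> (grid q j) - \<theta> (grid q i)) + aint (grid q i) (grid q j) * ?\<eta> * norm (u t - x)"
  let ?R = "\<lambda>j. (W q i - W q j - set_lebesgue_integral L {grid q i<..grid q j} fu
      - (\<theta> (grid q j) - \<theta> (grid q i)) *\<^sub>R y) \<bullet> (u t - x)"
  have distr: "K * (r * (b' - a) + n * g') + C * (b' - a) + (d + d') * e * x
      = (K * (r * (b - a) + n * g) + C * (b - a) + d * e * x)
        + (K * ((b' - b) * r + n * (g' - g)) + C * (b' - b)) + d' * e * x"
    for K r a b b' n g g' C d d' e x :: real
    by (simp add: algebra_simps)
  have add3: "- E' \<le> R'" if "E' = E + E1 + E2" "R' = R + R1 + R2" "- E \<le> R" "- E1 \<le> R1" "- E2 \<le> R2"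
    for E E' E1 E2 R R' R1 R2 :: real
    using that by linarith
  have "- ?E j \<le> ?R j" if "i \<le> j" "j \<le> l" for j
    using that
  proof (induction j rule: dec_induct)
    case base
    then show ?case using eps_pos[of n] by (simp add: g_def set_lebesgue_integral_def)
  next
    case (step j)
    let ?h = "\<theta> (grid q (Suc j)) - \<theta> (grid q j)"
    let ?D = "\<bar>\<theta> (grid q (Suc j)) - \<theta> t\<bar>"
    let ?F = "drift (grid q j) (grid q (Suc j)) (W q j)"
    let ?I = "set_lebesgue_integral L {grid q j<..grid q (Suc j)} fu"
    have jl: "j < l" "j < 2 ^ q" using step l by auto
    have h0: "0 \<le> ?h" using tm[of j "Suc j"] step by simp
    \<comment> \<open>Steps that end with the block are at distance exactly \<open>\<kappa>\<close>
      from \<open>t\<close>. For earlier ones the distance is at most \<open>\<nu>\<close>, and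
      their lengths are absorbed by the increments of \<open>g\<close>, which sum to at most
      \<open>eps n\<close>.\<close>
    have hD: "?h * ?D \<le> ?h * \<kappa> + \<nu> * (g (Suc j) - g j)"
    proof (cases "grid q (Suc j) = grid n (Suc k)")
      case True
      have "g j \<le> g (Suc j)" using tm[of j "Suc j"] step by (auto simp: g_def)
      moreover have "0 \<le> \<nu>" using tm[OF il] by (simp add: \<nu>_def gi gl)
      moreover have "?D = \<kappa>" using True th gl by (simp add: \<kappa>_def)
      ultimately show ?thesis by simp
    next
      case False
      have "grid n k \<le> grid q (Suc j)" "grid q (Suc j) < grid n (Suc k)"
        using gm[of i "Suc j"] gm[of "Suc j" l] step False gi gl by auto
      then have "\<theta> (grid q (Suc j)) - \<theta> (grid n k) \<le> eps n" by (rule theta_grid_gap[OF k])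
      then have "g (Suc j) = \<theta> (grid q (Suc j)) - \<theta> (grid q i)" by (simp add: g_def gi)
      moreover have "g j \<le> \<theta> (grid q j) - \<theta> (grid q i)" by (simp add: g_def)
      ultimately have hg: "?h \<le> g (Suc j) - g j" by simp
      have D\<nu>: "?D \<le> \<nu>"
        using tm[of i "Suc j"] tm[of "Suc j" l] step th by (auto simp: \<nu>_def gi gl)
      have "?h * ?D \<le> (g (Suc j) - g j) * \<nu>" using hg D\<nu> h0 by (intro mult_mono) auto
      moreover have "0 \<le> ?h * \<kappa>" using h0 th by (simp add: \<kappa>_def gl)
      ultimately show ?thesis by (simp add: mult.commute)
    qed
    have tj: "- (?K * ?D + (M + norm y) * err q) \<le> (Z q (Suc j) - y) \<bullet> (u t - x)"
      by (rule euler_test_inequality[OF jl(2) tT y])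
    have "- (?K * (?h * \<kappa> + \<nu> * (g (Suc j) - g j)) + (M + norm y) * err q * ?h) \<le> - (?h * (?K * ?D + (M + norm y) * err q))"
      using mult_left_mono[OF hD K0] by (simp add: algebra_simps)
    also have "\<dots> \<le> ?h * ((Z q (Suc j) - y) \<bullet> (u t - x))"
      using mult_left_mono[OF tj h0] by (simp only: mult_minus_right)
    also have "\<dots> = (?h *\<^sub>R Z q (Suc j) - ?h *\<^sub>R y) \<bullet> (u t - x)"
      by (simp add: inner_diff algebra_simps)
    finally have z_part: "- (?K * (?h * \<kappa> + \<nu> * (g (Suc j) - g j)) + (M + norm y) * err q * ?h)
       \<le> (?h *\<^sub>R Z q (Suc j) - ?h *\<^sub>R y) \<bullet> (u t - x)" .
    have "- ((?F - ?I) \<bullet> (u t - x)) \<le> norm (?F - ?I) * norm (u t - x)"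
      using Cauchy_Schwarz_ineq2[of "?F - ?I" "u t - x"] by linarith
    also have "\<dots> \<le> aint (grid q j) (grid q (Suc j)) * ?\<eta> * norm (u t - x)"
      using drift_fu_diff[OF jl(2)] by (intro mult_right_mono) auto
    finally have f_part: "- (aint (grid q j) (grid q (Suc j)) * ?\<eta> * norm (u t - x)) \<le> (?F - ?I) \<bullet> (u t - x)"
      by linarith
    have weq: "W q (Suc j) = W q j - ?F - ?h *\<^sub>R Z q (Suc j)"
      using WZ(3)[of q j] mesh_seq_grid[of j q] mesh_seq_grid[of "Suc j" q] jl by simp
    have ieq: "set_lebesgue_integral L {grid q i<..grid q (Suc j)} fu
      = set_lebesgue_integral L {grid q i<..grid q j} fu + ?I"
      using gb[of i] gb[of "Suc j"] gm[of i j] gm[of j "Suc j"] step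
      by (intro set_integral_Ioc_add fu_integrable) auto
    have aeq: "aint (grid q i) (grid q (Suc j)) = aint (grid q i) (grid q j) + aint (grid q j) (grid q (Suc j))"
      using gb[of i] gb[of "Suc j"] gm[of i j] gm[of j "Suc j"] step
      by (intro aint_add) auto
    have R: "?R (Suc j) = ?R j + (?h *\<^sub>R Z q (Suc j) - ?h *\<^sub>R y) \<bullet> (u t - x) + (?F - ?I) \<bullet> (u t - x)"
      unfolding weq ieq by (simp add: inner_diff inner_add algebra_simps)
    have E: "?E (Suc j) = ?E j + (?K * (?h * \<kappa> + \<nu> * (g (Suc j) - g j)) + (M + norm y) * err q * ?h)
      + aint (grid q j) (grid q (Suc j)) * ?\<eta> * norm (u t - x)"
      unfolding aeq by (rule distr)
    have "- ?E j \<le> ?R j" using step.prems by (intro step.IH) simp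
    then show ?case by (rule add3[OF E R _ z_part f_part])
  qed
  from this[OF il order_refl] have "- ?E l \<le> ?R l" .
  moreover have "?E l \<le> ?K * (\<nu> * (\<kappa> + eps n)) + (M + norm y) * err q * \<nu> + aint 0 T * ?\<eta> * norm (u t - x)"
  proof (intro add_mono)
    have "0 \<le> \<nu>" using tm[OF il] by (simp add: \<nu>_def gi gl)
    then have "\<nu> * g l \<le> \<nu> * eps n" by (intro mult_left_mono) (auto simp: g_def)
    then show "?K * (\<kappa> * (\<theta> (grid q l) - \<theta> (grid q i)) + \<nu> * g l) \<le> ?K * (\<nu> * (\<kappa> + eps n))"
      using K0 by (intro mult_left_mono) (auto simp: \<nu>_def gi gl algebra_simps)
    show "(M + norm y) * err q * (\<theta> (grid q l) - \<theta> (grid q i)) \<le> (M + norm y) * err q * \<nu>"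
      by (simp add: \<nu>_def gi gl)
    have "aint 0 T = aint 0 (grid q i) + aint (grid q i) T"
      using gb[OF il] by (intro aint_add) auto
    moreover have "aint (grid q i) T = aint (grid q i) (grid q l) + aint (grid q l) T"
      using gb[OF il] gb[of l] gm[OF il] by (intro aint_add) auto
    ultimately have "aint (grid q i) (grid q l) \<le> aint 0 T"
      using aint_nonneg[of 0 "grid q i"] aint_nonneg[of "grid q l" T] by linarith
    then show "aint (grid q i) (grid q l) * ?\<eta> * norm (u t - x) \<le> aint 0 T * ?\<eta> * norm (u t - x)"
      using eta0 by (intro mult_right_mono) auto
  qed
  ultimately show ?thesis by (simp only: gi gl \<nu>_def)
qed

text \<open>The block stays fixed while \<open>p\<close> tends to infinity, which removes all terms
  in \<open>err (n + p)\<close> and \<open>eps (n + p)\<close>. What remains vanishes only later, as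
  the blocks shrink.\<close>

lemma block_test_inequality:
  assumes k: "k < 2 ^ n" and t: "grid n k < t" "t \<le> grid n (Suc k)" and y: "y \<in> A t x"
  defines "\<nu> \<equiv> \<theta> (grid n (Suc k)) - \<theta> (grid n k)" and "\<kappa> \<equiv> \<theta> (grid n (Suc k)) - \<theta> t"
  shows "- ((1 + M) * (1 + M + norm y) * (\<nu> * (\<kappa> + eps n)))
    \<le> (- (U (grid n (Suc k)) - U (grid n k)) - \<nu> *\<^sub>R y) \<bullet> (u t - x)"
proof -
  let ?i = "\<lambda>p. k * 2 ^ p" and ?l = "\<lambda>p. Suc k * 2 ^ p"
  let ?I = "set_lebesgue_integral L {grid n k<..grid n (Suc k)} fu"
  have lim: "(\<lambda>p. W (n + p) (j * 2 ^ p)) \<longlonglongrightarrow> u (grid n j)" if "j \<le> 2 ^ n" for j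
  proof -
    have "norm (W (n + p) (j * 2 ^ p) - u (grid n j)) \<le> err (n + p)" for p
      using W_grid_le[of "j * 2 ^ p" "n + p"] that unfolding grid_refine by (simp add: power_add)
    then have "\<forall>\<^sub>F p in sequentially. norm (W (n + p) (j * 2 ^ p) - u (grid n j)) \<le> err (n + p)"
      by (intro always_eventually allI)
    moreover have "(\<lambda>p. err (n + p)) \<longlonglongrightarrow> 0"
      using LIMSEQ_ignore_initial_segment[OF err_tendsto_0, of n] by (simp add: add.commute)
    ultimately have "(\<lambda>p. W (n + p) (j * 2 ^ p) - u (grid n j)) \<longlonglongrightarrow> 0"
      by (rule Lim_null_comparison)
    then show ?thesis by (simp add: LIM_zero_iff)
  qed
  have errq: "(\<lambda>p. err (n + p)) \<longlonglongrightarrow> 0" and epsq: "(\<lambda>p. eps (n + p)) \<longlonglongrightarrow> 0"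
    using LIMSEQ_ignore_initial_segment[OF err_tendsto_0, of n] LIMSEQ_ignore_initial_segment[OF eps_tendsto_0, of n]
    by (simp_all add: add.commute)
  have "- ((1 + M) * (1 + M + norm y) * (\<nu> * (\<kappa> + eps n))
       + (M + norm y) * 0 * \<nu> + aint 0 T * (0 + M * 0) * norm (u t - x))
    \<le> (u (grid n k) - u (grid n (Suc k)) - ?I - \<nu> *\<^sub>R y) \<bullet> (u t - x)"
  proof (rule LIMSEQ_le)
    show "(\<lambda>p. - ((1 + M) * (1 + M + norm y) * (\<nu> * (\<kappa> + eps n))
       + (M + norm y) * err (n + p) * \<nu> + aint 0 T * (err (n + p) + M * eps (n + p)) * norm (u t - x)))
      \<longlonglongrightarrow> - ((1 + M) * (1 + M + norm y) * (\<nu> * (\<kappa> + eps n))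
       + (M + norm y) * 0 * \<nu> + aint 0 T * (0 + M * 0) * norm (u t - x))"
      by (intro tendsto_intros errq epsq)
    show "(\<lambda>p. (W (n + p) (?i p) - W (n + p) (?l p) - ?I - \<nu> *\<^sub>R y) \<bullet> (u t - x))
      \<longlonglongrightarrow> (u (grid n k) - u (grid n (Suc k)) - ?I - \<nu> *\<^sub>R y) \<bullet> (u t - x)"
      using k by (intro tendsto_intros lim) auto
    show "\<exists>N. \<forall>p\<ge>N. - ((1 + M) * (1 + M + norm y) * (\<nu> * (\<kappa> + eps n))
       + (M + norm y) * err (n + p) * \<nu> + aint 0 T * (err (n + p) + M * eps (n + p)) * norm (u t - x))
      \<le> (W (n + p) (?i p) - W (n + p) (?l p) - ?I - \<nu> *\<^sub>R y) \<bullet> (u t - x)"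
      unfolding \<nu>_def \<kappa>_def using block_test_inequality_approx[OF k t y] by blast
  qed
  moreover have "u (grid n k) - u (grid n (Suc k)) - ?I = - (U (grid n (Suc k)) - U (grid n k))"
    unfolding U_def using set_integral_Ioc_add[OF fu_integrable, of 0 "grid n k" "grid n (Suc k)"]
      grid_bounds[of k n] grid_bounds[of "Suc k" n] grid_mono[of k "Suc k" n] k by simp
  ultimately show ?thesis by simp
qed

end

section \<open>The energy inequality for primitives\<close>

context time_change_measure
begin

text \<open>Approach from the right keeps a possible atom at \<open>t\<close> inside the interval,
  so the indicators converge pointwise.\<close>

lemma set_integral_right_limit:
  fixes g :: "real \<Rightarrow> 'b::{banach, second_countable_topology}"
  assumes g: "integrable N g" and r: "0 \<le> r" and R: "R \<longlonglongrightarrow> t" "\<And>n. t \<le> R n" "\<And>n. R n \<le> T" and t: "r \<le> t"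
  shows "(\<lambda>n. set_lebesgue_integral N {r<..R n} g) \<longlonglongrightarrow> set_lebesgue_integral N {r<..t} g"
  unfolding set_lebesgue_integral_def
proof (rule integral_dominated_convergence[where w="\<lambda>s. norm (g s)"])
  have tT: "t \<le> T" using R(2)[of 0] R(3)[of 0] by simp
  show "(\<lambda>s. indicator {r<..t} s *\<^sub>R g s) \<in> borel_measurable N"
    using set_integrable_N[OF g, of r t] tT r unfolding set_integrable_def
    by (intro borel_measurable_integrable)
  show "(\<lambda>s. indicator {r<..R n} s *\<^sub>R g s) \<in> borel_measurable N" for n
    using set_integrable_N[OF g r R(3)] unfolding set_integrable_def
    by (intro borel_measurable_integrable)
  have "(\<lambda>n. indicator {r<..R n} s *\<^sub>R g s) \<longlonglongrightarrow> indicator {r<..t} s *\<^sub>R g s" for s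
  proof (cases "s \<le> t")
    case True
    have eq: "indicator {r<..R n} s *\<^sub>R g s = indicator {r<..t} s *\<^sub>R g s" for n
      using True R(2)[of n] by (auto simp: indicator_def)
    show ?thesis unfolding eq by (rule tendsto_const)
  next
    case False
    then have "eventually (\<lambda>n. R n < s) sequentially" using R(1) by (intro order_tendstoD(2)) auto
    then have "eventually (\<lambda>n. indicator {r<..R n} s *\<^sub>R g s = indicator {r<..t} s *\<^sub>R g s) sequentially"
      by eventually_elim (use False in \<open>auto simp: indicator_def\<close>)
    then show ?thesis by (rule tendsto_eventually)
  qed
  then show "AE s in N. (\<lambda>n. indicator {r<..R n} s *\<^sub>R g s) \<longlonglongrightarrow> indicator {r<..t} s *\<^sub>R g s" by simp
  show "AE s in N. norm (indicator {r<..R n} s *\<^sub>R g s) \<le> norm (g s)" for n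
    by (auto simp: indicator_def)
qed (use g in auto)

lemma right_end_tendsto:
  assumes t: "0 < t" "t \<le> T"
  shows "(\<lambda>n. grid n (Suc (block n t))) \<longlonglongrightarrow> t"
proof (rule tendsto_sandwich[where f="\<lambda>_. t"])
  show "(\<lambda>n. t + (\<theta> (grid n (Suc (block n t))) - \<theta> t)) \<longlonglongrightarrow> t"
    using tendsto_add[OF tendsto_const[of t] tendsto_diff[OF theta_block_tendsto[OF t] tendsto_const[of "\<theta> t"]]]
    by simp
  have "t \<le> grid n (Suc (block n t)) \<and> grid n (Suc (block n t)) \<le> t + (\<theta> (grid n (Suc (block n t))) - \<theta> t)" for n
    using block_props[OF t, where n=n] theta_expanding[of t "grid n (Suc (block n t))"] t
      grid_bounds[of "Suc (block n t)" n] by auto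
  then show "\<forall>\<^sub>F n in sequentially. t \<le> grid n (Suc (block n t))"
    "\<forall>\<^sub>F n in sequentially. grid n (Suc (block n t)) \<le> t + (\<theta> (grid n (Suc (block n t))) - \<theta> t)"
    by auto
qed simp

context
  fixes D d :: "real \<Rightarrow> 'b::{real_inner, banach, second_countable_topology}"
  assumes d: "integrable N d"
    and D: "\<And>t. 0 \<le> t \<Longrightarrow> t \<le> T \<Longrightarrow> D t = set_lebesgue_integral N {0<..t} d"
begin

lemma primitive_add: "0 \<le> s \<Longrightarrow> s \<le> t \<Longrightarrow> t \<le> T \<Longrightarrow> D t - D s = set_lebesgue_integral N {s<..t} d"
proof -
  assume st: "0 \<le> s" "s \<le> t" "t \<le> T"
  have eq: "{0<..t} = {0<..s} \<union> {s<..t}" using st by auto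
  have "set_lebesgue_integral N {0<..t} d = set_lebesgue_integral N {0<..s} d + set_lebesgue_integral N {s<..t} d"
    unfolding eq using st by (intro set_integral_Un set_integrable_N d) auto
  then show ?thesis using D[of s] D[of t] st by simp
qed

lemma primitive_bound:
  assumes "0 \<le> t" "t \<le> T"
  shows "norm (D t) \<le> (\<integral>s. norm (d s) \<partial>N)"
proof -
  have "norm (D t) \<le> (\<integral>s. norm (indicator {0<..t} s *\<^sub>R d s) \<partial>N)"
    using D[OF assms] by (simp only: set_lebesgue_integral_def integral_norm_bound)
  also have "\<dots> \<le> (\<integral>s. norm (d s) \<partial>N)"
  proof (rule integral_mono)
    show "integrable N (\<lambda>s. norm (indicator {0<..t} s *\<^sub>R d s))"
      using set_integrable_N[OF d, of 0 t] assms unfolding set_integrable_def by (intro integrable_norm) auto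
  qed (use d in \<open>auto simp: indicator_def\<close>)
  finally show ?thesis .
qed

text \<open>Right end points are sampled for the sign in \<open>(norm b)\<^sup>2 - (norm a)\<^sup>2
  \<le> 2 * (b \<bullet> (b - a))\<close>, and because there the primitive converges to its value at
  \<open>t\<close>, atoms included.\<close>

definition right_values :: "nat \<Rightarrow> real \<Rightarrow> 'b" where
  "right_values n t = (\<Sum>k<2^n. indicator {grid n k<..grid n (Suc k)} t *\<^sub>R D (grid n (Suc k)))"

lemma right_values_block:
  assumes "k < 2 ^ n" "t \<in> {grid n k<..grid n (Suc k)}"
  shows "right_values n t = D (grid n (Suc k))"
proof -
  have "indicator {grid n j<..grid n (Suc j)} t *\<^sub>R D (grid n (Suc j)) = (if j = k then D (grid n (Suc k)) else 0)"
    if "j < 2 ^ n" for j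
  proof (cases "t \<in> {grid n j<..grid n (Suc j)}")
    case True
    then have "block n t = j" using block_unique[OF that, of t] by simp
    moreover have "block n t = k" using block_unique[OF assms(1), of t] assms(2) by simp
    ultimately show ?thesis using True by simp
  qed (use assms in auto)
  then have "right_values n t = (\<Sum>j<2^n. if j = k then D (grid n (Suc k)) else 0)"
    unfolding right_values_def by (intro sum.cong) auto
  then show ?thesis using assms(1) by simp
qed

lemma right_values_measurable [measurable]: "right_values n \<in> borel_measurable N"
  unfolding right_values_def
  by (intro borel_measurable_sum borel_measurable_scaleR borel_measurable_indicator
      borel_measurable_const sets_N_Ioc grid_bounds) auto

lemma right_values_tendsto:
  assumes t: "0 < t" "t \<le> T"
  shows "(\<lambda>n. right_values n t) \<longlonglongrightarrow> D t"
proof -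
  have eq: "right_values n t = set_lebesgue_integral N {0<..grid n (Suc (block n t))} d" for n
    using block_props[OF t, where n=n] grid_bounds[of "Suc (block n t)" n]
    by (subst right_values_block[of "block n t"]) (auto intro!: D)
  have "(\<lambda>n. set_lebesgue_integral N {0<..grid n (Suc (block n t))} d) \<longlonglongrightarrow> set_lebesgue_integral N {0<..t} d"
  proof (rule set_integral_right_limit[OF d _ right_end_tendsto[OF t]])
    show "t \<le> grid n (Suc (block n t))" "grid n (Suc (block n t)) \<le> T" for n
      using block_props[OF t, where n=n] grid_bounds[of "Suc (block n t)" n] by auto
  qed (use t in auto)
  then show ?thesis using D[of t] t by (simp add: eq)
qed

lemma right_values_bound: "norm (right_values n t) \<le> (\<integral>s. norm (d s) \<partial>N)"
proof (cases "\<exists>k<2^n. t \<in> {grid n k<..grid n (Suc k)}")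
  case True
  then obtain k where k: "k < 2 ^ n" "t \<in> {grid n k<..grid n (Suc k)}" by blast
  then show ?thesis using primitive_bound[of "grid n (Suc k)"] grid_bounds[of "Suc k" n]
    by (simp add: right_values_block[OF k])
next
  case False
  then have "right_values n t = 0" unfolding right_values_def by (intro sum.neutral) auto
  then show ?thesis by (simp add: Bochner_Integration.integral_nonneg)
qed

lemma primitive_measurable: "D \<in> borel_measurable N"
proof -
  \<comment> \<open>No block contains 0, so the step functions vanish there; \<open>D 0\<close> is
    also 0, as an integral over the empty set.\<close>
  have "(\<lambda>t. if t = 0 then 0 else D t) \<in> borel_measurable N"
  proof (rule borel_measurable_LIMSEQ_metric)
    show "right_values n \<in> borel_measurable N" for n by measurable
    fix t assume "t \<in> space N"
    then have t: "0 \<le> t" "t \<le> T" by (auto simp: space_N)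
    show "(\<lambda>n. right_values n t) \<longlonglongrightarrow> (if t = 0 then 0 else D t)"
    proof (cases "t = 0")
      case True
      then have "right_values n t = 0" for n
        unfolding right_values_def using grid_bounds
        by (intro sum.neutral) (auto simp: indicator_def not_less)
      then show ?thesis using True by simp
    qed (use right_values_tendsto[of t] t in simp)
  qed
  moreover have "(if t = 0 then 0 else D t) = D t" if "t \<in> space N" for t
    using D[of 0] T_pos by (simp add: set_lebesgue_integral_def)
  ultimately show ?thesis by (simp cong: measurable_cong)
qed

lemma right_values_inner_integrable: "integrable N (\<lambda>s. right_values n s \<bullet> d s)"
proof (rule Bochner_Integration.integrable_bound)
  show "integrable N (\<lambda>s. (\<integral>s. norm (d s) \<partial>N) * norm (d s))"
    using d by (intro integrable_mult_right integrable_norm)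
  show "(\<lambda>s. right_values n s \<bullet> d s) \<in> borel_measurable N"
    using d by (intro borel_measurable_inner right_values_measurable) auto
  have "norm (right_values n s \<bullet> d s) \<le> norm ((\<integral>s. norm (d s) \<partial>N) * norm (d s))" for s
  proof -
    have "norm (right_values n s \<bullet> d s) \<le> norm (right_values n s) * norm (d s)"
      using Cauchy_Schwarz_ineq2 by simp
    also have "\<dots> \<le> (\<integral>s. norm (d s) \<partial>N) * norm (d s)"
      by (intro mult_right_mono right_values_bound) simp
    also have "\<dots> \<le> norm ((\<integral>s. norm (d s) \<partial>N) * norm (d s))" by simp
    finally show ?thesis .
  qed
  then show "AE s in N. norm (right_values n s \<bullet> d s) \<le> norm ((\<integral>s. norm (d s) \<partial>N) * norm (d s))"
    by simp
qed

lemma primitive_inner_integrable: "integrable N (\<lambda>s. D s \<bullet> d s)"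
proof (rule Bochner_Integration.integrable_bound)
  show "integrable N (\<lambda>s. (\<integral>s. norm (d s) \<partial>N) * norm (d s))"
    using d by (intro integrable_mult_right integrable_norm)
  show "(\<lambda>s. D s \<bullet> d s) \<in> borel_measurable N"
    using d by (intro borel_measurable_inner primitive_measurable) auto
  have "norm (D s \<bullet> d s) \<le> norm ((\<integral>s. norm (d s) \<partial>N) * norm (d s))" if "s \<in> space N" for s
  proof -
    have "norm (D s \<bullet> d s) \<le> norm (D s) * norm (d s)"
      using Cauchy_Schwarz_ineq2 by simp
    also have "\<dots> \<le> (\<integral>s. norm (d s) \<partial>N) * norm (d s)"
      using that by (intro mult_right_mono primitive_bound) (auto simp: space_N)
    also have "\<dots> \<le> norm ((\<integral>s. norm (d s) \<partial>N) * norm (d s))" by simp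
    finally show ?thesis .
  qed
  then show "AE s in N. norm (D s \<bullet> d s) \<le> norm ((\<integral>s. norm (d s) \<partial>N) * norm (d s))"
    by (rule AE_I2)
qed

text \<open>On a block the sampled function is the constant \<open>D\<close> at the right end, so
  its integral against \<open>d\<close> is \<open>D ?b \<bullet> (D ?b - D ?a)\<close>. Dropping the
  square of the increment gives one step of the induction.\<close>

lemma energy_inequality_grid:
  assumes "k \<le> 2 ^ n"
  shows "(norm (D (grid n k)))\<^sup>2 \<le> 2 * set_lebesgue_integral N {0<..grid n k} (\<lambda>s. right_values n s \<bullet> d s)"
  using assms
proof (induction k)
  case 0
  then show ?case using D[of 0] T_pos by (simp add: set_lebesgue_integral_def)
next
  case (Suc k)
  let ?a = "grid n k" and ?b = "grid n (Suc k)" and ?g = "\<lambda>s. right_values n s \<bullet> d s"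
  have g: "0 \<le> ?a" "?a \<le> ?b" "?b \<le> T" using Suc.prems grid_bounds grid_mono by auto
  have eq: "{0<..?b} = {0<..?a} \<union> {?a<..?b}" using g by auto
  have split: "set_lebesgue_integral N {0<..?b} ?g
      = set_lebesgue_integral N {0<..?a} ?g + set_lebesgue_integral N {?a<..?b} ?g"
    unfolding eq using g by (intro set_integral_Un set_integrable_N right_values_inner_integrable) auto
  have "set_lebesgue_integral N {?a<..?b} ?g = (\<integral>s. D ?b \<bullet> (indicator {?a<..?b} s *\<^sub>R d s) \<partial>N)"
    unfolding set_lebesgue_integral_def
    using Suc.prems by (intro Bochner_Integration.integral_cong) (auto simp: indicator_def right_values_block[of k] Suc_le_eq)
  also have "\<dots> = D ?b \<bullet> set_lebesgue_integral N {?a<..?b} d"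
    unfolding set_lebesgue_integral_def
    using set_integrable_N[OF d g(1,3)] by (intro integral_inner_right) (simp add: set_integrable_def)
  also have "\<dots> = D ?b \<bullet> (D ?b - D ?a)" using primitive_add[OF g] by simp
  finally have I: "set_lebesgue_integral N {?a<..?b} ?g = D ?b \<bullet> (D ?b - D ?a)" .
  have "(norm (D ?a))\<^sup>2 = (norm (D ?b))\<^sup>2 - 2 * (D ?b \<bullet> (D ?b - D ?a)) + (norm (D ?b - D ?a))\<^sup>2"
    by (simp only: power2_norm_eq_inner) (simp add: inner_diff inner_commute algebra_simps)
  then have "(norm (D ?b))\<^sup>2 \<le> (norm (D ?a))\<^sup>2 + 2 * (D ?b \<bullet> (D ?b - D ?a))"
    using zero_le_power2[of "norm (D ?b - D ?a)"] by linarith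
  then show ?case using Suc split I by simp
qed

text \<open>At atoms of \<open>N\<close> the inequality is strict in general, since \<open>D\<close> is the right-continuous primitive.\<close>
lemma energy_inequality:
  assumes t: "0 \<le> t" "t \<le> T"
  shows "(norm (D t))\<^sup>2 \<le> 2 * set_lebesgue_integral N {0<..t} (\<lambda>s. D s \<bullet> d s)"
proof -
  let ?g = "\<lambda>s. D s \<bullet> d s"
  have grid: "(norm (D (grid n k)))\<^sup>2 \<le> 2 * set_lebesgue_integral N {0<..grid n k} ?g" if k: "k \<le> 2 ^ n" for n k
  proof (rule LIMSEQ_le_const)
    note b = grid_bounds[OF k]
    have "(\<lambda>p. set_lebesgue_integral N {0<..grid n k} (\<lambda>s. right_values (n + p) s \<bullet> d s))
        \<longlonglongrightarrow> set_lebesgue_integral N {0<..grid n k} ?g"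
      unfolding set_lebesgue_integral_def
    proof (rule integral_dominated_convergence[where w="\<lambda>s. (\<integral>s. norm (d s) \<partial>N) * norm (d s)"])
      show "(\<lambda>s. indicator {0<..grid n k} s *\<^sub>R (D s \<bullet> d s)) \<in> borel_measurable N"
        using set_integrable_N[OF primitive_inner_integrable, of 0 "grid n k"] b
        unfolding set_integrable_def by (intro borel_measurable_integrable) auto
      show "(\<lambda>s. indicator {0<..grid n k} s *\<^sub>R (right_values (n + p) s \<bullet> d s)) \<in> borel_measurable N" for p
        using set_integrable_N[OF right_values_inner_integrable, of 0 "grid n k" "n + p"] b
        unfolding set_integrable_def by (intro borel_measurable_integrable) auto
      show "integrable N (\<lambda>s. (\<integral>s. norm (d s) \<partial>N) * norm (d s))"
        using d by (intro integrable_mult_right integrable_norm)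
      have "(\<lambda>p. indicator {0<..grid n k} s *\<^sub>R (right_values (n + p) s \<bullet> d s))
          \<longlonglongrightarrow> indicator {0<..grid n k} s *\<^sub>R (D s \<bullet> d s)" for s
      proof (cases "s \<in> {0<..grid n k}")
        case True
        then have "(\<lambda>p. right_values p s) \<longlonglongrightarrow> D s" using b by (intro right_values_tendsto) auto
        then have "(\<lambda>p. right_values (p + n) s) \<longlonglongrightarrow> D s" by (rule LIMSEQ_ignore_initial_segment)
        then show ?thesis by (intro tendsto_intros) (simp add: add.commute)
      qed simp
      then show "AE s in N. (\<lambda>p. indicator {0<..grid n k} s *\<^sub>R (right_values (n + p) s \<bullet> d s))
          \<longlonglongrightarrow> indicator {0<..grid n k} s *\<^sub>R (D s \<bullet> d s)" by (rule AE_I2)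
      have "norm (indicator {0<..grid n k} s *\<^sub>R (right_values (n + p) s \<bullet> d s)) \<le> (\<integral>s. norm (d s) \<partial>N) * norm (d s)" for s p
      proof -
        have "norm (indicator {0<..grid n k} s *\<^sub>R (right_values (n + p) s \<bullet> d s)) \<le> norm (right_values (n + p) s) * norm (d s)"
          using Cauchy_Schwarz_ineq2[of "right_values (n + p) s" "d s"] by (auto simp: indicator_def)
        also have "\<dots> \<le> (\<integral>s. norm (d s) \<partial>N) * norm (d s)"
          by (intro mult_right_mono right_values_bound) simp
        finally show ?thesis .
      qed
      then show "AE s in N. norm (indicator {0<..grid n k} s *\<^sub>R (right_values (n + p) s \<bullet> d s))
          \<le> (\<integral>s. norm (d s) \<partial>N) * norm (d s)" for p
        by (intro AE_I2)
    qed
    then show "(\<lambda>p. 2 * set_lebesgue_integral N {0<..grid n k} (\<lambda>s. right_values (n + p) s \<bullet> d s))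
        \<longlonglongrightarrow> 2 * set_lebesgue_integral N {0<..grid n k} ?g"
      by (intro tendsto_intros)
    have "(norm (D (grid n k)))\<^sup>2 \<le> 2 * set_lebesgue_integral N {0<..grid n k} (\<lambda>s. right_values (n + p) s \<bullet> d s)" for p
    proof -
      have "k * 2 ^ p \<le> 2 ^ (n + p)" using k by (simp add: power_add)
      from energy_inequality_grid[OF this] show ?thesis unfolding grid_refine .
    qed
    then show "\<exists>N'. \<forall>p\<ge>N'. (norm (D (grid n k)))\<^sup>2 \<le> 2 * set_lebesgue_integral N {0<..grid n k} (\<lambda>s. right_values (n + p) s \<bullet> d s)"
      by blast
  qed
  show ?thesis
  proof (cases "t = 0")
    case True
    then show ?thesis using grid[of 0 0] by simp
  next
    case False
    then have t0: "0 < t" using t by simp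
    \<comment> \<open>A general \<open>t\<close> is approached by grid points from the right, along
      which both sides are continuous.\<close>
    let ?R = "\<lambda>n. grid n (Suc (block n t))"
    have R: "t \<le> ?R n" "?R n \<le> T" "Suc (block n t) \<le> 2 ^ n" for n
      using block_props[OF t0 t(2), where n=n] grid_bounds[of "Suc (block n t)" n] by auto
    have lim: "(\<lambda>n. set_lebesgue_integral N {0<..?R n} h) \<longlonglongrightarrow> set_lebesgue_integral N {0<..t} h"
      if "integrable N h" for h :: "real \<Rightarrow> 'c::{banach, second_countable_topology}"
      by (rule set_integral_right_limit[OF that order_refl right_end_tendsto[OF t0 t(2)] R(1,2) t(1)])
    have "(\<lambda>n. D (?R n)) \<longlonglongrightarrow> D t"
      using lim[OF d] D[OF t] D R t by (simp add: order_trans[OF t(1) R(1)])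
    then have l1: "(\<lambda>n. (norm (D (?R n)))\<^sup>2) \<longlonglongrightarrow> (norm (D t))\<^sup>2" by (intro tendsto_intros)
    have l2: "(\<lambda>n. 2 * set_lebesgue_integral N {0<..?R n} ?g) \<longlonglongrightarrow> 2 * set_lebesgue_integral N {0<..t} ?g"
      by (intro tendsto_intros lim primitive_inner_integrable)
    show ?thesis using grid[OF R(3)] by (intro LIMSEQ_le[OF l1 l2]) blast
  qed
qed

end

end

section \<open>Gronwall's lemma for an integrable kernel\<close>

context evolution
begin

text \<open>Let \<open>r\<close> be the supremum of the times up to which \<open>\<phi>\<close>
  vanishes. If \<open>r < T\<close>, then \<open>a\<close> has small integral on a short interval
  after \<open>r\<close>, where the hypothesis halves every bound on \<open>\<phi>\<close>; so
  \<open>\<phi>\<close> vanishes beyond \<open>r\<close>, a contradiction.\<close>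

lemma gronwall_zero:
  fixes \<phi> :: "real \<Rightarrow> real"
  assumes meas: "\<phi> \<in> borel_measurable L" and nn: "\<And>t. t \<in> {0..T} \<Longrightarrow> 0 \<le> \<phi> t"
    and bd: "\<And>t. t \<in> {0..T} \<Longrightarrow> \<phi> t \<le> C"
    and le: "\<And>t. t \<in> {0..T} \<Longrightarrow> \<phi> t \<le> 2 * set_lebesgue_integral L {0<..t} (\<lambda>s. a s * \<phi> s)"
    and t: "t \<in> {0..T}"
  shows "\<phi> t = 0"
proof -
  have C0: "0 \<le> C" using nn[of 0] bd[of 0] T_pos by simp
  have int: "integrable L (\<lambda>s. a s * \<phi> s)"
  proof (rule Bochner_Integration.integrable_bound)
    show "integrable L (\<lambda>s. a s * C)" by (intro integrable_mult_left a_integrable)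
    show "(\<lambda>s. a s * \<phi> s) \<in> borel_measurable L"
      using a_integrable meas by (intro borel_measurable_times) auto
    have "norm (a s * \<phi> s) \<le> norm (a s * C)" if "s \<in> space L" for s
      using nn[of s] bd[of s] that a_nonneg[of s] C0 by (auto simp: leb.space_N abs_mult intro!: mult_left_mono)
    then show "AE s in L. norm (a s * \<phi> s) \<le> norm (a s * C)" by (rule AE_I2)
  qed
  define S where "S = {r \<in> {0..T}. \<forall>s\<in>{0..r}. \<phi> s = 0}"
  have S0: "0 \<in> S"
    using le[of 0] nn[of 0] T_pos by (auto simp: S_def set_lebesgue_integral_def)
  have bddS: "bdd_above S" by (rule bdd_aboveI[of _ T]) (auto simp: S_def)
  define r where "r = Sup S"
  have r: "0 \<le> r" "r \<le> T"
    unfolding r_def using S0 bddS by (auto intro: cSup_upper intro!: cSup_least simp: S_def)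
  have z: "\<phi> s = 0" if s: "0 \<le> s" "s < r" for s
  proof -
    obtain q where "q \<in> S" "s < q" using less_cSup_iff[OF _ bddS, of s] S0 s(2) unfolding r_def by blast
    then show ?thesis using s by (auto simp: S_def)
  qed
  have int0: "set_lebesgue_integral L {0<..r} (\<lambda>s. a s * \<phi> s) = 0"
  proof -
    have "norm (set_lebesgue_integral L {0<..r} (\<lambda>s. a s * \<phi> s)) \<le> set_lebesgue_integral L {0<..r} (\<lambda>s. 0)"
    proof (rule norm_set_integral_L_le[OF int])
      show "AE s in L. s \<in> {0<..<r} \<longrightarrow> norm (a s * \<phi> s) \<le> 0"
        by (intro AE_I2) (auto simp: z)
    qed (use r in auto)
    then show ?thesis by (simp add: set_lebesgue_integral_def)
  qed
  \<comment> \<open>The integral inequality gives the value at \<open>r\<close>, since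
    \<open>\<phi>\<close> need not be continuous.\<close>
  have zr: "\<phi> r = 0" using le[of r] nn[of r] r int0 by simp
  have "r = T"
  proof (rule ccontr)
    assume "r \<noteq> T"
    then have rT: "r < T" using r by simp
    define R where "R n = r + (T - r) / real (Suc n)" for n
    have R: "r < R n" "R n \<le> T" for n
    proof -
      have "0 < (T - r) / real (Suc n)" using rT by (intro divide_pos_pos) auto
      moreover have "(T - r) / real (Suc n) \<le> (T - r) / 1" using rT by (intro divide_left_mono) auto
      ultimately
      show "r < R n" "R n \<le> T" by (auto simp: R_def)
    qed
    have "(\<lambda>n. r + (T - r) * (1 / real (Suc n))) \<longlonglongrightarrow> r + (T - r) * 0"
      by (intro tendsto_intros LIMSEQ_Suc[OF lim_inverse_n'])
    then have Rlim: "R \<longlonglongrightarrow> r" by (simp add: R_def[abs_def])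
    have "(\<lambda>n. set_lebesgue_integral L {r<..R n} a) \<longlonglongrightarrow> set_lebesgue_integral L {r<..r} a"
      using R by (intro leb.set_integral_right_limit a_integrable r(1) Rlim) (auto intro: less_imp_le)
    then have "(\<lambda>n. aint r (R n)) \<longlonglongrightarrow> 0" by (simp only: aint_def[symmetric] aint_refl)
    \<comment> \<open>With the factor 2 of the hypothesis, \<open>1/4\<close> yields contraction by
      one half.\<close>
    then have "eventually (\<lambda>n. aint r (R n) < 1/4) sequentially" by (intro order_tendstoD(2)) auto
    then obtain n where n: "aint r (R n) < 1/4" by (auto simp: eventually_sequentially)
    define q where "q = R n"
    have q: "r < q" "q \<le> T" "aint r q < 1/4" using R n by (auto simp: q_def)
    have halve: "\<phi> s \<le> C / 2 ^ j" if "s \<in> {r..q}" for s j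
      using that
    proof (induction j arbitrary: s)
      case 0
      then show ?case using bd[of s] r q by simp
    next
      case (Suc j)
      have s: "r \<le> s" "s \<le> q" "s \<le> T" using Suc.prems q by auto
      have "set_lebesgue_integral L {0<..s} (\<lambda>s. a s * \<phi> s) = set_lebesgue_integral L {r<..s} (\<lambda>s. a s * \<phi> s)"
        using set_integral_Ioc_add[OF int, of 0 r s] r s int0 by simp
      also have "\<dots> \<le> norm (set_lebesgue_integral L {r<..s} (\<lambda>s. a s * \<phi> s))" by simp
      also have "\<dots> \<le> set_lebesgue_integral L {r<..s} (\<lambda>s. a s * (C / 2 ^ j))"
      proof (rule norm_set_integral_L_le[OF int])
        show "integrable L (\<lambda>s. a s * (C / 2 ^ j))" by (intro integrable_mult_left a_integrable)
        have "norm (a x * \<phi> x) \<le> a x * (C / 2 ^ j)" if "x \<in> {r<..<s}" for x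
        proof -
          have "norm (a x * \<phi> x) = a x * \<phi> x" using nn[of x] a_nonneg[of x] that r s by simp
          also have "\<dots> \<le> a x * (C / 2 ^ j)"
            using that s by (intro mult_left_mono Suc.IH a_nonneg) auto
          finally show ?thesis .
        qed
        then show "AE x in L. x \<in> {r<..<s} \<longrightarrow> norm (a x * \<phi> x) \<le> a x * (C / 2 ^ j)" by simp
      qed (use r s in auto)
      also have "\<dots> = aint r s * (C / 2 ^ j)"
        unfolding aint_def by (rule set_integral_mult_left)
      also have "\<dots> \<le> 1 / 4 * (C / 2 ^ j)"
      proof (rule mult_right_mono)
        have "aint r q = aint r s + aint s q" using r s q by (intro aint_add) auto
        then show "aint r s \<le> 1 / 4" using q aint_nonneg[of s q] by simp
      qed (use C0 in simp)
      finally have "\<phi> s \<le> 2 * (1 / 4 * (C / 2 ^ j))"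
        using le[of s] r s by simp
      then show ?case by (simp add: field_simps)
    qed
    have "\<phi> s = 0" if s: "s \<in> {r..q}" for s
    proof -
      have "(\<lambda>j. C * (1 / 2) ^ j) \<longlonglongrightarrow> C * 0" by (intro tendsto_intros LIMSEQ_realpow_zero) auto
      moreover have "\<phi> s \<le> C * (1 / 2) ^ j" for j using halve[OF s, of j] by (simp add: power_divide)
      ultimately have "\<phi> s \<le> C * 0" by (intro LIMSEQ_le_const) auto
      then show ?thesis using nn[of s] s r q by simp
    qed
    then have "q \<in> S" using z r q by (auto simp: S_def not_less) (metis atLeastAtMost_iff not_less)
    then have "q \<le> r" unfolding r_def using bddS by (rule cSup_upper)
    then show False using q by simp
  qed
  then show ?thesis using z[of t] zr t by (cases "t = T") auto
qed

section \<open>The measure \<open>\<nu>\<close>\<close>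

abbreviation N :: "real measure" where "N \<equiv> nu_measure T \<rho>"

lemma sets_stieltjes_eq: "sets (stieltjes_measure_I T \<rho>) = sets L"
  by (simp add: stieltjes_measure_I_def lebesgue_measure_I_def sets_restrict_space)

lemma emeasure_nu: "X \<in> sets L \<Longrightarrow> emeasure N X = emeasure L X + emeasure (stieltjes_measure_I T \<rho>) X"
  unfolding nu_measure_def by (rule emeasure_sum_of_measures[OF sets_stieltjes_eq])

text \<open>The extension of \<open>\<rho>\<close> is constant on \<open>]-1,0]\<close>, so this
  interval, which contains 0, has no mass.\<close>

lemma emeasure_stieltjes_0: "emeasure (stieltjes_measure_I T \<rho>) {0} = 0"
proof -
  let ?F = "\<lambda>t. \<rho> (max 0 (min T t))"
  have F_mono: "?F x \<le> ?F y" if "x \<le> y" for x y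
    using T_pos that by (intro rho_le) auto
  have F_rc: "continuous (at_right b) ?F" for b
  proof -
    have "\<forall>\<^sub>F x in at_right b. b < x" by (rule eventually_at_right_less)
    moreover have "\<forall>\<^sub>F x in at_right b. b < 0 \<longrightarrow> x < 0"
      by (cases "b < 0") (auto intro: eventually_at_right_real[THEN eventually_mono])
    moreover have "\<forall>\<^sub>F x in at_right b. b < T \<longrightarrow> x < T"
      by (cases "b < T") (auto intro: eventually_at_right_real[THEN eventually_mono])
    ultimately have "\<forall>\<^sub>F x in at_right b. (if 0 \<le> b \<and> b < T then \<rho> x else ?F b) = ?F x"
      by eventually_elim (use T_pos in auto)
    moreover have "((\<lambda>x. if 0 \<le> b \<and> b < T then \<rho> x else ?F b) \<longlongrightarrow> ?F b) (at_right b)"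
    proof (cases "0 \<le> b \<and> b < T")
      case True
      then show ?thesis using rho_right_continuous[of b] by (simp add: continuous_within)
    next
      case False
      then show ?thesis by (simp only: if_False tendsto_const)
    qed
    ultimately show ?thesis
      unfolding continuous_within by (rule Lim_transform_eventually[rotated])
  qed
  have "emeasure (stieltjes_measure_I T \<rho>) {0} = emeasure (interval_measure ?F) {0}"
    unfolding stieltjes_measure_I_def using T_pos by (intro emeasure_restrict_space) auto
  also have "\<dots> \<le> emeasure (interval_measure ?F) {-1<..0}" by (intro emeasure_mono) auto
  also have "\<dots> = ennreal (?F 0 - ?F (-1))"
    by (intro emeasure_interval_measure_Ioc F_mono F_rc) auto
  also have "\<dots> = 0" using T_pos by simp
  finally show ?thesis by simp
qed

sublocale nu: time_change_measure T \<theta> N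
proof
  show "sets N = sets (restrict_space borel {0..T})" by (rule sets_nu_measure)
  show "emeasure N {s<..t} = ennreal (\<theta> t - \<theta> s)" if st: "0 \<le> s" "s \<le> t" "t \<le> T" for s t
  proof -
    have "emeasure N {s<..t} = ennreal (t - s) + ennreal (\<rho> t - \<rho> s)"
      using st leb.sets_N_Ioc[of s t] emeasure_stieltjes_measure_I_Ioc[OF rho_mono rho_right_continuous st]
      by (simp add: emeasure_nu emeasure_L_Ioc)
    also have "\<dots> = ennreal (\<theta> t - \<theta> s)"
      using st rho_le[OF st] by (subst ennreal_plus[symmetric]) (auto simp: \<theta>_def algebra_simps)
    finally show ?thesis .
  qed
  have "{0} \<in> sets L" unfolding sets_L using T_pos by (auto simp: sets_restrict_space_iff)
  then show "emeasure N {0} = 0"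
    by (simp add: emeasure_nu leb.emeasure_N_0 emeasure_stieltjes_0)
qed

lemma sets_N_L: "sets N = sets L"
  by (simp add: nu.sets_N sets_L)

abbreviation \<beta> :: "real \<Rightarrow> real" where "\<beta> \<equiv> lebesgue_density T \<rho>"

lemma beta_nonneg: "0 \<le> \<beta> t"
  by (simp add: lebesgue_density_def)

lemma beta_measurable [measurable]: "\<beta> \<in> borel_measurable N"
  unfolding lebesgue_density_def[abs_def] by measurable

text \<open>The conversion of the Radon-Nikodym derivative to a real number changes it only on a
  null set, because it is finite almost everywhere for the sigma-finite measure
  \<open>L\<close>.\<close>

lemma density_beta: "density N (\<lambda>t. ennreal (\<beta> t)) = L"
proof -
  have ac: "absolutely_continuous N L"
  proof (unfold absolutely_continuous_def, rule subsetI)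
    fix X assume "X \<in> null_sets N"
    then have "emeasure N X = 0" "X \<in> sets L" by (auto simp: null_sets_def sets_N_L)
    then show "X \<in> null_sets L" by (simp add: emeasure_nu null_sets_def)
  qed
  have "AE t in N. RN_deriv N L t \<noteq> \<infinity>"
    by (rule nu.RN_deriv_finite[OF leb.sigma_finite_measure_axioms ac sets_N_L[symmetric]])
  then have "AE t in N. RN_deriv N L t = ennreal (\<beta> t)"
    by eventually_elim (simp add: lebesgue_density_def less_top)
  then have "density N (RN_deriv N L) = density N (\<lambda>t. ennreal (\<beta> t))"
    by (intro density_cong) auto
  then show ?thesis using nu.density_RN_deriv[OF ac sets_N_L[symmetric]] by simp
qed

lemma
  fixes g :: "real \<Rightarrow> 'b::{banach, second_countable_topology}"
  assumes g: "integrable L g"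
  shows beta_integrable: "integrable N (\<lambda>t. \<beta> t *\<^sub>R g t)"
    and beta_set_integral: "\<And>t. 0 \<le> t \<Longrightarrow> t \<le> T \<Longrightarrow>
      set_lebesgue_integral N {0<..t} (\<lambda>s. \<beta> s *\<^sub>R g s) = set_lebesgue_integral L {0<..t} g"
proof -
  have gm: "g \<in> borel_measurable N"
    using borel_measurable_integrable[OF g] by (simp add: measurable_cong_sets[OF sets_N_L refl])
  have "integrable (density N (\<lambda>t. ennreal (\<beta> t))) g" using g by (simp add: density_beta)
  then show "integrable N (\<lambda>t. \<beta> t *\<^sub>R g t)"
    by (subst (asm) integrable_density[OF gm beta_measurable]) (auto simp: beta_nonneg)
  fix t assume t: "0 \<le> t" "t \<le> T"
  have im: "(\<lambda>s. indicator {0<..t} s *\<^sub>R g s) \<in> borel_measurable N"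
    using gm t by (intro borel_measurable_scaleR borel_measurable_indicator) auto
  have "set_lebesgue_integral L {0<..t} g = (\<integral>s. indicator {0<..t} s *\<^sub>R g s \<partial>density N (\<lambda>t. ennreal (\<beta> t)))"
    by (simp add: density_beta set_lebesgue_integral_def)
  also have "\<dots> = (\<integral>s. \<beta> s *\<^sub>R (indicator {0<..t} s *\<^sub>R g s) \<partial>N)"
    by (rule integral_density[OF im beta_measurable]) (auto simp: beta_nonneg)
  finally show "set_lebesgue_integral N {0<..t} (\<lambda>s. \<beta> s *\<^sub>R g s) = set_lebesgue_integral L {0<..t} g"
    by (simp add: set_lebesgue_integral_def mult.commute)
qed

text \<open>A Lebesgue null set may carry positive \<open>\<nu>\<close>-mass, as an atom does, but
  \<open>\<beta>\<close> vanishes there almost everywhere. In the inclusion the term of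
  \<open>f\<close> has the factor \<open>\<beta>\<close>, so this transfer is enough for the
  Lipschitz bound.\<close>

lemma AE_beta_pos:
  assumes "AE t in L. P t"
  shows "AE t in N. 0 < \<beta> t \<longrightarrow> P t"
proof -
  have "AE t in density N (\<lambda>t. ennreal (\<beta> t)). P t" using assms by (subst density_beta)
  then show ?thesis by (subst (asm) AE_density) auto
qed

section \<open>Existence\<close>

text \<open>Maximality reduces the inclusion to one inequality for each pair of the graph. Division
  of the block inequality by the mass of the block leaves the error
  \<open>\<kappa> n + eps n\<close>, which vanishes by right continuity of
  \<open>\<theta>\<close>.\<close>

lemma u_inclusion:
  assumes t: "0 < t" "t \<le> T" and lim: "(\<lambda>i. nu.quotient_fun U (r i) t) \<longlonglongrightarrow> v" and r: "strict_mono r"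
  shows "- v \<in> A t (u t)"
proof (rule maximal_monotone_mem)
  show "maximal_monotone (A t)" using A_maximal t by simp
  fix x y assume y: "y \<in> A t x"
  let ?K = "(1 + M) * (1 + M + norm y)"
  define \<kappa> where "\<kappa> n = \<theta> (grid n (Suc (block n t))) - \<theta> t" for n
  have "- (?K * (\<kappa> n + eps n)) \<le> (- nu.quotient_fun U n t - y) \<bullet> (u t - x)" for n
  proof -
    note b = block_props[OF t, where n=n]
    let ?k = "block n t"
    let ?\<nu> = "\<theta> (grid n (Suc ?k)) - \<theta> (grid n ?k)"
    \<comment> \<open>A block that contains \<open>t\<close> is nondegenerate, so the division by
      its mass is legitimate.\<close>
    have "\<theta> (grid n ?k) < \<theta> (grid n (Suc ?k))"
      using b grid_bounds[of ?k n] grid_bounds[of "Suc ?k" n] by (intro theta_less) auto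
    then have nu: "0 < ?\<nu>" by simp
    have q: "nu.quotient_fun U n t = (U (grid n (Suc ?k)) - U (grid n ?k)) /\<^sub>R ?\<nu>"
      by (simp add: nu.quotient_fun_eq[OF t] nu.quotient_def)
    have "- (?K * (?\<nu> * (\<kappa> n + eps n))) \<le> (- (U (grid n (Suc ?k)) - U (grid n ?k)) - ?\<nu> *\<^sub>R y) \<bullet> (u t - x)"
      unfolding \<kappa>_def by (rule block_test_inequality[OF b y])
    also have "- (U (grid n (Suc ?k)) - U (grid n ?k)) - ?\<nu> *\<^sub>R y = ?\<nu> *\<^sub>R (- nu.quotient_fun U n t - y)"
      using nu by (simp add: q scaleR_diff_right)
    finally have "?\<nu> * (- (?K * (\<kappa> n + eps n))) \<le> ?\<nu> * ((- nu.quotient_fun U n t - y) \<bullet> (u t - x))"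
      by (simp add: mult.left_commute)
    then show ?thesis by (rule mult_left_le_imp_le) (rule nu)
  qed
  then have "- (?K * (\<kappa> (r i) + eps (r i))) \<le> (- nu.quotient_fun U (r i) t - y) \<bullet> (u t - x)" for i .
  moreover have "(\<lambda>i. (- nu.quotient_fun U (r i) t - y) \<bullet> (u t - x)) \<longlonglongrightarrow> (- v - y) \<bullet> (u t - x)"
    by (intro tendsto_intros lim)
  moreover have "(\<lambda>i. - (?K * (\<kappa> (r i) + eps (r i)))) \<longlonglongrightarrow> - (?K * (0 + 0))"
  proof (intro tendsto_intros)
    have "\<kappa> \<longlonglongrightarrow> 0"
      unfolding \<kappa>_def using tendsto_diff[OF theta_block_tendsto[OF t] tendsto_const[of "\<theta> t"]] by simp
    from LIMSEQ_subseq_LIMSEQ[OF this r] show "(\<lambda>i. \<kappa> (r i)) \<longlonglongrightarrow> 0" by (simp add: o_def)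
    from LIMSEQ_subseq_LIMSEQ[OF eps_tendsto_0 r] show "(\<lambda>i. eps (r i)) \<longlonglongrightarrow> 0" by (simp add: o_def)
  qed
  ultimately have "- (?K * (0 + 0)) \<le> (- v - y) \<bullet> (u t - x)"
    by (intro LIMSEQ_le[where X="\<lambda>i. - (?K * (\<kappa> (r i) + eps (r i)))"]) auto
  then show "0 \<le> (- v - y) \<bullet> (u t - x)" by simp
qed

lemma BVRC_u: "BVRC T u"
  unfolding BVRC_def
proof (intro conjI ballI)
  show "bounded_variation_on {0..T} u"
    unfolding bounded_variation_on_def
  proof (rule bdd_aboveI[where M="M * \<theta> T"], clarsimp)
    fix n and \<tau> :: "nat \<Rightarrow> real"
    assume mono: "strict_mono_on {0..n} \<tau>" and im: "\<tau> ` {0..n} \<subseteq> {0..T}"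
    have in_I: "0 \<le> \<tau> k" "\<tau> k \<le> T" if "k \<le> n" for k using im that by (auto simp: image_subset_iff)
    have "(\<Sum>k=1..j. norm (u (\<tau> k) - u (\<tau> (k - 1)))) \<le> M * (\<theta> (\<tau> j) - \<theta> (\<tau> 0))" if "j \<le> n" for j
      using that
    proof (induction j)
      case (Suc j)
      have "\<tau> j \<le> \<tau> (Suc j)" using strict_mono_onD[OF mono, of j "Suc j"] Suc.prems by simp
      then have "norm (u (\<tau> (Suc j)) - u (\<tau> j)) \<le> M * (\<theta> (\<tau> (Suc j)) - \<theta> (\<tau> j))"
        using in_I[of j] in_I[of "Suc j"] Suc.prems by (intro u_lipschitz) auto
      then show ?case using Suc by (simp add: algebra_simps)
    qed simp
    from this[OF order_refl] have "(\<Sum>k=1..n. norm (u (\<tau> k) - u (\<tau> (k - 1)))) \<le> M * (\<theta> (\<tau> n) - \<theta> (\<tau> 0))" .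
    also have "\<dots> \<le> M * \<theta> T"
      using theta_mono[of "\<tau> n" T] theta_nonneg[of "\<tau> 0"] in_I[of 0] in_I[of n] constants
      by (intro mult_left_mono) auto
    finally show "(\<Sum>k = Suc 0..n. norm (u (\<tau> k) - u (\<tau> (k - Suc 0)))) \<le> M * \<theta> T" by simp
  qed
next
  fix t assume t: "t \<in> {0..<T}"
  have "((\<lambda>s. M * (\<theta> s - \<theta> t)) \<longlongrightarrow> M * (\<theta> t - \<theta> t)) (at_right t)"
    using theta_right_continuous[of t] t by (intro tendsto_intros) auto
  then have lim: "((\<lambda>s. M * (\<theta> s - \<theta> t)) \<longlongrightarrow> 0) (at_right t)" by simp
  have "\<forall>\<^sub>F s in at_right t. norm (u s - u t) \<le> M * (\<theta> s - \<theta> t)"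
    using t eventually_at_right_real[of t T] by (auto elim!: eventually_mono intro!: u_lipschitz)
  from Lim_null_comparison[OF this lim] show "continuous (at_right t) u"
    by (simp add: continuous_within LIM_zero_iff)
qed

lemma solution_exists: "BVRC_solution T \<rho> A f u0 u"
proof -
  obtain r v where r: "strict_mono r" and v: "integrable N v"
    and conv: "AE t in N. (\<lambda>i. nu.quotient_fun U (r i) t) \<longlonglongrightarrow> v t"
    and U_eq: "\<And>t. 0 \<le> t \<Longrightarrow> t \<le> T \<Longrightarrow> U t = U 0 + set_lebesgue_integral N {0<..t} v"
  proof (rule nu.grid_differentiation[of U "M + m * B"])
    show "norm (U t - U s) \<le> (M + m * B) * (\<theta> t - \<theta> s)" if "0 \<le> s" "s \<le> t" "t \<le> T" for s t
      using that by (rule U_lipschitz)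
  next
    fix r v
    assume "strict_mono r" "integrable N v" "AE t in N. (\<lambda>i. nu.quotient_fun U (r i) t) \<longlonglongrightarrow> v t"
      "\<And>t. 0 \<le> t \<Longrightarrow> t \<le> T \<Longrightarrow> U t = U 0 + set_lebesgue_integral N {0<..t} v"
    then show thesis by (rule that)
  qed
  define v' where "v' t = v t - \<beta> t *\<^sub>R fu t" for t
  note bi = beta_integrable[OF fu_integrable]
  have "is_diff_density T N u v'"
    unfolding is_diff_density_def
  proof (intro conjI ballI)
    show "integrable N v'" unfolding v'_def using v bi by (rule Bochner_Integration.integrable_diff)
    fix t assume t: "t \<in> {0..T}"
    then have t': "0 \<le> t" "t \<le> T" by auto
    have "set_lebesgue_integral N {0<..t} v' = set_lebesgue_integral N {0<..t} v
        - set_lebesgue_integral N {0<..t} (\<lambda>s. \<beta> s *\<^sub>R fu s)"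
      unfolding v'_def using t'
      by (intro set_integral_diff(2) nu.set_integrable_N[OF v order_refl] nu.set_integrable_N[OF bi order_refl])
    then have v'_eq: "set_lebesgue_integral N {0<..t} v' = set_lebesgue_integral N {0<..t} v
        - set_lebesgue_integral L {0<..t} fu"
      unfolding beta_set_integral[OF fu_integrable t'] .
    have u_eq: "u t = U t - set_lebesgue_integral L {0<..t} fu" by (simp add: U_def)
    have "U t = u 0 + set_lebesgue_integral N {0<..t} v"
      unfolding U_eq[OF t'] by (simp add: U_def set_lebesgue_integral_def)
    then show "u t = u 0 + set_lebesgue_integral N {0<..t} v'"
      unfolding v'_eq u_eq by (simp only: add_diff_eq)
  qed
  \<comment> \<open>The time 0 lies in no block and is excluded as a null set.\<close>
  moreover have "AE t in N. - v' t \<in> (\<lambda>y. y + \<beta> t *\<^sub>R f t (u t)) ` A t (u t)"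
    using conv nu.AE_N_pos AE_space[of N]
  proof eventually_elim
    case (elim t)
    then have "- v t \<in> A t (u t)" by (intro u_inclusion[OF _ _ elim(1) r]) (auto simp: nu.space_N)
    moreover have "- v' t = - v t + \<beta> t *\<^sub>R f t (u t)" by (simp add: v'_def fu_def)
    ultimately show ?case by (rule rev_image_eqI)
  qed
  ultimately show ?thesis
    unfolding BVRC_solution_def using BVRC_u u_domain u_0 by blast
qed

section \<open>Uniqueness\<close>

lemma solution_unique:
  assumes w: "BVRC_solution T \<rho> A f u0 w" and w': "BVRC_solution T \<rho> A f u0 w'" and t: "t \<in> {0..T}"
  shows "w t = w' t"
proof -
  obtain v where v: "is_diff_density T N w v"
    and iv: "AE t in N. - v t \<in> (\<lambda>y. y + \<beta> t *\<^sub>R f t (w t)) ` A t (w t)" and w0: "w 0 = u0"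
    using w unfolding BVRC_solution_def by blast
  obtain v' where v': "is_diff_density T N w' v'"
    and iv': "AE t in N. - v' t \<in> (\<lambda>y. y + \<beta> t *\<^sub>R f t (w' t)) ` A t (w' t)" and w'0: "w' 0 = u0"
    using w' unfolding BVRC_solution_def by blast
  define D where "D s = w s - w' s" for s
  define d where "d s = v s - v' s" for s
  have vi: "integrable N v" "integrable N v'" using v v' by (auto simp: is_diff_density_def)
  have d: "integrable N d" unfolding d_def using vi by (rule Bochner_Integration.integrable_diff)
  have D: "D s = set_lebesgue_integral N {0<..s} d" if "0 \<le> s" "s \<le> T" for s
  proof -
    have "set_lebesgue_integral N {0<..s} d = set_lebesgue_integral N {0<..s} v - set_lebesgue_integral N {0<..s} v'"
      unfolding d_def using that by (intro set_integral_diff(2) nu.set_integrable_N vi) auto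
    moreover have "w s = w 0 + set_lebesgue_integral N {0<..s} v" "w' s = w' 0 + set_lebesgue_integral N {0<..s} v'"
    proof -
      have s: "s \<in> {0..T}" using that by simp
      show "w s = w 0 + set_lebesgue_integral N {0<..s} v"
        using v s unfolding is_diff_density_def by blast
      show "w' s = w' 0 + set_lebesgue_integral N {0<..s} v'"
        using v' s unfolding is_diff_density_def by blast
    qed
    ultimately show ?thesis by (simp add: D_def w0 w'0)
  qed
  define C where "C = (\<integral>s. norm (d s) \<partial>N)"
  have Dbd: "norm (D s) \<le> C" if "s \<in> {0..T}" for s
    unfolding C_def using nu.primitive_bound[OF d D] that by simp
  have Dm: "D \<in> borel_measurable L"
    using nu.primitive_measurable[OF d D] unfolding measurable_cong_sets[OF sets_N_L refl] .
  have aD: "integrable L (\<lambda>s. a s * (norm (D s))\<^sup>2)"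
  proof (rule Bochner_Integration.integrable_bound)
    show "integrable L (\<lambda>s. a s * C\<^sup>2)" by (intro integrable_mult_left a_integrable)
    show "(\<lambda>s. a s * (norm (D s))\<^sup>2) \<in> borel_measurable L"
      using a_integrable Dm by (intro borel_measurable_times borel_measurable_power borel_measurable_norm) auto
    have "norm (a s * (norm (D s))\<^sup>2) \<le> norm (a s * C\<^sup>2)" if "s \<in> space L" for s
      using Dbd[of s] that a_nonneg[of s] by (auto simp: leb.space_N abs_mult intro!: mult_left_mono power_mono)
    then show "AE s in L. norm (a s * (norm (D s))\<^sup>2) \<le> norm (a s * C\<^sup>2)" by (rule AE_I2)
  qed
  \<comment> \<open>Monotonicity of \<open>A s\<close> leaves only the difference of the
    \<open>f\<close> terms, weighted by \<open>\<beta>\<close>. As \<open>\<beta>\<close> is the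
    density of \<open>L\<close>, the energy estimate becomes a Lebesgue integral with kernel
    \<open>a\<close>.\<close>
  have mono: "AE s in N. D s \<bullet> d s \<le> \<beta> s * (a s * (norm (D s))\<^sup>2)"
    using iv iv' AE_beta_pos[OF f_lipschitz] AE_space[of N]
  proof eventually_elim
    case (elim s)
    have s: "s \<in> {0..T}" using elim(4) by (simp add: nu.space_N)
    obtain y where y: "y \<in> A s (w s)" "- v s = y + \<beta> s *\<^sub>R f s (w s)" using elim(1) by auto
    obtain y' where y': "y' \<in> A s (w' s)" "- v' s = y' + \<beta> s *\<^sub>R f s (w' s)" using elim(2) by auto
    have "0 \<le> (y - y') \<bullet> D s" unfolding D_def by (rule A_monotone[OF s y(1) y'(1)])
    moreover have "y - y' = - d s - \<beta> s *\<^sub>R (f s (w s) - f s (w' s))"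
    proof -
      have "y = - v s - \<beta> s *\<^sub>R f s (w s)" by (simp only: y(2) add_diff_cancel_right')
      moreover have "y' = - v' s - \<beta> s *\<^sub>R f s (w' s)" by (simp only: y'(2) add_diff_cancel_right')
      ultimately show ?thesis by (simp add: d_def scaleR_diff_right)
    qed
    ultimately have 1: "D s \<bullet> d s \<le> \<beta> s * - ((f s (w s) - f s (w' s)) \<bullet> D s)"
      by (simp add: inner_diff inner_commute algebra_simps)
    show ?case
    proof (cases "0 < \<beta> s")
      case True
      have "- ((f s (w s) - f s (w' s)) \<bullet> D s) \<le> norm (f s (w s) - f s (w' s)) * norm (D s)"
        using Cauchy_Schwarz_ineq2[of "f s (w s) - f s (w' s)" "D s"] by linarith
      also have "\<dots> \<le> (a s * norm (D s)) * norm (D s)"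
        using elim(3) True unfolding D_def by (intro mult_right_mono) auto
      finally have "- ((f s (w s) - f s (w' s)) \<bullet> D s) \<le> a s * (norm (D s))\<^sup>2"
        by (simp add: power2_eq_square mult.assoc)
      then show ?thesis using 1 True by (meson mult_left_mono order_trans less_imp_le)
    next
      case False
      then have "\<beta> s = 0" using beta_nonneg[of s] by simp
      then show ?thesis using 1 by simp
    qed
  qed
  have le: "(norm (D s))\<^sup>2 \<le> 2 * set_lebesgue_integral L {0<..s} (\<lambda>s. a s * (norm (D s))\<^sup>2)" if s: "s \<in> {0..T}" for s
  proof -
    have "(norm (D s))\<^sup>2 \<le> 2 * set_lebesgue_integral N {0<..s} (\<lambda>s. D s \<bullet> d s)"
      using s by (intro nu.energy_inequality[OF d D]) auto
    moreover have "set_lebesgue_integral N {0<..s} (\<lambda>s. D s \<bullet> d s)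
        \<le> set_lebesgue_integral N {0<..s} (\<lambda>s. \<beta> s *\<^sub>R (a s * (norm (D s))\<^sup>2))"
    proof (rule set_integral_mono_AE)
      show "set_integrable N {0<..s} (\<lambda>s. D s \<bullet> d s)"
        using s by (intro nu.set_integrable_N nu.primitive_inner_integrable[OF d D]) auto
      show "set_integrable N {0<..s} (\<lambda>s. \<beta> s *\<^sub>R (a s * (norm (D s))\<^sup>2))"
        using s by (intro nu.set_integrable_N beta_integrable aD) auto
      show "AE x\<in>{0<..s} in N. D x \<bullet> d x \<le> \<beta> x *\<^sub>R (a x * (norm (D x))\<^sup>2)"
        using mono by eventually_elim simp
    qed
    moreover have "set_lebesgue_integral N {0<..s} (\<lambda>s. \<beta> s *\<^sub>R (a s * (norm (D s))\<^sup>2))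
        = set_lebesgue_integral L {0<..s} (\<lambda>s. a s * (norm (D s))\<^sup>2)"
      using s by (intro beta_set_integral[OF aD]) auto
    ultimately show ?thesis by linarith
  qed
  have "(norm (D t))\<^sup>2 = 0"
  proof (rule gronwall_zero[OF _ _ _ le t])
    show "(\<lambda>s. (norm (D s))\<^sup>2) \<in> borel_measurable L"
      using Dm by measurable
    show "(norm (D s))\<^sup>2 \<le> C\<^sup>2" if "s \<in> {0..T}" for s
      using Dbd[OF that] by (intro power_mono) auto
  qed auto
  then show ?thesis by (simp add: D_def)
qed

end

theorem theorem3p1:
  fixes T :: real
    and A :: "real \<Rightarrow> 'a::{real_inner, banach, second_countable_topology} \<Rightarrow> 'a set"
    and f :: "real \<Rightarrow> 'a \<Rightarrow> 'a"
    and \<rho> \<alpha> :: "real \<Rightarrow> real"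
    and c m :: real
    and u0 :: 'a
  assumes "T > 0"
    and "\<And>t. t \<in> {0..T} \<Longrightarrow> maximal_monotone (A t)"
    and "\<rho> \<in> {0..T} \<rightarrow> {0..}"
    and "\<And>t. t \<in> {0..<T} \<Longrightarrow> continuous (at_right t) \<rho>"
    and "mono_on {0..T} \<rho>"
    and "\<rho> 0 = 0"
    and "\<And>s t. 0 \<le> s \<Longrightarrow> s \<le> t \<Longrightarrow> t \<le> T \<Longrightarrow>
           vladimirov_dis (A t) (A s) \<le> ereal (\<rho> t - \<rho> s)"
    and "c \<ge> 0"
    and "\<And>t x. t \<in> {0..T} \<Longrightarrow> x \<in> op_domain (A t) \<Longrightarrow>
           norm (min_section (A t) x) \<le> c * (1 + norm x)"
    and "\<And>x. (\<lambda>t. f t x) \<in> measurable (restrict_space borel {0..T}) borel"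
    and "m \<ge> 0"
    and "\<And>t x. t \<in> {0..T} \<Longrightarrow> norm (f t x) \<le> m * (1 + norm x)"
    and "integrable (lebesgue_on {0..T}) \<alpha>"
    and "\<And>t x y. t \<in> {0..T} \<Longrightarrow> norm (f t x - f t y) \<le> \<alpha> t * norm (x - y)"
    and "u0 \<in> op_domain (A 0)"
  shows "\<exists>u. BVRC_solution T \<rho> A f u0 u \<and>
           (\<forall>w. BVRC_solution T \<rho> A f u0 w \<longrightarrow> (\<forall>t \<in> {0..T}. w t = u t))"
proof -
  \<comment> \<open>Extension by zero moves \<open>\<alpha>\<close> to the whole line, where a
    function measurable for the completed measure has a Borel version \<open>g\<close>.\<close>
  let ?h = "\<lambda>t. indicator {0..T} t *\<^sub>R \<alpha> t"
  have hi: "integrable lebesgue ?h"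
    using integrable_restrict_space[of "{0..T}" lebesgue \<alpha>] assms(13) by simp
  then have "?h \<in> borel_measurable lebesgue" by (rule borel_measurable_integrable)
  then obtain g where g: "g \<in> borel_measurable lborel" and hg: "AE t in lborel. ?h t = g t"
    using completion_ex_borel_measurable_real by blast
  have "integrable lebesgue g"
    by (rule integrable_cong_AE_imp[OF hi measurable_completion[OF g] AE_completion[OF hg]])
  then have "integrable lborel g" using integrable_completion[OF g] by simp
  then have "integrable lborel (\<lambda>t. indicator {0..T} t *\<^sub>R \<bar>g t\<bar>)"
    by (intro integrable_mult_indicator integrable_abs) auto
  then have ai: "integrable (lebesgue_measure_I T) (\<lambda>t. \<bar>g t\<bar>)"
    unfolding lebesgue_measure_I_def using integrable_restrict_space[of "{0..T}" lborel "\<lambda>t. \<bar>g t\<bar>"] by simp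
  \<comment> \<open>Continuity at every time has to come from \<open>\<alpha>\<close> itself, since
    \<open>g\<close> controls \<open>f\<close> only almost everywhere. The absolute value provides a
    nonnegative Lipschitz constant.\<close>
  have cont: "continuous_on UNIV (f t)" if t: "t \<in> {0..T}" for t
  proof (rule lipschitz_on_continuous_on)
    show "\<bar>\<alpha> t\<bar>-lipschitz_on UNIV (f t)"
    proof (rule lipschitz_onI)
      fix x y
      have "norm (f t x - f t y) \<le> \<alpha> t * norm (x - y)" by (rule assms(14)[OF t])
      also have "\<dots> \<le> \<bar>\<alpha> t\<bar> * norm (x - y)" by (intro mult_right_mono) auto
      finally show "dist (f t x) (f t y) \<le> \<bar>\<alpha> t\<bar> * dist x y" by (simp add: dist_norm)
    qed simp
  qed
  have lip: "AE t in lebesgue_measure_I T. \<forall>x y. norm (f t x - f t y) \<le> \<bar>g t\<bar> * norm (x - y)"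
    unfolding lebesgue_measure_I_def
  proof (subst AE_restrict_space_iff)
    show "AE t in lborel. t \<in> {0..T} \<longrightarrow> (\<forall>x y. norm (f t x - f t y) \<le> \<bar>g t\<bar> * norm (x - y))"
      using hg
    proof eventually_elim
      case (elim t)
      show ?case
      proof (intro impI allI)
        fix x y assume t: "t \<in> {0..T}"
        have "norm (f t x - f t y) \<le> \<alpha> t * norm (x - y)" by (rule assms(14)[OF t])
        also have "\<dots> \<le> \<bar>g t\<bar> * norm (x - y)"
          using elim t by (intro mult_right_mono) auto
        finally show "norm (f t x - f t y) \<le> \<bar>g t\<bar> * norm (x - y)" .
      qed
    qed
  qed simp
  have fm: "(\<lambda>t. f t x) \<in> borel_measurable (lebesgue_measure_I T)" for x
  proof -
    have "sets (lebesgue_measure_I T) = sets (restrict_space borel {0..T})"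
      by (simp add: lebesgue_measure_I_def sets_restrict_space)
    from measurable_cong_sets[OF this refl] show ?thesis using assms(10)[of x] by blast
  qed
  interpret evolution T A f \<rho> "\<lambda>t. \<bar>g t\<bar>" c m u0
  proof
    show "vladimirov_dis (A t) (A s) \<le> ereal (\<rho> t - \<rho> s)" if "0 \<le> s" "s \<le> t" "t \<le> T" for s t
      using that by (rule assms(7))
    show "norm (min_section (A t) x) \<le> c * (1 + norm x)" if "t \<in> {0..T}" "x \<in> op_domain (A t)" for t x
      using that by (rule assms(9))
  qed (fact assms(1) assms(2) assms(4) assms(5) assms(6) assms(8) assms(11) assms(12) assms(15)
      fm ai lip cont abs_ge_zero)+
  show ?thesis using solution_exists solution_unique by blast
qed

end
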